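(* Let $A_{-2}\ge 0$, $A_0,A_1,A_2\in\mathbb R$, $A_3\le 0$, and suppose that either $\{A_{-2}=0,\ A_3<0\}$ or $\{A_{-2}>0,\ A_3=0\}$, with $A_2/(\omega_0A_{-2})\notin\mathbb Z$ in the latter case. Consider the equation $$\big(1-A_{-2}\,\partial_x^2\big)u_t = iA_0u+A_1u_x+iA_2u_{xx}+A_3u_{xxx},\qquad x>0,\ t>0,$$ with sufficiently smooth and decaying initial datum and Dirichlet datum $u(0,t)=g_0(t)$, $t>0$, where $g_0\in C^\infty(0,\infty)$ and $g_0(t)\sim\sum_{n\in\mathbb Z}a_ne^{in\omega_0t}$ as $t\to\infty$, with $\omega_0\ge0$, $a_n\in\mathbb C$ and the sum absolutely convergent; assume that the initial and boundary data satisfy the necessary compatibility conditions at the origin, and that the solution $u(x,t)$ and its boundary values $\partial_x^ju(0,t)$, $j\in\mathbb N$, are asymptotically time-periodic. Let $$\omega(k)=\frac{-A_0-A_1k+A_2k^2+A_3k^3}{1+A_{-2}k^2}$$ be the dispersion relation. For each $n\in\mathbb Z$ let $k_0(n)$ be the root, lying on $\partial D^+$, of $A_3k^3+(A_2+n\omega_0A_{-2})k^2-A_1k-A_0+n\omega_0=0$, where $D^+=\{k\in\mathbb C:\operatorname{Im}(k)>0,\ \operatorname{Re}(i\,\omega(k))<0\}$. Then: (1) $k_0(n)$ is the unique branch of the dispersion relation satisfying $n\omega_0=-\omega(k_0(n))$ if and only if the radiation condition holds, namely $$k_0(n)\in\mathbb R\ \text{ and }\ c_g=\omega'(k_0(n))\ge0,\qquad\text{or}\qquad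 \operatorname{Im}k_0(n)>0.$$ That is, among the solutions $k$ of $\omega(k)=-n\omega_0$, the one equal to $k_0(n)$ is characterized by the radiation condition. (2) The asymptotic solution of the wavemaker problem, i.e. the initial-boundary value problem consisting of the equation $\big(1-A_{-2}\,\partial_x^2\big)u_t = iA_0u+A_1u_x+iA_2u_{xx}+A_3u_{xxx}$ for $x>0$, $t>0$, the zero initial datum $u(x,0)=0$, $x>0$, and the Dirichlet datum $u(0,t)=g_0(t)$, $t>0$, takes the form $$u(x,t)\sim\sum_{n\in\mathbb Z}a_ne^{i(k_0(n)x+n\omega_0t)},\qquad t\to\infty,\quad x=\mathcal O(1).$$ (3) There exist real numbers $\omega_{cr}^\pm$ (depending on the coefficients of the equation, not on $\omega_0$) such that $\operatorname{Im}k_0(1)=0$ if and only if $\omega_{cr}^-\le\omega_0\le\omega_{cr}^+$.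
   Context: "Asymptotically time-periodic" means $u(x,t)\sim\sum_{n\in\mathbb Z}U_n(x)e^{in\omega_0t}$ and $\partial_x^ju(0,t)\sim\sum_{n\in\mathbb Z}b_n^{(j)}e^{in\omega_0t}$ as $t\to\infty$, for some functions $U_n(x)$ and complex coefficients $b_n^{(j)}$. The group velocity is $c_g=d\omega/dk$, evaluated at the wavenumber under consideration. The cubic equation in the claim is equivalent to $\omega(k)=-n\omega_0$ (after clearing the denominator $1+A_{-2}k^2$); the minus sign arises because $\omega(k)$ is defined with respect to waves $e^{i(kx-\omega t)}$, while the boundary datum is expanded in $e^{in\omega_0t}$. The notation $x=\mathcal O(1)$ means $x$ is kept fixed (bounded) as $t\to\infty$. The solution is understood to decay as $x\to\infty$. *)

theory Defs
  imports "HOL-Analysis.Analysis" "HOL-Library.Nonpos_Ints"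
begin

text \<open>
  Throughout, the real coefficients are listed in the order \<open>Am A0 A1 A2 A3\<close>, where \<open>Am\<close> is the
  coefficient $A_{-2}$ of the mixed derivative $u_{xxt}$.
\<close>

definition admissible_coeffs :: "real \<Rightarrow> real \<Rightarrow> bool" where
  "admissible_coeffs Am A3 \<longleftrightarrow> (Am = 0 \<and> A3 < 0) \<or> (Am > 0 \<and> A3 = 0)"

text \<open>
  For \<open>Am > 0\<close> the frequency must satisfy $A_2/(\omega_0 A_{-2}) \notin Z$, that is,
  $A_2 + n\omega_0 A_{-2} \neq 0$ for all integers $n$. For \<open>\<omega>0 = 0\<close> this says \<open>A2 \<noteq> 0\<close>; that case
  is written out because the HOL convention \<open>A2 / 0 = 0\<close> would rule it out altogether.
\<close>

definition admissible_freq :: "real \<Rightarrow> real \<Rightarrow> real \<Rightarrow> bool" where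
  "admissible_freq Am A2 \<omega>0 \<longleftrightarrow>
     \<omega>0 \<ge> 0 \<and>
     (Am > 0 \<longrightarrow> (if \<omega>0 = 0 then A2 \<noteq> 0 else A2 / (\<omega>0 * Am) \<notin> \<int>))"

section \<open>Dispersion relation\<close>

definition omega :: "real \<Rightarrow> real \<Rightarrow> real \<Rightarrow> real \<Rightarrow> real \<Rightarrow> complex \<Rightarrow> complex" where
  "omega Am A0 A1 A2 A3 k =
     (- of_real A0 - of_real A1 * k + of_real A2 * k^2 + of_real A3 * k^3) / (1 + of_real Am * k^2)"

text \<open>
  The equation $\omega(k) = w$ at a wavenumber where $\omega$ is defined. The first conjunct excludes
  the poles $k = \pm i/\sqrt{A_{-2}}$, where HOL division gives the spurious value \<open>0\<close>.
\<close>

definition dispersion :: "real \<Rightarrow> real \<Rightarrow> real \<Rightarrow> real \<Rightarrow> real \<Rightarrow> complex \<Rightarrow> complex \<Rightarrow> bool" where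
  "dispersion Am A0 A1 A2 A3 k w \<longleftrightarrow>
     1 + of_real Am * k^2 \<noteq> 0 \<and> omega Am A0 A1 A2 A3 k = w"

text \<open>No such guard is needed here: at a pole \<open>omega\<close> is \<open>0\<close>, so the strict inequality fails.\<close>

definition Dplus :: "real \<Rightarrow> real \<Rightarrow> real \<Rightarrow> real \<Rightarrow> real \<Rightarrow> complex set" where
  "Dplus Am A0 A1 A2 A3 = {k. Im k > 0 \<and> Re (\<i> * omega Am A0 A1 A2 A3 k) < 0}"

definition boundary_root ::
  "real \<Rightarrow> real \<Rightarrow> real \<Rightarrow> real \<Rightarrow> real \<Rightarrow> real \<Rightarrow> int \<Rightarrow> complex \<Rightarrow> bool" where
  "boundary_root Am A0 A1 A2 A3 \<omega>0 n k \<longleftrightarrow>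
     of_real A3 * k^3 + of_real (A2 + of_int n * \<omega>0 * Am) * k^2
       - of_real A1 * k - of_real A0 + of_real (of_int n * \<omega>0) = 0 \<and>
     k \<in> frontier (Dplus Am A0 A1 A2 A3)"

text \<open>
  The group velocity is the complex derivative of \<open>omega\<close>; it is real at real \<open>k\<close>, and
  \<open>\<real>\<^sub>\<ge>\<^sub>0\<close> is the set of nonnegative reals inside the complex numbers.
\<close>

definition radiation_condition ::
  "real \<Rightarrow> real \<Rightarrow> real \<Rightarrow> real \<Rightarrow> real \<Rightarrow> complex \<Rightarrow> bool" where
  "radiation_condition Am A0 A1 A2 A3 k \<longleftrightarrow>
     (k \<in> \<real> \<and> deriv (omega Am A0 A1 A2 A3) k \<in> \<real>\<^sub>\<ge>\<^sub>0) \<or> Im k > 0"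

section \<open>Derivatives on subsets of the line\<close>

text \<open>
  Derivatives are taken within \<open>S\<close>, hence one-sided at a boundary point of \<open>S\<close> belonging to \<open>S\<close>.
\<close>

primrec nderiv_on :: "nat \<Rightarrow> real set \<Rightarrow> (real \<Rightarrow> complex) \<Rightarrow> real \<Rightarrow> complex" where
  "nderiv_on 0 S f = f"
| "nderiv_on (Suc n) S f = (\<lambda>x. vector_derivative (nderiv_on n S f) (at x within S))"

definition times_differentiable_on :: "nat \<Rightarrow> real set \<Rightarrow> (real \<Rightarrow> complex) \<Rightarrow> bool" where
  "times_differentiable_on m S f \<longleftrightarrow>
     (\<forall>n<m. \<forall>x\<in>S. nderiv_on n S f differentiable (at x within S))"

definition smooth_on_set :: "real set \<Rightarrow> (real \<Rightarrow> complex) \<Rightarrow> bool" where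
  "smooth_on_set S f \<longleftrightarrow> (\<forall>m. times_differentiable_on m S f)"

definition dx :: "nat \<Rightarrow> (real \<Rightarrow> real \<Rightarrow> complex) \<Rightarrow> real \<Rightarrow> real \<Rightarrow> complex" where
  "dx j u x t = nderiv_on j {0..} (\<lambda>y. u y t) x"

definition dt :: "(real \<Rightarrow> real \<Rightarrow> complex) \<Rightarrow> real \<Rightarrow> real \<Rightarrow> complex" where
  "dt u x t = nderiv_on 1 {0..} (u x) t"

section \<open>The initial-boundary value problem\<close>

text \<open>
  Continuity up to the boundary of the closed quadrant, with an integrable rate of decay as \<open>x\<close> tends
  to infinity that is uniform for \<open>t\<close> in bounded intervals; nothing is assumed about how the bound
  grows with the length \<open>T\<close> of the interval.
\<close>

definition continuous_decaying :: "(real \<Rightarrow> real \<Rightarrow> complex) \<Rightarrow> bool" where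
  "continuous_decaying f \<longleftrightarrow>
     continuous_on ({0..} \<times> {0..}) (\<lambda>(x, t). f x t) \<and>
     (\<forall>T. \<exists>C. \<forall>x\<ge>0. \<forall>t\<in>{0..T}. norm (f x t) \<le> C / (1 + x)^2)"

text \<open>
  Sufficiently smooth and decaying: the derivatives occurring in the equation exist, are
  continuous up to the boundary and decay. Since the corner \<open>x = t = 0\<close> is included, this entails the
  compatibility of the initial and boundary data. Smoothness of all orders in \<open>x\<close> for \<open>t > 0\<close>
  gives a meaning to all the boundary values $\partial_x^j u(0,t)$.
\<close>

definition regular_decaying :: "(real \<Rightarrow> real \<Rightarrow> complex) \<Rightarrow> bool" where
  "regular_decaying u \<longleftrightarrow>
     (\<forall>x\<ge>0. times_differentiable_on 1 {0..} (u x)) \<and>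
     (\<forall>t\<ge>0. times_differentiable_on 3 {0..} (\<lambda>x. u x t)) \<and>
     (\<forall>t\<ge>0. times_differentiable_on 2 {0..} (\<lambda>x. dt u x t)) \<and>
     (\<forall>t>0. smooth_on_set {0..} (\<lambda>x. u x t)) \<and>
     (\<forall>j\<le>3. continuous_decaying (dx j u)) \<and>
     (\<forall>j\<le>2. continuous_decaying (dx j (dt u)))"

definition ibvp_solution ::
  "real \<Rightarrow> real \<Rightarrow> real \<Rightarrow> real \<Rightarrow> real \<Rightarrow>
   (real \<Rightarrow> complex) \<Rightarrow> (real \<Rightarrow> complex) \<Rightarrow> (real \<Rightarrow> real \<Rightarrow> complex) \<Rightarrow> bool" where
  "ibvp_solution Am A0 A1 A2 A3 u0 g0 u \<longleftrightarrow>
     regular_decaying u \<and>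
     (\<forall>x>0. \<forall>t>0. dt u x t - of_real Am * dx 2 (dt u) x t =
        \<i> * of_real A0 * u x t + of_real A1 * dx 1 u x t
        + \<i> * of_real A2 * dx 2 u x t + of_real A3 * dx 3 u x t) \<and>
     (\<forall>x>0. u x 0 = u0 x) \<and>
     (\<forall>t>0. u 0 t = g0 t)"

section \<open>Asymptotic time-periodicity\<close>

text \<open>
  $f(t) \sim \sum_n c_n e^{in\omega_0 t}$ as $t \to \infty$: the series converges absolutely and the
  difference of the two sides tends to \<open>0\<close>.
\<close>

definition fourier_asymp :: "real \<Rightarrow> (real \<Rightarrow> complex) \<Rightarrow> (int \<Rightarrow> complex) \<Rightarrow> bool" where
  "fourier_asymp \<omega>0 f c \<longleftrightarrow>
     (\<lambda>n. norm (c n)) summable_on UNIV \<and>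
     ((\<lambda>t. f t - (\<Sum>\<^sub>\<infinity>n. c n * exp (\<i> * of_real (of_int n * \<omega>0 * t)))) \<longlongrightarrow> 0) at_top"

text \<open>
  The same with a parameter \<open>x\<close>, uniformly for \<open>x\<close> in \<open>X\<close>. A singleton \<open>X\<close> gives the asymptotics
  at a fixed \<open>x\<close>; intervals give locally uniform asymptotics.
\<close>

definition fourier_asymp_on ::
  "real set \<Rightarrow> real \<Rightarrow> (real \<Rightarrow> real \<Rightarrow> complex) \<Rightarrow> (int \<Rightarrow> real \<Rightarrow> complex) \<Rightarrow> bool" where
  "fourier_asymp_on X \<omega>0 u U \<longleftrightarrow>
     (\<forall>x\<in>X. (\<lambda>n. norm (U n x)) summable_on UNIV) \<and>
     uniform_limit X
       (\<lambda>t x. u x t - (\<Sum>\<^sub>\<infinity>n. U n x * exp (\<i> * of_real (of_int n * \<omega>0 * t)))) (\<lambda>x. 0) at_top"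

end

theory Submission
  imports Defs "HOL-Computational_Algebra.Fundamental_Theorem_Algebra" "HOL-Real_Asymp.Real_Asymp"
begin

text \<open>
  In the upper half-plane $\mathrm{Im}\,\omega$ has the sign of a real quadratic polynomial
  (\<open>dsym\<close>), whose restriction to the real axis has the sign of $\omega'$. Hence boundary points of $D^+$
  satisfy the radiation condition, and divided differences show that at most one root does.
  For the asymptotics put $s = \varepsilon + i n \omega_0$ and
  $v_T(x) = \int_0^T e^{-st} u(x,t)\,dt$. Integrating the equation in time gives an ordinary differential
  equation in $x$ whose symbol has exactly one root $k(s)$ in the upper half-plane, and whose right-hand side
  is $e^{-sT}$ times a function that grows polynomially in $T$ by an energy estimate. Integrating
  the growing factors from $x = \infty$ gives $v_T(x) - e^{ik(s)x} v_T(0) \to 0$ as $T \to \infty$.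
  Letting then $\varepsilon \to 0$, an Abelian argument extracts the $n$-th Fourier coefficients, while
  $k(s)$ tends to a root in the closure of $D^+$, which is $k_0(n)$ by uniqueness.
\<close>

section \<open>The symbol of the dispersion relation\<close>

text \<open>The decay hypotheses bound \<open>u\<close> only on bounded time intervals, by constants
  whose growth in \<open>T\<close> is unknown, so a Laplace transform over all times is not known to
  exist on the whole half-line. This is why the time integral stops at \<open>T\<close>. Those
  bounds serve only qualitatively, to discard boundary terms at x = infinity; the quantitative
  growth in \<open>T\<close> comes from the energy, whose only input is boundary data, bounded
  because they are asymptotically periodic. The shift \<epsilon> > 0 keeps all roots off the real
  axis. On the axis itself incoming and outgoing roots can be real at once and may even coincide,
  and no dichotomy between growing and decaying modes is left. The limit \<epsilon> -> 0 is not
  found by following a branch of roots: the inequalities for \<open>Im k\<close> and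
  \<open>dsym\<close> are closed, hence survive the limit, and they admit a single root. If
  \<omega>0 = 0, all modes have the same frequency and only the sum of their coefficients is
  recovered. This suffices, because \<open>k0 n\<close> is then independent of n.\<close>

definition dsym :: "real \<Rightarrow> real \<Rightarrow> real \<Rightarrow> real \<Rightarrow> real \<Rightarrow> complex \<Rightarrow> real" where
  "dsym Am A0 A1 A2 A3 k =
     - A1 + 2 * (A2 + Am * A0) * Re k + Am * A1 * ((Re k)\<^sup>2 + (Im k)\<^sup>2) + A3 * (3 * (Re k)\<^sup>2 - (Im k)\<^sup>2)"

text \<open>With N and D the numerator and denominator of \<open>omega\<close>, \<open>dsym\<close>
  is what remains of Im (N cnj D) after \<open>Im k\<close> is divided out. One further term, of
  degree four, carries the factor \<open>Am * A3\<close>, which is zero in both admissible families;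
  so a quadratic is left.\<close>

lemma Im_omega:
  assumes "Am * A3 = 0" "1 + of_real Am * k^2 \<noteq> 0"
  shows "Im (omega Am A0 A1 A2 A3 k) = Im k * dsym Am A0 A1 A2 A3 k / (cmod (1 + of_real Am * k^2))\<^sup>2"
proof -
  obtain x y where k: "k = Complex x y" by (cases k)
  have "Im ((- of_real A0 - of_real A1 * k + of_real A2 * k^2 + of_real A3 * k^3) * cnj (1 + of_real Am * k^2))
     = Im k * dsym Am A0 A1 A2 A3 k + Am * A3 * (Im k * ((Re k)\<^sup>2 + (Im k)\<^sup>2)\<^sup>2)"
    unfolding k dsym_def by (simp add: power2_eq_square power3_eq_cube algebra_simps)
  then show ?thesis using assms(1)
    unfolding omega_def by (subst complex_div_cnj) (simp add: Im_divide_of_real del: complex_cnj_add)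
qed

text \<open>At a pole \<open>omega\<close> has the HOL value 0, which keeps the pole out of
  \<open>Dplus\<close>. A pole in the upper half-plane is purely imaginary with
  \<open>Am * (Im k)\<^sup>2 = 1\<close>, so the terms of \<open>dsym\<close> cancel there as well,
  and the sign description of \<open>Dplus\<close> has no exceptional points.\<close>

lemma dsym_pole:
  assumes "1 + of_real Am * k^2 = 0" "Am * A3 = 0" "Im k > 0"
  shows "dsym Am A0 A1 A2 A3 k = 0"
proof -
  obtain x y where k: "k = Complex x y" by (cases k)
  have 1: "1 + Am * (x\<^sup>2 - y\<^sup>2) = 0" "Am * (x * y) = 0"
    using assms(1) unfolding k by (auto simp: complex_eq_iff power2_eq_square algebra_simps)
  have y: "y > 0" using assms(3) k by simp
  have "Am \<noteq> 0" using 1(1) by auto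
  then have "x = 0" "A3 = 0" using 1 y assms(2) by auto
  with 1 have "Am * y\<^sup>2 = 1" by simp
  with \<open>x = 0\<close> \<open>A3 = 0\<close> show ?thesis unfolding k dsym_def by simp
qed

text \<open>Since Re (i \<omega>) = - Im \<omega>, the division disappears and strict polynomial
  inequalities remain. Continuity then gives the weak inequalities on the closure.\<close>

lemma Dplus_eq:
  assumes "Am * A3 = 0"
  shows "Dplus Am A0 A1 A2 A3 = {k. Im k > 0 \<and> dsym Am A0 A1 A2 A3 k > 0}"
proof -
  have "Re (\<i> * omega Am A0 A1 A2 A3 k) < 0 \<longleftrightarrow> dsym Am A0 A1 A2 A3 k > 0" if "Im k > 0" for k
  proof (cases "1 + of_real Am * k^2 = 0")
    case True
    then have "omega Am A0 A1 A2 A3 k = 0" by (simp add: omega_def)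
    then show ?thesis using dsym_pole[OF True assms that] by simp
  next
    case False
    then show ?thesis using Im_omega[OF assms False] that
      by (simp add: zero_less_divide_iff zero_less_mult_iff)
  qed
  then show ?thesis unfolding Dplus_def by auto
qed

lemma closure_DplusD:
  assumes "Am * A3 = 0" "k \<in> closure (Dplus Am A0 A1 A2 A3)"
  shows "Im k \<ge> 0 \<and> dsym Am A0 A1 A2 A3 k \<ge> 0"
proof -
  have "closed {k. Im k \<ge> 0 \<and> dsym Am A0 A1 A2 A3 k \<ge> 0}"
    unfolding dsym_def by (intro closed_Collect_conj closed_Collect_le continuous_intros)
  moreover have "Dplus Am A0 A1 A2 A3 \<subseteq> {k. Im k \<ge> 0 \<and> dsym Am A0 A1 A2 A3 k \<ge> 0}"
    unfolding Dplus_eq[OF assms(1)] by auto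
  ultimately show ?thesis using assms(2) closure_minimal by blast
qed

text \<open>The same polynomial as in \<open>Im_omega\<close> has to appear: \<open>omega\<close> is
  real on the real axis, so Im \<omega> / Im k tends to \<omega>' there.\<close>

lemma deriv_omega_real:
  assumes "Am \<ge> 0" "Am * A3 = 0"
  shows "deriv (omega Am A0 A1 A2 A3) (of_real x)
    = of_real (dsym Am A0 A1 A2 A3 (of_real x) / (1 + Am * x\<^sup>2)\<^sup>2)"
proof -
  have pos: "1 + Am * x\<^sup>2 > 0" using assms by (simp add: add_pos_nonneg)
  have "(of_real (1 + Am * x\<^sup>2) :: complex) \<noteq> 0" using pos by (simp only: of_real_eq_0_iff)
  then have nz: "1 + of_real Am * (of_real x)^2 \<noteq> (0::complex)" by simp
  let ?x = "of_real x :: complex"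
  have "((\<lambda>k. (- of_real A0 - of_real A1 * k + of_real A2 * k^2 + of_real A3 * k^3) / (1 + of_real Am * k^2))
    has_field_derivative
    ((- of_real A1 + of_real A2 * (2 * ?x) + of_real A3 * (3 * ?x^2)) * (1 + of_real Am * ?x^2)
      - (- of_real A0 - of_real A1 * ?x + of_real A2 * ?x^2 + of_real A3 * ?x^3) * (of_real Am * (2 * ?x)))
      / ((1 + of_real Am * ?x^2) * (1 + of_real Am * ?x^2))) (at ?x)"
    using nz by (auto intro!: derivative_eq_intros)
  also have "(- of_real A1 + of_real A2 * (2 * ?x) + of_real A3 * (3 * ?x^2)) * (1 + of_real Am * ?x^2)
      - (- of_real A0 - of_real A1 * ?x + of_real A2 * ?x^2 + of_real A3 * ?x^3) * (of_real Am * (2 * ?x))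
      = of_real (dsym Am A0 A1 A2 A3 (of_real x) + Am * A3 * x^4)"
    unfolding dsym_def by (simp add: power2_eq_square power3_eq_cube power4_eq_xxxx algebra_simps)
  finally show ?thesis unfolding omega_def[abs_def] using assms(2)
    by (intro DERIV_imp_deriv) (simp add: power2_eq_square)
qed

lemma radiation_condition_iff:
  assumes "Am \<ge> 0" "Am * A3 = 0"
  shows "radiation_condition Am A0 A1 A2 A3 k \<longleftrightarrow>
    (Im k = 0 \<and> dsym Am A0 A1 A2 A3 k \<ge> 0) \<or> Im k > 0"
proof (cases "Im k = 0")
  case True
  then obtain x where k: "k = of_real x" by (metis complex_is_Real_iff Reals_cases)
  have pos: "1 + Am * x\<^sup>2 > 0" using assms by (simp add: add_pos_nonneg)
  show ?thesis unfolding radiation_condition_def k deriv_omega_real[OF assms]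
    using pos by (simp only: nonneg_Reals_of_real_iff) (simp add: zero_le_divide_iff)
next
  case False
  then show ?thesis by (auto simp: radiation_condition_def complex_is_Real_iff)
qed

section \<open>Polynomial form of the dispersion relation and uniqueness of the radiating
  root\<close>

definition dispoly :: "real \<Rightarrow> real \<Rightarrow> real \<Rightarrow> real \<Rightarrow> real \<Rightarrow> complex \<Rightarrow> complex \<Rightarrow> complex" where
  "dispoly Am A0 A1 A2 A3 w k =
     of_real A3 * k^3 + (of_real A2 - w * of_real Am) * k^2 - of_real A1 * k - of_real A0 - w"

text \<open>Clearing the denominator may add roots at the poles, hence the extra conjunct. The
  frequency \<open>w\<close> is complex because it is later moved off the real axis, to
  \<open>\<i> * s\<close> with \<open>Re s > 0\<close>.\<close>

lemma dispersion_iff: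
  "dispersion Am A0 A1 A2 A3 k w \<longleftrightarrow> 1 + of_real Am * k^2 \<noteq> 0 \<and> dispoly Am A0 A1 A2 A3 w k = 0"
  unfolding dispersion_def omega_def dispoly_def
  by (auto simp: divide_eq_eq algebra_simps)

lemma boundary_root_iff:
  "boundary_root Am A0 A1 A2 A3 \<omega>0 n k \<longleftrightarrow>
     dispoly Am A0 A1 A2 A3 (of_real (- of_int n * \<omega>0)) k = 0 \<and> k \<in> frontier (Dplus Am A0 A1 A2 A3)"
  unfolding boundary_root_def dispoly_def by (simp add: algebra_simps)

lemma frontier_Dplus_radiation:
  assumes "Am \<ge> 0" "Am * A3 = 0" "k \<in> frontier (Dplus Am A0 A1 A2 A3)"
  shows "radiation_condition Am A0 A1 A2 A3 k"
  using closure_DplusD[OF assms(2)] assms(3)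
  unfolding radiation_condition_iff[OF assms(1,2)] frontier_def by force

text \<open>With N and D the numerator and denominator of \<open>omega\<close>, a root has N = w D,
  so N' D - N D' = D (N' - w D'), and the last factor is the derivative of the polynomial N - w D.
  At a real root the group velocity thus has the sign of the slope of that polynomial.\<close>

lemma dsym_eq_pderiv:
  assumes "Am * A3 = 0" "dispoly Am A0 A1 A2 A3 (of_real w) (of_real x) = 0"
  shows "dsym Am A0 A1 A2 A3 (of_real x) = (3 * A3 * x\<^sup>2 + 2 * (A2 - w * Am) * x - A1) * (1 + Am * x\<^sup>2)"
proof -
  have "(of_real (A3 * x^3 + (A2 - w * Am) * x\<^sup>2 - A1 * x - A0 - w) :: complex) = 0"
    using assms(2) unfolding dispoly_def by simp
  then have *: "A3 * x^3 + (A2 - w * Am) * x\<^sup>2 - A1 * x - A0 - w = 0" by (simp only: of_real_eq_0_iff)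
  have "dsym Am A0 A1 A2 A3 (of_real x) = (3 * A3 * x\<^sup>2 + 2 * (A2 - w * Am) * x - A1) * (1 + Am * x\<^sup>2)
    - 2 * Am * x * (A3 * x^3 + (A2 - w * Am) * x\<^sup>2 - A1 * x - A0 - w) - Am * A3 * x^4"
    unfolding dsym_def by (simp add: power2_eq_square power3_eq_cube power4_eq_xxxx algebra_simps)
  then show ?thesis using * assms(1) by simp
qed

text \<open>The coefficients are real, so a root z in the upper half-plane brings
  \<open>cnj z\<close> with it. A quadratic then has no room for another root; a cubic has room for
  one, which is real and where the slope A3 |z' - z|^2 is negative, against the radiation condition.
  At two real roots x, y the slopes add up to A3 (x - y)^2. For the cubic this is negative; for the
  quadratic it is zero, so both slopes would vanish at two distinct simple roots.\<close>

lemma radiation_root_unique: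
  assumes coeffs: "admissible_coeffs Am A3" and lead: "Am > 0 \<Longrightarrow> A2 - w * Am \<noteq> 0"
    and k: "dispoly Am A0 A1 A2 A3 (of_real w) k = 0" "radiation_condition Am A0 A1 A2 A3 k"
    and l: "dispoly Am A0 A1 A2 A3 (of_real w) l = 0" "radiation_condition Am A0 A1 A2 A3 l"
  shows "k = l"
proof (rule ccontr)
  assume ne: "k \<noteq> l"
  have AA: "Am \<ge> 0" "Am * A3 = 0" using coeffs by (auto simp: admissible_coeffs_def)
  note rad = radiation_condition_iff[OF AA]
  have conj_root: "dispoly Am A0 A1 A2 A3 (of_real w) (cnj z) = 0"
    if "dispoly Am A0 A1 A2 A3 (of_real w) z = 0" for z
  proof -
    have "dispoly Am A0 A1 A2 A3 (of_real w) (cnj z) = cnj (dispoly Am A0 A1 A2 A3 (of_real w) z)"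
      unfolding dispoly_def by simp
    with that show ?thesis by simp
  qed
  let ?c = "A2 - w * Am"
  \<comment> \<open>First divided difference of the polynomial at two distinct roots.\<close>
  have dd: "of_real A3 * (z\<^sup>2 + z * z' + z'\<^sup>2) + of_real ?c * (z + z') - of_real A1 = 0"
    if "dispoly Am A0 A1 A2 A3 (of_real w) z = 0" "dispoly Am A0 A1 A2 A3 (of_real w) z' = 0" "z \<noteq> z'" for z z'
  proof -
    have "(z - z') * (of_real A3 * (z\<^sup>2 + z * z' + z'\<^sup>2) + of_real ?c * (z + z') - of_real A1)
      = dispoly Am A0 A1 A2 A3 (of_real w) z - dispoly Am A0 A1 A2 A3 (of_real w) z'"
      unfolding dispoly_def by (simp add: power2_eq_square power3_eq_cube algebra_simps)
    with that show ?thesis by simp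
  qed
  \<comment> \<open>Second divided difference at \<open>z\<close>, \<open>cnj z\<close>,
    \<open>z'\<close>. For \<open>A3 = 0\<close> it says that the leading coefficient
    \<open>?c\<close> vanishes; for \<open>A3 < 0\<close> it gives the sum of the roots, whose
    imaginary part is \<open>Im z'\<close>.\<close>
  have third: "of_real A3 * (z + cnj z + z') + of_real ?c = 0"
    if "dispoly Am A0 A1 A2 A3 (of_real w) z = 0" "dispoly Am A0 A1 A2 A3 (of_real w) z' = 0"
       "Im z > 0" "Im z' \<ge> 0" "z \<noteq> z'" for z z'
  proof -
    have "cnj z \<noteq> z'" using that by auto
    note d = dd[OF that(1,2) that(5)] dd[OF conj_root[OF that(1)] that(2) this]
    have "(of_real A3 * (z + cnj z + z') + of_real ?c) * (z - cnj z)
      = (of_real A3 * (z\<^sup>2 + z * z' + z'\<^sup>2) + of_real ?c * (z + z') - of_real A1)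
       - (of_real A3 * ((cnj z)\<^sup>2 + cnj z * z' + z'\<^sup>2) + of_real ?c * (cnj z + z') - of_real A1)"
      by (simp add: power2_eq_square algebra_simps)
    then have "(of_real A3 * (z + cnj z + z') + of_real ?c) * (z - cnj z) = 0"
      unfolding d by simp
    moreover have "z - cnj z \<noteq> 0" using that(3) by (auto simp: complex_eq_iff)
    ultimately show ?thesis by simp
  qed
  have no: False
    if z: "dispoly Am A0 A1 A2 A3 (of_real w) z = 0" "Im z > 0"
      and z': "dispoly Am A0 A1 A2 A3 (of_real w) z' = 0" "radiation_condition Am A0 A1 A2 A3 z'" "z \<noteq> z'" for z z'
  proof -
    have "Im z' \<ge> 0" using z'(2) rad by auto
    note t = third[OF z(1) z'(1) z(2) this z'(3)]
    have "Am = 0 \<and> A3 < 0"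
    proof (rule ccontr)
      assume "\<not> (Am = 0 \<and> A3 < 0)"
      then have "Am > 0" "A3 = 0" using coeffs by (auto simp: admissible_coeffs_def)
      then show False using t lead by (metis add_0 mult_zero_left of_real_0 of_real_eq_0_iff)
    qed
    then have c: "Am = 0" "A3 < 0" by auto
    have "Im (of_real A3 * (z + cnj z + z') + of_real ?c) = 0" using t by simp
    then have "Im z' = 0" using c by simp
    then obtain x where x: "z' = of_real x" by (metis complex_is_Real_iff Reals_cases)
    have c2: "?c = - A3 * (2 * Re z + x)" using arg_cong[OF t, of Re] x by simp
    have "dsym Am A0 A1 A2 A3 z' = 3 * A3 * x\<^sup>2 + 2 * ?c * x - A1"
      using dsym_eq_pderiv[OF AA(2) z'(1)[unfolded x]] c x by simp
    \<comment> \<open>Derivative of A3 (k - z) (k - cnj z) (k - x) at k = x.\<close>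
    also have "\<dots> = A3 * ((x - Re z)\<^sup>2 + (Im z)\<^sup>2)"
      using arg_cong[OF dd[OF z(1) z'(1) z'(3)], of Re] unfolding x c2
      by (simp add: power2_eq_square algebra_simps)
    also have "\<dots> < 0" using c z(2) by (simp add: mult_less_0_iff add_nonneg_pos)
    finally show False using z'(2) rad \<open>Im z' = 0\<close> by simp
  qed
  have "Im k = 0" "Im l = 0" using no[of k l] no[of l k] k l ne rad by (metis less_irrefl)+
  then obtain x y where xy: "k = of_real x" "l = of_real y" by (metis complex_is_Real_iff Reals_cases)
  define qx where "qx = 3 * A3 * x\<^sup>2 + 2 * ?c * x - A1"
  define qy where "qy = 3 * A3 * y\<^sup>2 + 2 * ?c * y - A1"
  have "1 + Am * x\<^sup>2 > 0" "1 + Am * y\<^sup>2 > 0" using AA by (simp_all add: add_pos_nonneg)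
  moreover have "qx * (1 + Am * x\<^sup>2) \<ge> 0" "qy * (1 + Am * y\<^sup>2) \<ge> 0"
    using dsym_eq_pderiv[OF AA(2)] k l rad xy unfolding qx_def qy_def by auto
  ultimately have q: "qx \<ge> 0" "qy \<ge> 0" by (simp_all add: zero_le_mult_iff)
  have "(of_real (A3 * (x\<^sup>2 + x * y + y\<^sup>2) + ?c * (x + y) - A1) :: complex) = 0"
    using dd[OF k(1) l(1) ne] unfolding xy by simp
  then have d: "A3 * (x\<^sup>2 + x * y + y\<^sup>2) + ?c * (x + y) - A1 = 0" by (simp only: of_real_eq_0_iff)
  have sum: "qx + qy = A3 * (x - y)\<^sup>2"
    using d unfolding qx_def qy_def by (simp add: power2_eq_square algebra_simps)
  have xyne: "x \<noteq> y" using ne xy by auto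
  then have "(x - y)\<^sup>2 > 0" by simp
  show False
  proof (cases "Am = 0")
    case True
    then have "A3 < 0" using coeffs by (auto simp: admissible_coeffs_def)
    then have "A3 * (x - y)\<^sup>2 < 0" using \<open>(x - y)\<^sup>2 > 0\<close> by (simp add: mult_neg_pos)
    then show False using sum q by simp
  next
    case False
    then have c: "Am > 0" "A3 = 0" using coeffs by (auto simp: admissible_coeffs_def)
    then have "qx = 0" using sum q by simp
    moreover have "qx = ?c * (x - y)" using d c unfolding qx_def by (simp add: algebra_simps)
    ultimately show False using lead c xyne by simp
  qed
qed

text \<open>A root at a pole is a common zero of numerator and denominator. Both are then
  proportional, since the pole is not real: \<open>omega\<close> is the constant \<open>- A0\<close>
  away from the poles, \<open>dsym\<close> vanishes identically, and \<open>Dplus\<close> is empty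
  and has no frontier.\<close>

lemma frontier_root_not_pole:
  assumes coeffs: "admissible_coeffs Am A3"
    and root: "dispoly Am A0 A1 A2 A3 w k = 0" and front: "k \<in> frontier (Dplus Am A0 A1 A2 A3)"
  shows "1 + of_real Am * k^2 \<noteq> 0"
proof
  assume pole: "1 + of_real Am * k^2 = 0"
  then have "Am \<noteq> 0" by auto
  then have c: "Am > 0" "A3 = 0" using coeffs by (auto simp: admissible_coeffs_def)
  \<comment> \<open>Eliminating \<open>k^2\<close> with the pole equation leaves a real linear
    relation for \<open>k\<close>. As \<open>k\<close> is not real, both coefficients must
    vanish.\<close>
  have "of_real (A2 + Am * A0) + of_real (Am * A1) * k
     = (of_real A2 - w * of_real Am) * (1 + of_real Am * k^2) - of_real Am * dispoly Am A0 A1 A2 A3 w k"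
    unfolding dispoly_def using c by (simp add: algebra_simps)
  then have *: "of_real (A2 + Am * A0) + of_real (Am * A1) * k = 0"
    unfolding pole root by simp
  have "Im k \<noteq> 0"
  proof
    assume "Im k = 0"
    then obtain x where "k = of_real x" by (metis complex_is_Real_iff Reals_cases)
    then have "(of_real (1 + Am * x^2) :: complex) = 0" using pole by simp
    then have "1 + Am * x^2 = 0" by (simp only: of_real_eq_0_iff)
    moreover have "Am * x^2 \<ge> 0" using c by simp
    ultimately show False by simp
  qed
  moreover have "Im (of_real (A2 + Am * A0) + of_real (Am * A1) * k) = 0" using * by simp
  ultimately have A1: "A1 = 0" using c by simp
  with * have "(of_real (A2 + Am * A0) :: complex) = 0" by simp
  then have "A2 + Am * A0 = 0" by (simp only: of_real_eq_0_iff)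
  with A1 c have "dsym Am A0 A1 A2 A3 z = 0" for z unfolding dsym_def by simp
  then have "Dplus Am A0 A1 A2 A3 = {}" using c by (subst Dplus_eq) auto
  with front show False by simp
qed

lemma admissible_freq_lead:
  assumes "admissible_freq Am A2 \<omega>0" "Am > 0"
  shows "A2 - (- of_int n * \<omega>0) * Am \<noteq> 0"
proof
  assume *: "A2 - (- of_int n * \<omega>0) * Am = 0"
  show False
  proof (cases "\<omega>0 = 0")
    case True
    then show False using * assms by (simp add: admissible_freq_def)
  next
    case False
    have "A2 / (\<omega>0 * Am) = of_int (- n)" using * False assms(2) by (simp add: field_simps)
    then have "A2 / (\<omega>0 * Am) \<in> \<int>" by (metis Ints_of_int)
    then show False using assms False by (simp add: admissible_freq_def)
  qed
qed

lemma boundary_root_characterization: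
  assumes coeffs: "admissible_coeffs Am A3" and freq: "admissible_freq Am A2 \<omega>0"
    and k0: "boundary_root Am A0 A1 A2 A3 \<omega>0 n k0"
  shows "dispersion Am A0 A1 A2 A3 k0 (of_real (- of_int n * \<omega>0))"
    and "dispersion Am A0 A1 A2 A3 k (of_real (- of_int n * \<omega>0)) \<Longrightarrow>
           k = k0 \<longleftrightarrow> radiation_condition Am A0 A1 A2 A3 k"
proof -
  have AA: "Am \<ge> 0" "Am * A3 = 0" using coeffs by (auto simp: admissible_coeffs_def)
  note k0' = k0[unfolded boundary_root_iff]
  show "dispersion Am A0 A1 A2 A3 k0 (of_real (- of_int n * \<omega>0))"
    using k0' frontier_root_not_pole[OF coeffs] unfolding dispersion_iff by blast
  have rad: "radiation_condition Am A0 A1 A2 A3 k0" using frontier_Dplus_radiation[OF AA] k0' by blast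
  assume "dispersion Am A0 A1 A2 A3 k (of_real (- of_int n * \<omega>0))"
  then show "k = k0 \<longleftrightarrow> radiation_condition Am A0 A1 A2 A3 k"
    using radiation_root_unique[OF coeffs admissible_freq_lead[OF freq]] k0' rad
    unfolding dispersion_iff by blast
qed

section \<open>Driving frequencies with a real wavenumber\<close>

lemma concave_quadratic_nonneg_interval:
  fixes a b c :: real
  assumes "a < 0"
  shows "\<exists>l u. (\<forall>x. a * x\<^sup>2 + b * x + c \<ge> 0 \<longleftrightarrow> l \<le> x \<and> x \<le> u)"
proof (cases "b\<^sup>2 - 4 * a * c < 0")
  case True
  have "a * x\<^sup>2 + b * x + c < 0" for x
  proof -
    have "4 * a * (a * x\<^sup>2 + b * x + c) = (2 * a * x + b)\<^sup>2 - (b\<^sup>2 - 4 * a * c)"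
      by (simp add: power2_eq_square algebra_simps)
    also have "\<dots> > 0" using True by (simp add: add_nonneg_pos diff_conv_add_uminus del: add_uminus_conv_diff)
    finally show ?thesis using assms by (simp add: zero_less_mult_iff)
  qed
  \<comment> \<open>An empty set of solutions is also presented as an interval, the one from 1 to
    0.\<close>
  then have "a * x\<^sup>2 + b * x + c \<ge> 0 \<longleftrightarrow> 1 \<le> x \<and> x \<le> 0" for x
    using leD[of 0 "a * x\<^sup>2 + b * x + c"] by auto
  then show ?thesis by blast
next
  case False
  define d where "d = sqrt (b\<^sup>2 - 4 * a * c)"
  have d: "d \<ge> 0" "d\<^sup>2 = b\<^sup>2 - 4 * a * c" using False by (auto simp: d_def)
  have "a * x\<^sup>2 + b * x + c \<ge> 0 \<longleftrightarrow> (- b + d) / (2 * a) \<le> x \<and> x \<le> (- b - d) / (2 * a)" for x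
  proof -
    have "4 * a * (a * x\<^sup>2 + b * x + c) = (2 * a * x + b)\<^sup>2 - d\<^sup>2"
      unfolding d by (simp add: power2_eq_square algebra_simps)
    moreover have "a * x\<^sup>2 + b * x + c \<ge> 0 \<longleftrightarrow> 4 * a * (a * x\<^sup>2 + b * x + c) \<le> 0"
      using assms by (simp add: mult_le_0_iff)
    ultimately have "a * x\<^sup>2 + b * x + c \<ge> 0 \<longleftrightarrow> (2 * a * x + b)\<^sup>2 \<le> d\<^sup>2" by simp
    also have "\<dots> \<longleftrightarrow> \<bar>2 * a * x + b\<bar> \<le> d" using d(1) by (metis abs_le_square_iff abs_of_nonneg)
    also have "\<dots> \<longleftrightarrow> (- b + d) / (2 * a) \<le> x \<and> x \<le> (- b - d) / (2 * a)"
      using assms by (auto simp: field_simps abs_le_iff)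
    finally show ?thesis .
  qed
  then show ?thesis by blast
qed

text \<open>The root solves a real quadratic equation, so it is real exactly when the discriminant
  is nonnegative. The frequency enters both the leading and the constant coefficient, which makes
  the discriminant a concave quadratic in \<omega>0.\<close>

lemma boundary_root_real_range_mixed:
  assumes "Am > 0" "A3 = 0"
  shows "\<exists>\<omega>m \<omega>p :: real. \<forall>\<omega>0 k.
        admissible_freq Am A2 \<omega>0 \<and> boundary_root Am A0 A1 A2 A3 \<omega>0 1 k \<longrightarrow>
          (Im k = 0 \<longleftrightarrow> \<omega>m \<le> \<omega>0 \<and> \<omega>0 \<le> \<omega>p)"
proof -
  have "- 4 * Am < 0" using assms by simp
  \<comment> \<open>The quadratic is the discriminant A1^2 - 4 (A2 + x Am) (x - A0), expanded in the
    frequency x.\<close>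
  then obtain l u where lu: "\<And>x. - 4 * Am * x\<^sup>2 + (4 * Am * A0 - 4 * A2) * x + (A1\<^sup>2 + 4 * A2 * A0) \<ge> 0 \<longleftrightarrow> l \<le> x \<and> x \<le> u"
    using concave_quadratic_nonneg_interval[of "- 4 * Am" "4 * Am * A0 - 4 * A2" "A1\<^sup>2 + 4 * A2 * A0"] by blast
  have "Im k = 0 \<longleftrightarrow> l \<le> \<omega>0 \<and> \<omega>0 \<le> u"
    if "admissible_freq Am A2 \<omega>0" "boundary_root Am A0 A1 A2 A3 \<omega>0 1 k" for \<omega>0 k
  proof -
    obtain x y where k: "k = Complex x y" by (cases k)
    define c where "c = A2 + \<omega>0 * Am"
    have c: "c \<noteq> 0" using admissible_freq_lead[OF that(1) assms(1), of 1] by (simp add: c_def)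
    have "of_real c * k^2 - of_real A1 * k - of_real A0 + of_real \<omega>0 = 0"
      using that(2) assms unfolding boundary_root_def c_def by simp
    then have re: "c * (x\<^sup>2 - y\<^sup>2) - A1 * x - A0 + \<omega>0 = 0" and im: "2 * c * x * y - A1 * y = 0"
      unfolding k by (simp_all add: complex_eq_iff power2_eq_square algebra_simps)
    define D where "D = A1\<^sup>2 - 4 * c * (\<omega>0 - A0)"
    \<comment> \<open>Completing the square gives D = (2 c k - A1)^2 at the root; this is the real
      part of that identity.\<close>
    have D: "D = (2 * c * x - A1)\<^sup>2 - 4 * c\<^sup>2 * y\<^sup>2"
    proof -
      have "D = (2 * c * x - A1)\<^sup>2 - 4 * c\<^sup>2 * y\<^sup>2 - 4 * c * (c * (x\<^sup>2 - y\<^sup>2) - A1 * x - A0 + \<omega>0)"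
        unfolding D_def by (simp add: power2_eq_square algebra_simps)
      with re show ?thesis by simp
    qed
    have "y = 0 \<longleftrightarrow> D \<ge> 0"
    proof
      assume "D \<ge> 0"
      show "y = 0"
      proof (rule ccontr)
        assume y: "y \<noteq> 0"
        with im have "2 * c * x - A1 = 0" by auto
        then have "D = - 4 * c\<^sup>2 * y\<^sup>2" using D by simp
        moreover have "c\<^sup>2 * y\<^sup>2 > 0" using c y by simp
        ultimately show False using \<open>D \<ge> 0\<close> by simp
      qed
    qed (simp add: D)
    also have "D = - 4 * Am * \<omega>0\<^sup>2 + (4 * Am * A0 - 4 * A2) * \<omega>0 + (A1\<^sup>2 + 4 * A2 * A0)"
      unfolding D_def c_def by (simp add: power2_eq_square algebra_simps)
    finally show ?thesis unfolding lu k by simp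
  qed
  then show ?thesis by blast
qed

text \<open>By uniqueness the boundary root is real exactly when some real radiating root exists.
  Real wavenumbers with nonnegative group velocity form an interval, on which - \<omega> is
  nonincreasing; the admissible frequencies are the image of that interval.\<close>

lemma boundary_root_real_range_cubic:
  assumes "Am = 0" "A3 < 0"
  shows "\<exists>\<omega>m \<omega>p :: real. \<forall>\<omega>0 k.
        admissible_freq Am A2 \<omega>0 \<and> boundary_root Am A0 A1 A2 A3 \<omega>0 1 k \<longrightarrow>
          (Im k = 0 \<longleftrightarrow> \<omega>m \<le> \<omega>0 \<and> \<omega>0 \<le> \<omega>p)"
proof -
  have coeffs: "admissible_coeffs Am A3" using assms by (simp add: admissible_coeffs_def)
  have AA: "Am \<ge> 0" "Am * A3 = 0" using assms by auto
  \<comment> \<open>For \<open>Am = 0\<close> this is - \<omega> on the real axis, so the dispersion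
    relation reads \<open>p x = \<omega>0\<close>.\<close>
  define p where "p x = - (A3 * x^3 + A2 * x\<^sup>2 - A1 * x - A0)" for x
  have "3 * A3 < 0" using assms by simp
  then obtain l u where lu: "\<And>x. 3 * A3 * x\<^sup>2 + 2 * A2 * x + - A1 \<ge> 0 \<longleftrightarrow> l \<le> x \<and> x \<le> u"
    using concave_quadratic_nonneg_interval[of "3 * A3" "2 * A2" "- A1"] by blast
  have dsym: "dsym Am A0 A1 A2 A3 (of_real x) \<ge> 0 \<longleftrightarrow> l \<le> x \<and> x \<le> u" for x
    unfolding lu[symmetric] dsym_def using assms by (simp add: algebra_simps)
  have poly: "dispoly Am A0 A1 A2 A3 (of_real (- of_int 1 * \<omega>0)) (of_real x) = of_real (\<omega>0 - p x)" for \<omega>0 x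
    unfolding dispoly_def p_def using assms by simp
  have decr: "p b \<le> p a" if "l \<le> a" "a \<le> b" "b \<le> u" for a b
  proof (rule DERIV_nonpos_imp_nonincreasing[OF that(2)])
    fix x assume "a \<le> x" "x \<le> b"
    then have "3 * A3 * x\<^sup>2 + 2 * A2 * x + - A1 \<ge> 0" using lu that by simp
    moreover have "DERIV p x :> - (3 * A3 * x\<^sup>2 + 2 * A2 * x + - A1)"
      unfolding p_def by (auto intro!: derivative_eq_intros simp: power2_eq_square algebra_simps)
    ultimately show "\<exists>y. DERIV p x :> y \<and> y \<le> 0" by (intro exI conjI) auto
  qed
  have real_iff: "Im k = 0 \<longleftrightarrow> (\<exists>x. l \<le> x \<and> x \<le> u \<and> p x = \<omega>0)"
    if "admissible_freq Am A2 \<omega>0" "boundary_root Am A0 A1 A2 A3 \<omega>0 1 k" for \<omega>0 k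
  proof
    note that2 = that(2)[unfolded boundary_root_iff]
    have rad: "radiation_condition Am A0 A1 A2 A3 k" using frontier_Dplus_radiation[OF AA] that2 by blast
    {
      assume "Im k = 0"
      then obtain x where k: "k = of_real x" by (metis complex_is_Real_iff Reals_cases)
      then have "l \<le> x" "x \<le> u" using rad dsym unfolding radiation_condition_iff[OF AA] by auto
      moreover have "p x = \<omega>0" using that2[THEN conjunct1] unfolding k poly by (simp only: of_real_eq_0_iff)
      ultimately show "\<exists>x. l \<le> x \<and> x \<le> u \<and> p x = \<omega>0" by blast
    next
      assume "\<exists>x. l \<le> x \<and> x \<le> u \<and> p x = \<omega>0"
      then obtain x where x: "l \<le> x" "x \<le> u" "p x = \<omega>0" by blast
      have "radiation_condition Am A0 A1 A2 A3 (of_real x)"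
        using dsym x unfolding radiation_condition_iff[OF AA] by simp
      moreover have "dispoly Am A0 A1 A2 A3 (of_real (- of_int 1 * \<omega>0)) (of_real x) = 0"
        unfolding poly using x(3) by simp
      ultimately have "of_real x = k"
        using radiation_root_unique[OF coeffs admissible_freq_lead[OF that(1)]] rad that2 by blast
      then show "Im k = 0" by auto
    }
  qed
  show ?thesis
  proof (cases "l \<le> u")
    \<comment> \<open>The group velocity is negative on the whole real axis, so no real root
      radiates; 1 and 0 serve as endpoints of an empty range.\<close>
    case False
    then have "\<not> (\<exists>x. l \<le> x \<and> x \<le> u \<and> p x = \<omega>0)" for \<omega>0 by auto
    with real_iff have "\<forall>\<omega>0 k. admissible_freq Am A2 \<omega>0 \<and> boundary_root Am A0 A1 A2 A3 \<omega>0 1 k \<longrightarrow>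
          (Im k = 0 \<longleftrightarrow> 1 \<le> \<omega>0 \<and> \<omega>0 \<le> 0)" by auto
    then show ?thesis by blast
  next
    case True
    have "(\<exists>x. l \<le> x \<and> x \<le> u \<and> p x = \<omega>0) \<longleftrightarrow> p u \<le> \<omega>0 \<and> \<omega>0 \<le> p l" for \<omega>0
    proof
      assume "p u \<le> \<omega>0 \<and> \<omega>0 \<le> p l"
      moreover have "continuous_on {l..u} p" unfolding p_def by (intro continuous_intros)
      ultimately show "\<exists>x. l \<le> x \<and> x \<le> u \<and> p x = \<omega>0" using IVT2'[of p u \<omega>0 l] True by auto
    qed (use decr in auto)
    with real_iff have "\<forall>\<omega>0 k. admissible_freq Am A2 \<omega>0 \<and> boundary_root Am A0 A1 A2 A3 \<omega>0 1 k \<longrightarrow>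
          (Im k = 0 \<longleftrightarrow> p u \<le> \<omega>0 \<and> \<omega>0 \<le> p l)" by auto
    then show ?thesis by blast
  qed
qed

section \<open>Vieta relations and the half-planes of the roots for \<open>Re s > 0\<close>\<close>

lemma cubic_roots:
  fixes b c d :: complex
  shows "\<exists>k0 k1 k2. b = - (k0 + k1 + k2) \<and> c = k0 * k1 + k0 * k2 + k1 * k2 \<and> d = - (k0 * k1 * k2)"
proof -
  have "\<exists>z. poly [:d, c, b, 1:] z = 0"
    by (rule fundamental_theorem_of_algebra) (simp add: constant_degree)
  then obtain r where r: "d + r * (c + r * (b + r)) = 0" by auto
  \<comment> \<open>Dividing out \<open>r\<close> leaves z^2 + (b + r) z + (c + (b + r) r), and
    \<open>e\<close> is a square root of its discriminant. Stating the result through Vieta's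
    relations keeps track of multiplicities.\<close>
  define e where "e = csqrt ((b + r)\<^sup>2 - 4 * (c + (b + r) * r))"
  have e: "e\<^sup>2 = (b + r)\<^sup>2 - 4 * (c + (b + r) * r)" by (simp add: e_def)
  define k1 k2 where "k1 = (- (b + r) + e) / 2" and "k2 = (- (b + r) - e) / 2"
  have s: "k1 + k2 = - (b + r)" by (simp add: k1_def k2_def field_simps)
  have "4 * (k1 * k2) = (b + r)\<^sup>2 - e\<^sup>2" by (simp add: k1_def k2_def power2_eq_square field_simps)
  also have "\<dots> = 4 * (c + (b + r) * r)" unfolding e by simp
  finally have p: "k1 * k2 = c + (b + r) * r" by (simp only: mult_cancel_left) simp
  have "b = - (r + k1 + k2)" using s by (simp add: algebra_simps)
  moreover have "c = r * k1 + r * k2 + k1 * k2"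
    using arg_cong[OF s, of "\<lambda>z. r * z"] p by (simp add: algebra_simps)
  moreover have "d + r * (k1 * k2) = 0" unfolding p using r by (simp add: algebra_simps)
  then have "d = - (r * k1 * k2)" by (simp add: eq_neg_iff_add_eq_0 mult.assoc)
  ultimately show ?thesis by blast
qed

text \<open>If the first two symmetric functions are real, only the product of the roots can carry
  an imaginary part; the identity says that its sign is opposite to that of the product of the
  imaginary parts. The proof translates the roots by the real part of \<open>k2\<close>; the factor
  \<open>(Im k1)\<^sup>2\<close> avoids a division.\<close>

lemma cubic_root_signs:
  fixes k0 k1 k2 :: complex
  assumes "Im (k0 + k1 + k2) = 0" "Im (k0 * k1 + k0 * k2 + k1 * k2) = 0" "Im k1 \<noteq> 0"
  shows "Im (k0 * k1 * k2) * (Im k1)\<^sup>2 = - (Im k0 * Im k1 * Im k2) * ((Re k0 - Re k2)\<^sup>2 + (Im k1)\<^sup>2)"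
proof -
  obtain x0 y0 x1 y1 x2 y2 where k: "k0 = Complex x0 y0" "k1 = Complex x1 y1" "k2 = Complex x2 y2"
    by (metis complex_surj)
  have y2: "y2 = - (y0 + y1)" using assms(1) k by simp
  define a b where "a = x0 - x2" and "b = x1 - x2"
  have x: "x0 = a + x2" "x1 = b + x2" by (auto simp: a_def b_def)
  \<comment> \<open>The imaginary part of the second symmetric function is - (a y0 + b y1), since
    the imaginary parts sum to zero.\<close>
  have ab: "b * y1 = - (a * y0)" using assms(2) unfolding k x y2 by (simp add: algebra_simps)
  have "Im (k0 * k1 * k2) = y2 * (a * b - y0 * y1)"
  proof -
    have "Im (k0 * k1 * k2) = y2 * (a * b - y0 * y1) - x2 * (a * y0 + b * y1)"
      unfolding k x y2 by (simp add: algebra_simps)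
    with ab show ?thesis by simp
  qed
  then have "Im (k0 * k1 * k2) * y1\<^sup>2 = y2 * (a * (b * y1) * y1 - y0 * y1^3)"
    by (simp only:) (simp add: power2_eq_square power3_eq_cube algebra_simps)
  also have "\<dots> = - (y0 * y1 * y2) * (a\<^sup>2 + y1\<^sup>2)"
    unfolding ab by (simp add: power2_eq_square power3_eq_cube algebra_simps)
  finally show ?thesis by (simp add: k a_def)
qed

text \<open>Only the constant coefficient contains \<open>s\<close>, so the first two symmetric
  functions are real and the product of the roots has imaginary part Re s / A3 < 0. By
  \<open>cubic_root_signs\<close> the three imaginary parts have positive product; their sum is
  zero, so exactly one is positive.\<close>

lemma dispersion_roots_cubic:
  assumes "A3 < 0" "Re s > 0"
  obtains k0 k1 k2 where "Im k0 > 0" "Im k1 < 0" "Im k2 < 0"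
    "of_real A2 = - of_real A3 * (k0 + k1 + k2)"
    "- of_real A1 = of_real A3 * (k0 * k1 + k0 * k2 + k1 * k2)"
    "- of_real A0 - \<i> * s = - of_real A3 * (k0 * k1 * k2)"
proof -
  define P where "P k0 k1 k2 \<longleftrightarrow> of_real A2 = - of_real A3 * (k0 + k1 + k2) \<and>
    - of_real A1 = of_real A3 * (k0 * k1 + k0 * k2 + k1 * k2) \<and>
    - of_real A0 - \<i> * s = - of_real A3 * (k0 * k1 * k2)" for k0 k1 k2
  obtain k0 k1 k2 where "of_real A2 / of_real A3 = - (k0 + k1 + k2)"
    "- of_real A1 / of_real A3 = k0 * k1 + k0 * k2 + k1 * k2"
    "(- of_real A0 - \<i> * s) / of_real A3 = - (k0 * k1 * k2)" using cubic_roots by blast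
  then have P: "P k0 k1 k2" unfolding P_def using assms(1) by (simp add: field_simps)
  have sgn: "Im k0 * Im k1 * Im k2 > 0 \<and> Im k0 + Im k1 + Im k2 = 0" if "P k0 k1 k2" for k0 k1 k2
  proof -
    note q = that[unfolded P_def]
    have s1: "Im (k0 + k1 + k2) = 0" using arg_cong[OF q[THEN conjunct1], of Im] assms(1) by simp
    have s2: "Im (k0 * k1 + k0 * k2 + k1 * k2) = 0"
      using arg_cong[OF q[THEN conjunct2, THEN conjunct1], of Im] assms(1) by simp
    have "- Re s = - A3 * Im (k0 * k1 * k2)"
      using arg_cong[OF q[THEN conjunct2, THEN conjunct2], of Im] by simp
    then have s3: "Im (k0 * k1 * k2) < 0" using assms by (metis neg_0_less_iff_less neg_less_0_iff_less zero_less_mult_pos mult_minus_left minus_mult_minus)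
    \<comment> \<open>A real \<open>k1\<close> would make the imaginary part of the product of the
      roots a multiple of that of the second symmetric function, which is zero.\<close>
    have "Im k1 \<noteq> 0"
    proof
      assume "Im k1 = 0"
      define q where "q = Im (k0 * k2)"
      have "Im (k0 * k1 * k2) = Re k1 * q" using \<open>Im k1 = 0\<close> by (simp add: q_def algebra_simps)
      moreover have "Im k0 = - Im k2" using s1 \<open>Im k1 = 0\<close> by simp
      moreover have "Im (k0 * k1 + k0 * k2 + k1 * k2) = Re k1 * (Im k0 + Im k2) + q"
        using \<open>Im k1 = 0\<close> by (simp add: q_def algebra_simps)
      ultimately show False using s2 s3 by (simp del: times_complex.simps plus_complex.simps)
    qed
    have "- (Im k0 * Im k1 * Im k2) * ((Re k0 - Re k2)\<^sup>2 + (Im k1)\<^sup>2) < 0"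
      unfolding cubic_root_signs[OF s1 s2 \<open>Im k1 \<noteq> 0\<close>, symmetric]
      using s3 \<open>Im k1 \<noteq> 0\<close> by (simp add: mult_neg_pos)
    moreover have "(Re k0 - Re k2)\<^sup>2 + (Im k1)\<^sup>2 > 0"
      using \<open>Im k1 \<noteq> 0\<close> by (simp add: add_nonneg_pos)
    ultimately have "Im k0 * Im k1 * Im k2 > 0"
      by (metis mult_minus_left neg_less_0_iff_less zero_less_mult_pos2)
    then show ?thesis using s1 by simp
  qed
  have perm: "P k1 k0 k2" "P k2 k0 k1" using P unfolding P_def by (auto simp: algebra_simps)
  note goal = that
  have fin: thesis if "P k0 k1 k2" "Im k0 > 0" for k0 k1 k2
  proof -
    have "Im k1 * Im k2 > 0" "Im k1 + Im k2 < 0"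
      using sgn[OF that(1)] that(2) zero_less_mult_pos[of "Im k0" "Im k1 * Im k2"]
      by (auto simp: mult.assoc)
    then have "Im k1 < 0" "Im k2 < 0" by (auto simp: zero_less_mult_iff)
    then show ?thesis using goal[of k0 k1 k2] that unfolding P_def by blast
  qed
  \<comment> \<open>Three nonpositive imaginary parts could not have a positive product. The Vieta
    relations are symmetric, so the upper root may be renamed \<open>k0\<close>.\<close>
  consider "Im k0 > 0" | "Im k1 > 0" | "Im k2 > 0"
    using sgn[OF P] by (metis leD leI mult_nonneg_nonpos mult_nonpos_nonpos)
  then show thesis using fin P perm by cases blast+
qed

text \<open>Here \<open>s\<close> also enters the leading coefficient \<open>c\<close>, so no
  symmetric function need be real. With a = 1/c the sum and the product of the roots are both affine
  in a, and a real shift t removes a: (k0 - t) (k1 - t) = r is real and positive. Hence k1 - t is r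
  divided by k0 - t, a map that exchanges the half-planes. The shift divides by \<open>A1\<close>;
  for \<open>A1 = 0\<close> the roots are simply opposite.\<close>

lemma dispersion_roots_mixed:
  assumes "Am > 0" "A3 = 0" "Re s > 0"
  obtains k0 k1 c where "Im k0 > 0" "Im k1 < 0" "c \<noteq> 0" "c = of_real A2 - \<i> * s * of_real Am"
    "of_real A1 = c * (k0 + k1)" "- of_real A0 - \<i> * s = c * (k0 * k1)"
proof -
  define c where "c = of_real A2 - \<i> * s * of_real Am"
  define P where "P k0 k1 \<longleftrightarrow> of_real A1 = c * (k0 + k1) \<and> - of_real A0 - \<i> * s = c * (k0 * k1)" for k0 k1
  have Imc: "Im c < 0" using assms by (simp add: c_def)
  then have c: "c \<noteq> 0" by auto
  define e where "e = csqrt ((of_real A1 / c)\<^sup>2 - 4 * ((- of_real A0 - \<i> * s) / c))"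
  have e: "e\<^sup>2 = (of_real A1 / c)\<^sup>2 - 4 * ((- of_real A0 - \<i> * s) / c)" by (simp add: e_def)
  define k0 k1 where "k0 = (of_real A1 / c + e) / 2" and "k1 = (of_real A1 / c - e) / 2"
  have "k0 + k1 = of_real A1 / c" by (simp add: k0_def k1_def field_simps)
  moreover have half: "4 * ((z + z') / 2 * ((z - z') / 2)) = z\<^sup>2 - z'\<^sup>2" for z z' :: complex
    by (simp add: power2_eq_square field_simps)
  have "4 * (k0 * k1) = 4 * ((- of_real A0 - \<i> * s) / c)"
    unfolding k0_def k1_def half e by simp
  then have "k0 * k1 = (- of_real A0 - \<i> * s) / c" by (simp only: mult_cancel_left) simp
  ultimately have P: "P k0 k1" unfolding P_def using c by simp
  have neg: "Im k0 * Im k1 < 0"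
  proof -
    \<comment> \<open>Chosen so that - A0 - i s = c / Am - B, which expresses \<open>s\<close>
      through \<open>c\<close>.\<close>
    define B where "B = A0 + A2 / Am"
    define a where "a = 1 / c"
    have "Im a \<noteq> 0" using Imc by (simp add: a_def Im_divide)
    have e1: "k0 + k1 = of_real A1 * a" using P c by (simp add: P_def a_def field_simps)
    have "- of_real A0 - \<i> * s = c / of_real Am - of_real B"
      unfolding c_def B_def using assms(1) by (simp add: field_simps)
    then have "c * (k0 * k1) = c / of_real Am - of_real B" using P by (simp add: P_def)
    then have e2: "k0 * k1 = 1 / of_real Am - of_real B * a"
      using c by (simp add: a_def field_simps)
    show ?thesis
    proof (cases "A1 = 0")
      case True
      then have k1: "k1 = - k0" using e1 by (simp add: eq_neg_iff_add_eq_0 add.commute)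
      have "Im k0 \<noteq> 0"
      proof
        assume "Im k0 = 0"
        then obtain x where x: "k0 = of_real x" by (metis complex_is_Real_iff Reals_cases)
        have i: "- (x * x) = 1 / Am - B * Re a" "0 = - (B * Im a)"
          using arg_cong[OF e2, of Re] arg_cong[OF e2, of Im] unfolding k1 x
          by (simp_all add: Re_divide Im_divide power2_eq_square)
        then have "B = 0" using \<open>Im a \<noteq> 0\<close> by simp
        then have "- (x * x) = 1 / Am" using i by simp
        moreover have "1 / Am > 0" "x * x \<ge> 0" using assms(1) by auto
        ultimately show False by linarith
      qed
      then show ?thesis using k1 by (simp add: power2_eq_square[symmetric])
    next
      case False
      \<comment> \<open>Makes the coefficient B + t A1 of a vanish in (k0 - t) (k1 - t).\<close>
      define t where "t = - B / A1"
      have "(k0 - of_real t) * (k1 - of_real t) = of_real (1 / Am + t\<^sup>2)"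
      proof -
        have "(k0 - of_real t) * (k1 - of_real t) = k0 * k1 - of_real t * (k0 + k1) + of_real (t\<^sup>2)"
          by (simp add: algebra_simps power2_eq_square)
        also have "\<dots> = of_real (1 / Am + t\<^sup>2) - of_real (B + t * A1) * a"
          unfolding e1 e2 by (simp add: algebra_simps)
        also have "B + t * A1 = 0" using False by (simp add: t_def)
        finally show ?thesis by simp
      qed
      moreover define r where "r = 1 / Am + t\<^sup>2"
      ultimately have p: "(k0 - of_real t) * (k1 - of_real t) = of_real r" by simp
      have "r > 0" using assms(1) by (simp add: r_def add_pos_nonneg)
      define z where "z = k0 - of_real t"
      have z0: "z \<noteq> 0" using p \<open>r > 0\<close> by (auto simp: z_def)
      have "k1 - of_real t = of_real r / z" using p z0 by (simp add: z_def field_simps)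
      then have "Im k1 = Im (of_real r / z)" by (metis Im_complex_of_real minus_complex.simps(2) diff_zero)
      then have "Im k1 = - r * Im k0 / (cmod z)\<^sup>2"
        by (simp add: Im_divide cmod_power2 z_def)
      moreover have "Im k0 \<noteq> 0"
      proof
        assume "Im k0 = 0"
        with \<open>Im k1 = - r * Im k0 / (cmod z)\<^sup>2\<close> have "Im (k0 + k1) = 0" by simp
        then show False using e1 False \<open>Im a \<noteq> 0\<close> by simp
      qed
      then have "(Im k0)\<^sup>2 > 0" by simp
      ultimately have "Im k0 * Im k1 = - (r * (Im k0)\<^sup>2 / (cmod z)\<^sup>2)" by (simp add: power2_eq_square)
      moreover have "r * (Im k0)\<^sup>2 / (cmod z)\<^sup>2 > 0" using \<open>r > 0\<close> z0 \<open>(Im k0)\<^sup>2 > 0\<close> by simp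
      ultimately show ?thesis by simp
    qed
  qed
  have "P k1 k0" using P by (simp add: P_def ac_simps)
  from neg consider "Im k0 > 0" "Im k1 < 0" | "Im k1 > 0" "Im k0 < 0" by (auto simp: mult_less_0_iff)
  then show thesis
    using that[of k0 k1 c] that[of k1 k0 c] P \<open>P k1 k0\<close> c c_def unfolding P_def by cases blast+
qed

section \<open>Roots near the real frequency axis\<close>

text \<open>Cauchy's root bound, in a form that is uniform over a family of polynomials with leading
  coefficient bounded away from zero.\<close>

lemma cubic_root_bound:
  fixes a3 a2 a1 a0 z :: complex
  assumes "a3 * z^3 + a2 * z^2 + a1 * z + a0 = 0" "cmod a3 \<ge> \<delta>" "\<delta> > 0"
    and "cmod a2 \<le> B" "cmod a1 \<le> B" "cmod a0 \<le> B"
  shows "cmod z \<le> 1 + 3 * B / \<delta>"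
proof (cases "cmod z \<le> 1")
  case True
  have "B \<ge> 0" using assms(4) norm_ge_zero order_trans by blast
  then have "3 * B / \<delta> \<ge> 0" using assms(3) by simp
  then show ?thesis using True by linarith
next
  case False
  let ?r = "cmod z"
  have B: "B \<ge> 0" using assms(4) norm_ge_zero order_trans by blast
  have r: "?r \<ge> 1" using False by simp
  have "a3 * z^3 = - (a2 * z^2 + a1 * z + a0)" using assms(1) by (simp only: eq_neg_iff_add_eq_0 add.assoc)
  then have "cmod a3 * ?r^3 = cmod (a2 * z^2 + a1 * z + a0)" by (metis norm_minus_cancel norm_mult norm_power)
  also have "\<dots> \<le> cmod a2 * ?r^2 + cmod a1 * ?r + cmod a0"
    by (metis (no_types, lifting) add_mono norm_mult norm_power norm_triangle_ineq norm_triangle_mono order_refl)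
  also have "\<dots> \<le> B * ?r^2 + B * ?r^2 + B * ?r^2"
  proof (intro add_mono)
    have "?r \<le> ?r^2" using r by (simp add: self_le_power)
    then show "cmod a1 * ?r \<le> B * ?r^2" using assms(5) B by (intro mult_mono) auto
    have "1 \<le> ?r^2" using r by simp
    then show "cmod a0 \<le> B * ?r^2" using assms(6) B mult_left_mono by fastforce
  qed (use assms(4) in \<open>auto intro: mult_right_mono\<close>)
  also have "cmod a3 * ?r^3 \<ge> \<delta> * ?r^3" using assms(2) by (intro mult_right_mono) auto
  ultimately have "\<delta> * ?r^3 \<le> 3 * B * ?r^2" by linarith
  then have "(\<delta> * ?r) * ?r^2 \<le> (3 * B) * ?r^2" by (simp add: power2_eq_square power3_eq_cube mult.assoc)
  moreover have "?r^2 > 0" using r by auto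
  ultimately have "\<delta> * ?r \<le> 3 * B" by (simp only: mult_le_cancel_right_pos)
  then have "?r \<le> 3 * B / \<delta>" using assms(3) by (simp add: field_simps)
  then show ?thesis by linarith
qed

lemma tendsto_if_bounded_subseq_limits:
  fixes K :: "nat \<Rightarrow> 'a :: heine_borel"
  assumes "bounded (range K)"
    and "\<And>r l. strict_mono (r :: nat \<Rightarrow> nat) \<Longrightarrow> (K \<circ> r) \<longlonglongrightarrow> l \<Longrightarrow> l = L"
  shows "K \<longlonglongrightarrow> L"
proof (rule tendstoI, rule ccontr)
  fix e :: real assume "e > 0" "\<not> (\<forall>\<^sub>F j in sequentially. dist (K j) L < e)"
  then obtain r where r: "strict_mono (r :: nat \<Rightarrow> nat)" "\<And>n. \<not> dist (K (r n)) L < e"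
    using not_eventually_sequentiallyD by blast
  have "bounded (range (K \<circ> r))" using assms(1) by (rule bounded_subset) auto
  then obtain l q where lq: "strict_mono (q :: nat \<Rightarrow> nat)" "((K \<circ> r) \<circ> q) \<longlonglongrightarrow> l"
    using bounded_imp_convergent_subsequence by blast
  have "l = L" using assms(2)[of "r \<circ> q" l] lq r(1) by (simp add: strict_mono_o o_assoc)
  then have "\<forall>\<^sub>F n in sequentially. dist (K (r (q n))) L < e" using tendstoD[OF lq(2) \<open>e > 0\<close>] by simp
  then show False using r(2) by simp
qed

text \<open>Limiting absorption. The sequence is bounded, and every limit point is a root at the
  real frequency \<open>w\<close> with \<open>Im \<ge> 0\<close> and \<open>dsym \<ge> 0\<close>,
  that is, a radiating root, of which there is only one. No continuity of root branches enters, so a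
  double root with zero group velocity is covered.\<close>

lemma upper_root_tendsto:
  fixes K :: "nat \<Rightarrow> complex"
  assumes coeffs: "admissible_coeffs Am A3" and lead: "Am > 0 \<Longrightarrow> A2 - w * Am \<noteq> 0"
    and k0: "dispoly Am A0 A1 A2 A3 (of_real w) k0 = 0" "radiation_condition Am A0 A1 A2 A3 k0"
    and eps: "\<And>j. eps j > 0" "eps \<longlonglongrightarrow> 0"
    and K: "\<And>j. Im (K j) > 0" "\<And>j. dispoly Am A0 A1 A2 A3 (of_real w + \<i> * of_real (eps j)) (K j) = 0"
  shows "K \<longlonglongrightarrow> k0"
proof (rule tendsto_if_bounded_subseq_limits)
  have AA: "Am \<ge> 0" "Am * A3 = 0" using coeffs by (auto simp: admissible_coeffs_def)
  \<comment> \<open>The value of \<open>omega\<close> at \<open>K j\<close> has imaginary part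
    \<open>eps j > 0\<close>, so \<open>K j\<close> lies on the nonnegative side of
    \<open>dsym\<close>. The computation uses Im (N cnj D), without dividing, so poles need no
    separate treatment.\<close>
  have sym_nonneg: "dsym Am A0 A1 A2 A3 (K j) \<ge> 0" for j
  proof -
    define D where "D = 1 + of_real Am * (K j)\<^sup>2"
    define N where "N = - of_real A0 - of_real A1 * K j + of_real A2 * (K j)^2 + of_real A3 * (K j)^3"
    have "N = (of_real w + \<i> * of_real (eps j)) * D"
      using K(2)[of j] unfolding dispoly_def N_def D_def by (simp add: algebra_simps)
    then have "Im (N * cnj D) = eps j * (cmod D)\<^sup>2"
      by (simp add: mult.assoc complex_norm_square[symmetric])
    moreover have "Im (N * cnj D) = Im (K j) * dsym Am A0 A1 A2 A3 (K j)
      + Am * A3 * (Im (K j) * ((Re (K j))\<^sup>2 + (Im (K j))\<^sup>2)\<^sup>2)"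
    proof -
      obtain x y where k: "K j = Complex x y" by (cases "K j")
      show ?thesis unfolding N_def D_def k dsym_def
        by (simp add: power2_eq_square power3_eq_cube algebra_simps)
    qed
    ultimately have "Im (K j) * dsym Am A0 A1 A2 A3 (K j) \<ge> 0" using AA eps(1)[of j]
      by (metis add.right_neutral less_imp_le mult_zero_left mult_nonneg_nonneg zero_le_power2)
    then show ?thesis using K(1)[of j] by (simp add: zero_le_mult_iff)
  qed
  obtain b where b: "\<And>j. eps j \<le> b"
    using eps(2) by (metis Bseq_def convergent_imp_Bseq convergent_def abs_le_D1 real_norm_def)
  have b0: "b \<ge> 0" using b[of 0] eps(1)[of 0] by linarith
  have const: "cmod (- of_real A0 - (of_real w + \<i> * of_real (eps j))) \<le> \<bar>A0\<bar> + \<bar>w\<bar> + eps j" for j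
    using norm_triangle_ineq4[of "- complex_of_real A0" "of_real w + \<i> * of_real (eps j)"]
      norm_triangle_ineq[of "complex_of_real w" "\<i> * of_real (eps j)"] eps(1)[of j]
    by (simp add: norm_mult)
  show "bounded (range K)"
  proof (cases "Am = 0")
    case True
    then have A3: "A3 < 0" using coeffs by (auto simp: admissible_coeffs_def)
    define B where "B = \<bar>A2\<bar> + \<bar>A1\<bar> + (\<bar>A0\<bar> + \<bar>w\<bar> + b)"
    have "cmod (K j) \<le> 1 + 3 * B / \<bar>A3\<bar>" for j
    proof (rule cubic_root_bound)
      show "of_real A3 * K j^3 + of_real A2 * K j^2 + - of_real A1 * K j
        + (- of_real A0 - (of_real w + \<i> * of_real (eps j))) = 0"
        using K(2)[of j] True unfolding dispoly_def by (simp add: algebra_simps)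
      show "cmod (- of_real A0 - (of_real w + \<i> * of_real (eps j))) \<le> B"
        using const[of j] b[of j] unfolding B_def by linarith
      show "cmod (of_real A2) \<le> B" "cmod (- of_real A1) \<le> B" using b0 by (simp_all add: B_def)
      show "\<bar>A3\<bar> \<le> cmod (of_real A3)" "0 < \<bar>A3\<bar>" using A3 by simp_all
    qed
    then show ?thesis by (auto simp: bounded_iff)
  next
    case False
    then have A3: "Am > 0" "A3 = 0" using coeffs by (auto simp: admissible_coeffs_def)
    define B where "B = \<bar>A1\<bar> + (\<bar>A0\<bar> + \<bar>w\<bar> + b)"
    have "cmod (K j) \<le> 1 + 3 * B / \<bar>A2 - w * Am\<bar>" for j
    proof (rule cubic_root_bound)
      let ?c = "of_real A2 - (of_real w + \<i> * of_real (eps j)) * of_real Am"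
      \<comment> \<open>The equation is quadratic here; multiplied by \<open>K j\<close> it becomes
        a cubic with constant term 0 and fits \<open>cubic_root_bound\<close>.\<close>
      have "?c * K j^3 + - of_real A1 * K j^2
        + (- of_real A0 - (of_real w + \<i> * of_real (eps j))) * K j
        = K j * dispoly Am A0 A1 A2 A3 (of_real w + \<i> * of_real (eps j)) (K j)"
        using A3 unfolding dispoly_def by (simp add: algebra_simps power2_eq_square power3_eq_cube)
      then show "?c * K j^3 + - of_real A1 * K j^2
        + (- of_real A0 - (of_real w + \<i> * of_real (eps j))) * K j + 0 = 0" using K(2)[of j] by simp
      show "\<bar>A2 - w * Am\<bar> \<le> cmod ?c" using abs_Re_le_cmod[of ?c] by simp
      show "cmod (- of_real A0 - (of_real w + \<i> * of_real (eps j))) \<le> B"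
        using const[of j] b[of j] unfolding B_def by linarith
      show "cmod (- of_real A1) \<le> B" "cmod 0 \<le> B" using b0 by (simp_all add: B_def)
      show "0 < \<bar>A2 - w * Am\<bar>" using lead[OF A3(1)] by simp
    qed
    then show ?thesis by (auto simp: bounded_iff)
  qed
  fix r l assume r: "strict_mono (r :: nat \<Rightarrow> nat)" and l: "(K \<circ> r) \<longlonglongrightarrow> l"
  have eps_r: "(\<lambda>j. eps (r j)) \<longlonglongrightarrow> 0" using LIMSEQ_subseq_LIMSEQ[OF eps(2) r] by (simp add: o_def)
  note lim = l[unfolded o_def]
  have "(\<lambda>j. dispoly Am A0 A1 A2 A3 (of_real w + \<i> * of_real (eps (r j))) (K (r j)))
     \<longlonglongrightarrow> dispoly Am A0 A1 A2 A3 (of_real w + \<i> * of_real 0) l"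
    unfolding dispoly_def by (intro tendsto_intros lim eps_r)
  then have "dispoly Am A0 A1 A2 A3 (of_real w + \<i> * of_real 0) l = 0"
    unfolding K(2) by (simp only: LIMSEQ_const_iff)
  moreover have "Im l \<ge> 0"
    using tendsto_Im[OF lim] K(1) by (intro LIMSEQ_le_const) (auto intro: less_imp_le)
  moreover have "(\<lambda>j. dsym Am A0 A1 A2 A3 (K (r j))) \<longlonglongrightarrow> dsym Am A0 A1 A2 A3 l"
    unfolding dsym_def by (intro tendsto_intros lim)
  then have "dsym Am A0 A1 A2 A3 l \<ge> 0" using sym_nonneg by (intro LIMSEQ_le_const) auto
  ultimately have "dispoly Am A0 A1 A2 A3 (of_real w) l = 0" "radiation_condition Am A0 A1 A2 A3 l"
    unfolding radiation_condition_iff[OF AA] by auto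
  then show "l = k0" using radiation_root_unique[OF coeffs lead _ _ k0] by blast
qed

section \<open>Iterated limits and Abelian means\<close>

definition iterated_limit_filter :: "(nat \<times> real) filter" where
  "iterated_limit_filter = Abs_filter (\<lambda>P. \<forall>\<^sub>F j in sequentially. \<forall>\<^sub>F T in at_top. P (j, T))"

text \<open>The inner limit is in \<open>T\<close>, for fixed j. In the other order every mean below
  would tend to 0, being \<epsilon> times an integral over a bounded interval. Packing the two
  limits into one filter makes limit arithmetic and uniqueness of limits available.\<close>

lemma eventually_iterated:
  "eventually P iterated_limit_filter \<longleftrightarrow> (\<forall>\<^sub>F j in sequentially. \<forall>\<^sub>F T in at_top. P (j, T))"
  unfolding iterated_limit_filter_def
proof (rule eventually_Abs_filter, rule is_filter.intro)
  fix P Q :: "nat \<times> real \<Rightarrow> bool"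
  assume "\<forall>\<^sub>F j in sequentially. \<forall>\<^sub>F T in at_top. P (j, T)" "\<forall>\<^sub>F j in sequentially. \<forall>\<^sub>F T in at_top. Q (j, T)"
  then show "\<forall>\<^sub>F j in sequentially. \<forall>\<^sub>F T in at_top. P (j, T) \<and> Q (j, T)"
    by eventually_elim (rule eventually_conj)
next
  fix P Q :: "nat \<times> real \<Rightarrow> bool"
  assume "\<forall>x. P x \<longrightarrow> Q x" "\<forall>\<^sub>F j in sequentially. \<forall>\<^sub>F T in at_top. P (j, T)"
  then show "\<forall>\<^sub>F j in sequentially. \<forall>\<^sub>F T in at_top. Q (j, T)"
    by (auto elim!: eventually_mono)
qed simp

lemma iterated_limit_filter_nontrivial: "iterated_limit_filter \<noteq> bot"
  unfolding trivial_limit_def eventually_iterated by simp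

lemma tendsto_iterated:
  fixes A :: "nat \<Rightarrow> real \<Rightarrow> 'a :: metric_space"
  assumes "\<And>j. (A j \<longlongrightarrow> B j) at_top" "B \<longlonglongrightarrow> l"
  shows "((\<lambda>p. A (fst p) (snd p)) \<longlongrightarrow> l) iterated_limit_filter"
proof (rule tendstoI, unfold eventually_iterated)
  fix e :: real assume e: "e > 0"
  have "\<forall>\<^sub>F j in sequentially. dist (B j) l < e / 2" using e by (intro tendstoD[OF assms(2)]) simp
  then show "\<forall>\<^sub>F j in sequentially. \<forall>\<^sub>F T in at_top. dist (A (fst (j, T)) (snd (j, T))) l < e"
  proof eventually_elim
    case (elim j)
    have "\<forall>\<^sub>F T in at_top. dist (A j T) (B j) < e / 2" using e by (intro tendstoD[OF assms(1)]) simp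
    then show ?case
    proof eventually_elim
      case (elim T)
      then show ?case using dist_triangle[of "A j T" l "B j"] \<open>dist (B j) l < e / 2\<close> by simp
    qed
  qed
qed

text \<open>A truncated Laplace transform at \<epsilon> + i \<omega>. The factor \<epsilon>
  normalises it: as \<open>T\<close> tends to infinity, the mean of exp (i \<omega> t) tends to
  1.\<close>

definition laplace_mean :: "real \<Rightarrow> real \<Rightarrow> real \<Rightarrow> (real \<Rightarrow> complex) \<Rightarrow> complex" where
  "laplace_mean \<omega> \<epsilon> T f =
     of_real \<epsilon> * integral {0..T} (\<lambda>t. exp (- (of_real \<epsilon> + \<i> * of_real \<omega>) * of_real t) * f t)"

text \<open>With z = - \<epsilon> + i (\<nu> - \<omega>), letting \<open>T\<close> grow gives -
  \<epsilon> / z. This is 1 at resonance and of order \<epsilon> otherwise.\<close>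

lemma laplace_mean_exp_tendsto:
  assumes eps: "\<And>j. eps j > 0" "eps \<longlonglongrightarrow> 0"
  shows "((\<lambda>p. laplace_mean \<omega> (eps (fst p)) (snd p) (\<lambda>t. exp (\<i> * of_real (\<nu> * t))))
     \<longlongrightarrow> (if \<nu> = \<omega> then 1 else 0)) iterated_limit_filter"
proof (rule tendsto_iterated)
  define z where "z j = - of_real (eps j) + \<i> * of_real (\<nu> - \<omega>)" for j
  have z: "z j \<noteq> 0" for j using eps(1)[of j] by (auto simp: z_def complex_eq_iff)
  have eq: "laplace_mean \<omega> (eps j) T (\<lambda>t. exp (\<i> * of_real (\<nu> * t))) = of_real (eps j) * ((exp (z j * of_real T) - 1) / z j)"
    if "T \<ge> 0" for j T
  proof -
    have "((\<lambda>t. exp (z j * of_real t) / z j) has_vector_derivative exp (z j * of_real t)) (at t within {0..T})" for t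
    proof -
      have "((\<lambda>t. exp (z j * t) / z j) has_field_derivative exp (z j * of_real t)) (at (of_real t))"
        using z[of j] by (auto intro!: derivative_eq_intros)
      then show ?thesis by (rule has_vector_derivative_real_field)
    qed
    then have "((\<lambda>t. exp (z j * of_real t)) has_integral (exp (z j * of_real T) / z j - exp (z j * of_real 0) / z j)) {0..T}"
      using that by (intro fundamental_theorem_of_calculus) auto
    then have "integral {0..T} (\<lambda>t. exp (z j * of_real t)) = (exp (z j * of_real T) - 1) / z j"
      by (simp add: integral_unique diff_divide_distrib)
    moreover have "exp (- (of_real (eps j) + \<i> * of_real \<omega>) * of_real t) * exp (\<i> * of_real (\<nu> * t)) = exp (z j * of_real t)" for t
      unfolding z_def exp_add[symmetric] by (simp add: algebra_simps)
    ultimately show ?thesis unfolding laplace_mean_def by simp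
  qed
  show "((\<lambda>T. laplace_mean \<omega> (eps j) T (\<lambda>t. exp (\<i> * of_real (\<nu> * t)))) \<longlongrightarrow> of_real (eps j) * ((0 - 1) / z j)) at_top" for j
  proof -
    have "filterlim (\<lambda>T. eps j * T) at_top at_top"
      by (rule filterlim_tendsto_pos_mult_at_top[OF tendsto_const eps(1) filterlim_ident])
    then have "filterlim (\<lambda>T. - (eps j * T)) at_bot at_top" by (simp add: filterlim_uminus_at_bot)
    then have "((\<lambda>T. exp (- (eps j * T))) \<longlongrightarrow> 0) at_top" by (rule filterlim_compose[OF exp_at_bot])
    then have "((\<lambda>T. exp (z j * of_real T)) \<longlongrightarrow> 0) at_top"
      by (rule Lim_null_comparison[rotated]) (simp add: z_def)
    then have "((\<lambda>T. of_real (eps j) * ((exp (z j * of_real T) - 1) / z j)) \<longlongrightarrow> of_real (eps j) * ((0 - 1) / z j)) at_top"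
      using z by (intro tendsto_intros) auto
    moreover have "\<forall>\<^sub>F T in at_top. of_real (eps j) * ((exp (z j * of_real T) - 1) / z j)
       = laplace_mean \<omega> (eps j) T (\<lambda>t. exp (\<i> * of_real (\<nu> * t)))"
      using eventually_ge_at_top[of 0] by eventually_elim (simp only: eq)
    ultimately show ?thesis by (rule Lim_transform_eventually)
  qed
  show "(\<lambda>j. of_real (eps j) * ((0 - 1) / z j)) \<longlonglongrightarrow> (if \<nu> = \<omega> then 1 else 0)"
  proof (cases "\<nu> = \<omega>")
    case True
    have "of_real (eps j) * ((0 - 1) / z j) = 1" for j using eps(1)[of j] True by (simp add: z_def)
    then show ?thesis using True by simp
  next
    case False
    have "(\<lambda>j. of_real (eps j) * ((0 - 1) / z j)) \<longlonglongrightarrow> of_real 0 * ((0 - 1) / (- of_real 0 + \<i> * of_real (\<nu> - \<omega>)))"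
      unfolding z_def using False by (intro tendsto_intros eps(2)) auto
    then show ?thesis using False by simp
  qed
qed

lemma infsum_finite_tail_bound:
  fixes f :: "'b \<Rightarrow> 'a :: banach"
  assumes "(\<lambda>x. norm (f x)) summable_on S" "finite F" "F \<subseteq> S"
  shows "norm (infsum f S - sum f F) \<le> infsum (\<lambda>x. norm (f x)) S - (\<Sum>x\<in>F. norm (f x))"
proof -
  have sub: "(\<lambda>x. norm (f x)) summable_on (S - F)" using assms(1) by (rule summable_on_subset_banach) auto
  have S: "F \<union> (S - F) = S" using assms(3) by blast
  have "infsum f S = sum f F + infsum f (S - F)"
    using infsum_Un_disjoint[of f F "S - F"] abs_summable_summable[OF sub] assms(2) S by auto
  moreover have "infsum (\<lambda>x. norm (f x)) S = sum (\<lambda>x. norm (f x)) F + infsum (\<lambda>x. norm (f x)) (S - F)"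
    using infsum_Un_disjoint[of "\<lambda>x. norm (f x)" F "S - F"] sub assms(2) S by auto
  ultimately show ?thesis using norm_infsum_bound[OF sub] by simp
qed

lemma laplace_mean_linear:
  assumes "continuous_on {0..} f" "\<And>m. m \<in> F \<Longrightarrow> continuous_on {0..} (e m)" "finite F"
  shows "laplace_mean \<omega> \<epsilon> T (\<lambda>t. f t - (\<Sum>m\<in>F. c m * e m t))
     = laplace_mean \<omega> \<epsilon> T f - (\<Sum>m\<in>F. c m * laplace_mean \<omega> \<epsilon> T (e m))"
proof -
  let ?E = "\<lambda>t. exp (- (of_real \<epsilon> + \<i> * of_real \<omega>) * of_real t)"
  have int: "(\<lambda>t. ?E t * g t) integrable_on {0..T}" if "continuous_on {0..} g" for g :: "real \<Rightarrow> complex"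
    by (intro integrable_continuous_interval continuous_intros continuous_on_subset[OF that]) auto
  have "integral {0..T} (\<lambda>t. ?E t * (f t - (\<Sum>m\<in>F. c m * e m t)))
      = integral {0..T} (\<lambda>t. ?E t * f t - (\<Sum>m\<in>F. c m * (?E t * e m t)))"
    by (simp add: algebra_simps sum_distrib_left sum_distrib_right)
  also have "\<dots> = integral {0..T} (\<lambda>t. ?E t * f t) - integral {0..T} (\<lambda>t. \<Sum>m\<in>F. c m * (?E t * e m t))"
    by (intro Henstock_Kurzweil_Integration.integral_diff int assms integrable_sum integrable_on_mult_right)
  also have "integral {0..T} (\<lambda>t. \<Sum>m\<in>F. c m * (?E t * e m t)) = (\<Sum>m\<in>F. integral {0..T} (\<lambda>t. c m * (?E t * e m t)))"
  proof (rule Henstock_Kurzweil_Integration.integral_sum[OF assms(3)])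
    show "(\<lambda>t. c m * (?E t * e m t)) integrable_on {0..T}" if "m \<in> F" for m
      by (rule integrable_on_mult_right[OF int[OF assms(2)[OF that]]])
  qed
  finally have eq: "integral {0..T} (\<lambda>t. ?E t * (f t - (\<Sum>m\<in>F. c m * e m t)))
      = integral {0..T} (\<lambda>t. ?E t * f t) - (\<Sum>m\<in>F. c m * integral {0..T} (\<lambda>t. ?E t * e m t))"
    by (simp only: integral_mult_right)
  show ?thesis unfolding laplace_mean_def eq
    by (simp only: right_diff_distrib sum_distrib_left mult.left_commute)
qed

text \<open>The stretch before \<open>T0\<close> contributes a term that vanishes with \<epsilon>;
  the later one contributes at most d times the total mass 1 of \<epsilon> exp (- \<epsilon> t),
  uniformly in \<epsilon> and \<open>T\<close>.\<close>

lemma laplace_mean_bound: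
  assumes "continuous_on {0..} g" "\<epsilon> > 0" "0 \<le> T0" "T0 \<le> T"
    and "\<And>t. 0 \<le> t \<Longrightarrow> t \<le> T0 \<Longrightarrow> cmod (g t) \<le> B" and "\<And>t. T0 \<le> t \<Longrightarrow> cmod (g t) \<le> d"
  shows "cmod (laplace_mean \<omega> \<epsilon> T g) \<le> \<epsilon> * B * T0 + d"
proof -
  let ?h = "\<lambda>t. exp (- (of_real \<epsilon> + \<i> * of_real \<omega>) * of_real t) * g t"
  have cont: "continuous_on {0..} ?h" by (intro continuous_intros assms(1))
  then have int: "?h integrable_on {a..b}" if "0 \<le> a" for a b
    using that by (intro integrable_continuous_interval continuous_on_subset[OF cont]) auto
  have hn: "cmod (?h t) = exp (- \<epsilon> * t) * cmod (g t)" for t by (simp add: norm_mult)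
  have "d \<ge> 0" using assms(6)[of T0] norm_ge_zero order_trans by blast
  have B: "B \<ge> 0" using assms(5)[of 0] assms(3) norm_ge_zero order_trans by blast
  have "cmod (integral {0..T0} ?h) \<le> B * (T0 - 0)"
  proof (intro integral_bound assms(3) continuous_on_subset[OF cont])
    fix t assume t: "t \<in> {0..T0}"
    have "exp (- \<epsilon> * t) * cmod (g t) \<le> 1 * B"
      using t assms(2,5) B by (intro mult_mono) auto
    then show "cmod (?h t) \<le> B" unfolding hn by simp
  qed auto
  moreover have "cmod (integral {T0..T} ?h) \<le> d / \<epsilon>"
  proof -
    have hi: "((\<lambda>t. d * exp (- \<epsilon> * t)) has_integral ((- d / \<epsilon> * exp (- \<epsilon> * T)) - (- d / \<epsilon> * exp (- \<epsilon> * T0)))) {T0..T}"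
      using assms(2,4) by (intro fundamental_theorem_of_calculus)
        (auto intro!: derivative_eq_intros simp: has_real_derivative_iff_has_vector_derivative[symmetric])
    have "cmod (integral {T0..T} ?h) \<le> integral {T0..T} (\<lambda>t. d * exp (- \<epsilon> * t))"
    proof (rule integral_norm_bound_integral)
      fix t assume t: "t \<in> {T0..T}"
      have "exp (- \<epsilon> * t) * cmod (g t) \<le> exp (- \<epsilon> * t) * d"
        using t assms(6) by (intro mult_left_mono) auto
      then show "cmod (?h t) \<le> d * exp (- \<epsilon> * t)" unfolding hn by (simp add: mult.commute)
    qed (use int assms(3) hi in auto)
    also have "\<dots> = d / \<epsilon> * exp (- \<epsilon> * T0) - d / \<epsilon> * exp (- \<epsilon> * T)" using integral_unique[OF hi] by simp
    also have "\<dots> \<le> d / \<epsilon> * 1 - 0"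
      using \<open>d \<ge> 0\<close> assms(2,3) by (intro diff_mono mult_left_mono) auto
    finally show ?thesis by simp
  qed
  moreover have "integral {0..T} ?h = integral {0..T0} ?h + integral {T0..T} ?h"
    using Henstock_Kurzweil_Integration.integral_combine[OF assms(3,4) int] by simp
  ultimately have "cmod (integral {0..T} ?h) \<le> B * T0 + d / \<epsilon>"
    using norm_triangle_ineq[of "integral {0..T0} ?h" "integral {T0..T} ?h"] by simp
  then have "\<epsilon> * cmod (integral {0..T} ?h) \<le> \<epsilon> * (B * T0 + d / \<epsilon>)" using assms(2) by (intro mult_left_mono) auto
  also have "\<dots> = \<epsilon> * B * T0 + d" using assms(2) by (simp add: field_simps)
  finally show ?thesis unfolding laplace_mean_def using assms(2) by (simp add: norm_mult)
qed

text \<open>Absolute convergence leaves a finite trigonometric sum, whose means are explicit, and a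
  remainder that is small at late times. The limit is stated as a sum over all m with the same
  frequency as n: the single index n if \<omega>0 is nonzero, all integers if it is zero.\<close>

lemma fourier_asymp_laplace_mean:
  fixes n :: int
  assumes cont: "continuous_on {0..} f" and f: "fourier_asymp \<omega>0 f c"
    and eps: "\<And>j. eps j > 0" "eps \<longlonglongrightarrow> 0"
  shows "((\<lambda>p. laplace_mean (of_int n * \<omega>0) (eps (fst p)) (snd p) f)
     \<longlongrightarrow> (\<Sum>\<^sub>\<infinity>m\<in>{m. of_int m * \<omega>0 = of_int n * \<omega>0}. c m)) iterated_limit_filter"
proof (rule tendstoI)
  fix e :: real assume e: "e > 0"
  \<comment> \<open>The errors add up to 5 d: 3 d from the remainder \<open>G\<close>, d from the
    convergence of the finite sum and d from the coefficients outside \<open>F\<close>.\<close>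
  define d where "d = e / 6"
  have d: "d > 0" using e by (simp add: d_def)
  let ?R = "{m. of_int m * \<omega>0 = of_int n * \<omega>0}"
  define E where "E m t = exp (\<i> * of_real (of_int m * \<omega>0 * t))" for m :: int and t :: real
  have E: "cmod (E m t) = 1" for m t by (simp add: E_def)
  have abs: "(\<lambda>n. norm (c n)) summable_on UNIV" using f by (simp add: fourier_asymp_def)
  obtain F where "finite F \<and> F \<subseteq> UNIV \<and>
      dist (\<Sum>n\<in>F. norm (c n)) (infsum (\<lambda>n. norm (c n)) UNIV) \<le> d"
    using infsum_finite_approximation[OF abs d] by (rule exE)
  then have F: "finite F" "infsum (\<lambda>n. norm (c n)) UNIV - (\<Sum>n\<in>F. norm (c n)) \<le> d"
    unfolding dist_real_def by linarith+
  have tailE: "cmod ((\<Sum>\<^sub>\<infinity>n. c n * E n t) - (\<Sum>n\<in>F. c n * E n t)) \<le> d" for t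
    using infsum_finite_tail_bound[of "\<lambda>n. c n * E n t" UNIV F] F abs by (simp add: norm_mult E)
  define G where "G t = f t - (\<Sum>n\<in>F. c n * E n t)" for t
  have contE: "continuous_on {0..} (E m)" for m unfolding E_def by (intro continuous_intros)
  have contG: "continuous_on {0..} G" unfolding G_def by (intro continuous_intros cont contE)
  have "\<forall>\<^sub>F t in at_top. dist (f t - (\<Sum>\<^sub>\<infinity>n. c n * E n t)) 0 < d"
    using f d unfolding fourier_asymp_def E_def by (intro tendstoD) auto
  then obtain T1 where T1: "\<And>t. t \<ge> T1 \<Longrightarrow> cmod (f t - (\<Sum>\<^sub>\<infinity>n. c n * E n t)) < d"
    by (auto simp: eventually_at_top_linorder)
  define T0 where "T0 = max 0 T1"
  have T0: "T0 \<ge> 0" by (simp add: T0_def)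
  have G_late: "cmod (G t) \<le> 2 * d" if "T0 \<le> t" for t
  proof -
    have "G t = (f t - (\<Sum>\<^sub>\<infinity>n. c n * E n t)) + ((\<Sum>\<^sub>\<infinity>n. c n * E n t) - (\<Sum>n\<in>F. c n * E n t))"
      by (simp add: G_def)
    then have "cmod (G t) \<le> cmod (f t - (\<Sum>\<^sub>\<infinity>n. c n * E n t)) + cmod ((\<Sum>\<^sub>\<infinity>n. c n * E n t) - (\<Sum>n\<in>F. c n * E n t))"
      by (metis norm_triangle_ineq)
    then show ?thesis using T1[of t] tailE[of t] that by (simp add: T0_def)
  qed
  have "compact (G ` {0..T0})" by (intro compact_continuous_image continuous_on_subset[OF contG]) auto
  from compact_imp_bounded[OF this] obtain B where "\<forall>z\<in>G ` {0..T0}. cmod z \<le> B"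
    unfolding bounded_iff by blast
  then have B: "\<And>t. 0 \<le> t \<Longrightarrow> t \<le> T0 \<Longrightarrow> cmod (G t) \<le> B" by simp
  have main: "((\<lambda>p. \<Sum>m\<in>F. c m * laplace_mean (of_int n * \<omega>0) (eps (fst p)) (snd p) (E m))
     \<longlongrightarrow> (\<Sum>m\<in>F. c m * (if of_int m * \<omega>0 = of_int n * \<omega>0 then 1 else 0))) iterated_limit_filter"
    unfolding E_def by (intro tendsto_sum tendsto_mult tendsto_const laplace_mean_exp_tendsto eps)
  have "(\<Sum>m\<in>F. c m * (if of_int m * \<omega>0 = of_int n * \<omega>0 then 1 else 0)) = (\<Sum>m\<in>F \<inter> ?R. c m)"
    unfolding sum.inter_restrict[OF F(1)] by (intro sum.cong) auto
  moreover have "cmod ((\<Sum>\<^sub>\<infinity>m\<in>?R. c m) - (\<Sum>m\<in>F \<inter> ?R. c m)) \<le> d"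
  proof -
    have "infsum (\<lambda>n. norm (c n)) ?R - (\<Sum>n\<in>F \<inter> ?R. norm (c n)) \<le> d"
    proof -
      have i: "infsum (\<lambda>n. norm (c n)) UNIV = infsum (\<lambda>n. norm (c n)) ?R + infsum (\<lambda>n. norm (c n)) (- ?R)"
        using infsum_Un_disjoint[of "\<lambda>n. norm (c n)" ?R "- ?R"] summable_on_subset_banach[OF abs] by auto
      have "(\<Sum>n\<in>F - ?R. norm (c n)) \<le> infsum (\<lambda>n. norm (c n)) (- ?R)"
        using F(1) summable_on_subset_banach[OF abs] by (intro finite_sum_le_infsum) auto
      moreover have "(\<Sum>n\<in>F. norm (c n)) = (\<Sum>n\<in>F \<inter> ?R. norm (c n)) + (\<Sum>n\<in>F - ?R. norm (c n))"
        by (rule sum.Int_Diff[OF F(1)])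
      ultimately show ?thesis using F(2) i by linarith
    qed
    then show ?thesis
      using infsum_finite_tail_bound[of c ?R "F \<inter> ?R"] F(1) summable_on_subset_banach[OF abs, of ?R] by auto
  qed
  ultimately have lim: "cmod ((\<Sum>\<^sub>\<infinity>m\<in>?R. c m)
     - (\<Sum>m\<in>F. c m * (if of_int m * \<omega>0 = of_int n * \<omega>0 then 1 else 0))) \<le> d" (is "cmod (_ - ?s) \<le> d") by simp
  have small: "\<forall>\<^sub>F p in iterated_limit_filter. cmod (laplace_mean (of_int n * \<omega>0) (eps (fst p)) (snd p) G) \<le> 3 * d"
    unfolding eventually_iterated
  proof -
    have "(\<lambda>j. eps j * B * T0) \<longlonglongrightarrow> 0 * B * T0" by (intro tendsto_intros eps(2))
    then have "\<forall>\<^sub>F j in sequentially. eps j * B * T0 < d" using d by (intro order_tendstoD) auto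
    then show "\<forall>\<^sub>F j in sequentially. \<forall>\<^sub>F T in at_top.
      cmod (laplace_mean (of_int n * \<omega>0) (eps (fst (j, T))) (snd (j, T)) G) \<le> 3 * d"
    proof eventually_elim
      case (elim j)
      show ?case using eventually_ge_at_top[of T0]
      proof eventually_elim
        fix T assume "T0 \<le> T"
        have "cmod (laplace_mean (of_int n * \<omega>0) (eps j) T G) \<le> eps j * B * T0 + 2 * d"
          by (rule laplace_mean_bound[OF contG eps(1) T0 \<open>T0 \<le> T\<close> B G_late])
        then show "cmod (laplace_mean (of_int n * \<omega>0) (eps (fst (j, T))) (snd (j, T)) G) \<le> 3 * d"
          using elim by simp
      qed
    qed
  qed
  have lin: "laplace_mean (of_int n * \<omega>0) \<epsilon> T f
      = laplace_mean (of_int n * \<omega>0) \<epsilon> T G + (\<Sum>m\<in>F. c m * laplace_mean (of_int n * \<omega>0) \<epsilon> T (E m))" for \<epsilon> T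
    unfolding G_def by (subst laplace_mean_linear) (auto intro: cont contE F(1))
  show "\<forall>\<^sub>F p in iterated_limit_filter.
    dist (laplace_mean (of_int n * \<omega>0) (eps (fst p)) (snd p) f) (\<Sum>\<^sub>\<infinity>m\<in>?R. c m) < e"
    using small tendstoD[OF main d]
  proof eventually_elim
    case (elim p)
    let ?A = "laplace_mean (of_int n * \<omega>0) (eps (fst p)) (snd p)"
    have eq: "?A f - (\<Sum>\<^sub>\<infinity>m\<in>?R. c m)
      = ?A G + ((\<Sum>m\<in>F. c m * ?A (E m)) - ?s) - ((\<Sum>\<^sub>\<infinity>m\<in>?R. c m) - ?s)" unfolding lin by simp
    have tri: "cmod (a + b - b') \<le> cmod a + cmod b + cmod b'" for a b b' :: complex
      using norm_triangle_ineq4[of "a + b" b'] norm_triangle_ineq[of a b] by linarith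
    have "cmod (?A f - (\<Sum>\<^sub>\<infinity>m\<in>?R. c m)) \<le> 3 * d + d + d"
      unfolding eq
      by (rule order_trans[OF tri add_mono[OF add_mono[OF elim(1) less_imp_le[OF elim(2)[unfolded dist_norm]]] lim]])
    then show ?case using e unfolding dist_norm d_def by linarith
  qed
qed

section \<open>First-order equations on the half-line\<close>

lemma exp_times_has_vector_derivative:
  fixes f :: "real \<Rightarrow> complex"
  assumes "(f has_vector_derivative f') (at y within S)"
  shows "((\<lambda>y. exp (\<mu> * of_real (y - x)) * f y) has_vector_derivative
    exp (\<mu> * of_real (y - x)) * (\<mu> * f y + f')) (at y within S)"
proof -
  have "((\<lambda>y. exp (\<mu> * (y - of_real x))) has_field_derivative exp (\<mu> * (of_real y - of_real x)) * \<mu>) (at (of_real y))"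
    by (auto intro!: derivative_eq_intros)
  from has_vector_derivative_real_field[OF this]
  have "((\<lambda>y. exp (\<mu> * of_real (y - x))) has_vector_derivative exp (\<mu> * of_real (y - x)) * \<mu>) (at y within S)"
    by simp
  from has_vector_derivative_mult[OF this assms] show ?thesis
    by (simp add: algebra_simps)
qed

lemma linear_ode_variation:
  fixes f r :: "real \<Rightarrow> complex"
  assumes "\<And>y. y \<ge> 0 \<Longrightarrow> (f has_vector_derivative \<mu> * f y + r y) (at y within {0..})"
    and "0 \<le> a" "a \<le> b"
  shows "((\<lambda>y. exp (- \<mu> * of_real (y - x)) * r y) has_integral
     (exp (- \<mu> * of_real (b - x)) * f b - exp (- \<mu> * of_real (a - x)) * f a)) {a..b}"
proof (rule fundamental_theorem_of_calculus[OF assms(3)])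
  fix y assume y: "y \<in> {a..b}"
  then have "(f has_vector_derivative \<mu> * f y + r y) (at y within {a..b})"
    using assms by (intro has_vector_derivative_within_subset[OF assms(1)]) auto
  from exp_times_has_vector_derivative[OF this, of "- \<mu>" x]
  show "((\<lambda>y. exp (- \<mu> * of_real (y - x)) * f y) has_vector_derivative
      exp (- \<mu> * of_real (y - x)) * r y) (at y within {a..b})" by simp
qed

text \<open>A bounded solution of an equation with a growing homogeneous mode is determined by its
  source, through the integral from x to infinity. The bound \<open>B\<close> is multiplied by exp
  (- Re \<mu> (R - x)) and drops out of the conclusion; this is essential, since in the applications
  \<open>B\<close> depends on \<open>T\<close> in an unknown way.\<close>

lemma linear_ode_growing_bound:
  fixes f r :: "real \<Rightarrow> complex"
  assumes f: "\<And>y. y \<ge> 0 \<Longrightarrow> (f has_vector_derivative \<mu> * f y + r y) (at y within {0..})"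
    and r: "continuous_on {0..} r" and \<mu>: "Re \<mu> > 0" and bdd: "\<And>y. y \<ge> 0 \<Longrightarrow> cmod (f y) \<le> B"
    and x: "x \<ge> 0"
    and Q: "\<And>R. R \<ge> x \<Longrightarrow> integral {x..R} (\<lambda>y. exp (- Re \<mu> * (y - x)) * cmod (r y)) \<le> Q"
  shows "cmod (f x) \<le> Q"
proof -
  have "cmod (f x) \<le> exp (- (Re \<mu> * (R - x))) * B + Q" if R: "R \<ge> x" for R
  proof -
    note hi = linear_ode_variation[of f \<mu> r x R x, OF f x R]
    let ?J = "integral {x..R} (\<lambda>y. exp (- \<mu> * of_real (y - x)) * r y)"
    have J: "?J = exp (- \<mu> * of_real (R - x)) * f R - f x"
      using integral_unique[OF hi] by simp
    have cont: "continuous_on {x..R} r" using x by (intro continuous_on_subset[OF r]) auto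
    have "cmod ?J \<le> integral {x..R} (\<lambda>y. exp (- Re \<mu> * (y - x)) * cmod (r y))"
      by (rule integral_norm_bound_integral)
         (use cont in \<open>auto intro!: integrable_continuous_interval continuous_intros simp: norm_mult\<close>)
    then have J_le: "cmod ?J \<le> Q" using Q[OF R] by simp
    have "f x = exp (- \<mu> * of_real (R - x)) * f R - ?J" unfolding J by simp
    then have "cmod (f x) \<le> cmod (exp (- \<mu> * of_real (R - x)) * f R) + cmod ?J"
      by (metis norm_triangle_ineq4)
    also have "cmod (exp (- \<mu> * of_real (R - x)) * f R) = exp (- (Re \<mu> * (R - x))) * cmod (f R)"
      by (simp add: norm_mult)
    also have "\<dots> \<le> exp (- (Re \<mu> * (R - x))) * B" using bdd[of R] x R by (intro mult_left_mono) auto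
    finally show ?thesis using J_le by simp
  qed
  then have "\<forall>\<^sub>F R in at_top. cmod (f x) \<le> exp (- (Re \<mu> * (R - x))) * B + Q"
    using eventually_ge_at_top[of x] by (rule eventually_mono[rotated]) 
  moreover have "((\<lambda>R. exp (- (Re \<mu> * (R - x))) * B + Q) \<longlongrightarrow> 0 * B + Q) at_top"
  proof (intro tendsto_intros)
    have "filterlim (\<lambda>R. R - x) at_top at_top"
      using filterlim_tendsto_add_at_top[OF tendsto_const filterlim_ident, of "- x"] by (simp add: add.commute)
    from filterlim_tendsto_pos_mult_at_top[OF tendsto_const \<mu> this]
    have "filterlim (\<lambda>R. - (Re \<mu> * (R - x))) at_bot at_top" by (simp only: filterlim_uminus_at_bot minus_minus)
    then show "((\<lambda>R. exp (- (Re \<mu> * (R - x)))) \<longlongrightarrow> 0) at_top" by (rule filterlim_compose[OF exp_at_bot])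
  qed
  ultimately have "cmod (f x) \<le> 0 * B + Q" by (intro tendsto_lowerbound[where F = at_top]) auto
  then show ?thesis by simp
qed

lemma integral_exp_decay_le:
  fixes m :: real
  assumes "m > 0" "x \<le> R"
  shows "integral {x..R} (\<lambda>y. exp (- m * (y - x))) \<le> 1 / m"
proof -
  have "((\<lambda>y. exp (- m * (y - x))) has_integral (- exp (- m * (R - x)) / m - (- exp (- m * (x - x)) / m))) {x..R}"
    using assms by (intro fundamental_theorem_of_calculus)
      (auto intro!: derivative_eq_intros simp: has_real_derivative_iff_has_vector_derivative[symmetric])
  then have "integral {x..R} (\<lambda>y. exp (- m * (y - x))) = 1 / m - exp (- m * (R - x)) / m"
    by (simp add: integral_unique)
  moreover have "exp (- m * (R - x)) / m \<ge> 0" using assms by simp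
  ultimately show ?thesis by linarith
qed

lemma linear_ode_growing_sup_bound:
  fixes f r :: "real \<Rightarrow> complex"
  assumes f: "\<And>y. y \<ge> 0 \<Longrightarrow> (f has_vector_derivative \<mu> * f y + r y) (at y within {0..})"
    and r: "continuous_on {0..} r" and \<mu>: "Re \<mu> > 0" and bdd: "\<And>y. y \<ge> 0 \<Longrightarrow> cmod (f y) \<le> B"
    and x: "x \<ge> 0" and M: "\<And>y. y \<ge> 0 \<Longrightarrow> cmod (r y) \<le> M"
  shows "cmod (f x) \<le> M / Re \<mu>"
proof (rule linear_ode_growing_bound[OF f r \<mu> bdd x])
  have M0: "M \<ge> 0" using M[of 0] norm_ge_zero order_trans by blast
  fix R assume R: "R \<ge> x"
  have cont: "continuous_on {x..R} r" using x by (intro continuous_on_subset[OF r]) auto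
  have "integral {x..R} (\<lambda>y. exp (- Re \<mu> * (y - x)) * cmod (r y))
      \<le> integral {x..R} (\<lambda>y. M * exp (- Re \<mu> * (y - x)))"
  proof (rule integral_le)
    fix y assume "y \<in> {x..R}"
    then show "exp (- Re \<mu> * (y - x)) * cmod (r y) \<le> M * exp (- Re \<mu> * (y - x))"
      using M[of y] x by (simp add: mult.commute)
  qed (intro integrable_continuous_interval continuous_intros cont)+
  also have "\<dots> = M * integral {x..R} (\<lambda>y. exp (- Re \<mu> * (y - x)))" by (rule integral_mult_right)
  also have "\<dots> \<le> M * (1 / Re \<mu>)" using integral_exp_decay_le[OF \<mu> R] M0 by (rule mult_left_mono)
  finally show "integral {x..R} (\<lambda>y. exp (- Re \<mu> * (y - x)) * cmod (r y)) \<le> M / Re \<mu>" by simp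
qed

text \<open>Meant for sources known only in mean square, as the energy provides them. The factor
  \<eta> stays outside \<open>r\<close> because the bound is not homogeneous in \<open>r\<close>:
  later \<eta> is an exponentially small number, and the result must be small with it.\<close>

lemma linear_ode_growing_L2_bound:
  fixes f r :: "real \<Rightarrow> complex"
  assumes f: "\<And>y. y \<ge> 0 \<Longrightarrow> (f has_vector_derivative \<mu> * f y + of_real \<eta> * r y) (at y within {0..})"
    and r: "continuous_on {0..} r" and \<mu>: "Re \<mu> > 0" and bdd: "\<And>y. y \<ge> 0 \<Longrightarrow> cmod (f y) \<le> B"
    and x: "x \<ge> 0" and \<eta>: "\<eta> \<ge> 0"
    and M: "\<And>R. R \<ge> 0 \<Longrightarrow> integral {0..R} (\<lambda>y. (cmod (r y))\<^sup>2) \<le> M"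
  shows "cmod (f x) \<le> \<eta> * (1 / Re \<mu> + M)"
proof (rule linear_ode_growing_bound[OF f _ \<mu> bdd x])
  show "continuous_on {0..} (\<lambda>y. of_real \<eta> * r y)" by (intro continuous_intros r)
  fix R assume R: "R \<ge> x"
  have cont: "continuous_on {a..R} r" if "a \<ge> 0" for a using that by (intro continuous_on_subset[OF r]) auto
  let ?e = "\<lambda>y. exp (- Re \<mu> * (y - x))"
  have int: "(\<lambda>y. (cmod (r y))\<^sup>2) integrable_on {a..R}" if "a \<ge> 0" for a
    by (intro integrable_continuous_interval continuous_intros cont that)
  have "integral {x..R} (\<lambda>y. ?e y * cmod (of_real \<eta> * r y))
      \<le> integral {x..R} (\<lambda>y. \<eta> * (?e y + (cmod (r y))\<^sup>2))"
  proof (rule integral_le)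
    fix y assume y: "y \<in> {x..R}"
    have e: "0 \<le> ?e y" "?e y \<le> 1" using y \<mu> by auto
    \<comment> \<open>Replaces the Cauchy-Schwarz inequality for integrals: a b is at most (a^2 +
      b^2) / 2, and a^2 is at most a for 0 <= a <= 1.\<close>
    have "?e y * cmod (r y) \<le> ?e y + (cmod (r y))\<^sup>2"
    proof -
      have "0 \<le> (?e y - cmod (r y))\<^sup>2 + (?e y * (1 - ?e y)) + ?e y + (cmod (r y))\<^sup>2"
        using e by (intro add_nonneg_nonneg mult_nonneg_nonneg) auto
      also have "\<dots> = 2 * (?e y + (cmod (r y))\<^sup>2 - ?e y * cmod (r y))"
        by (simp add: power2_eq_square algebra_simps)
      finally show ?thesis by simp
    qed
    then have "\<eta> * (?e y * cmod (r y)) \<le> \<eta> * (?e y + (cmod (r y))\<^sup>2)" using \<eta> by (rule mult_left_mono)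
    then show "?e y * cmod (of_real \<eta> * r y) \<le> \<eta> * (?e y + (cmod (r y))\<^sup>2)"
      using \<eta> by (simp add: norm_mult mult.left_commute)
  qed (intro integrable_continuous_interval continuous_intros cont x)+
  also have "\<dots> = \<eta> * integral {x..R} (\<lambda>y. ?e y + (cmod (r y))\<^sup>2)" by (rule integral_mult_right)
  also have "integral {x..R} (\<lambda>y. ?e y + (cmod (r y))\<^sup>2) = integral {x..R} ?e + integral {x..R} (\<lambda>y. (cmod (r y))\<^sup>2)"
    by (intro Henstock_Kurzweil_Integration.integral_add int x integrable_continuous_interval continuous_intros)
  also have "\<eta> * \<dots> \<le> \<eta> * (1 / Re \<mu> + M)"
  proof (intro mult_left_mono add_mono integral_exp_decay_le \<mu> R \<eta>)
    have "integral {x..R} (\<lambda>y. (cmod (r y))\<^sup>2) \<le> integral {0..R} (\<lambda>y. (cmod (r y))\<^sup>2)"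
      using x by (intro integral_subset_le int) auto
    also have "\<dots> \<le> M" using M x R by simp
    finally show "integral {x..R} (\<lambda>y. (cmod (r y))\<^sup>2) \<le> M" .
  qed
  finally show "integral {x..R} (\<lambda>y. ?e y * cmod (of_real \<eta> * r y)) \<le> \<eta> * (1 / Re \<mu> + M)" .
qed

text \<open>For the mode that does not grow, the integration starts at the boundary. The bound grows
  linearly in x, which is harmless at fixed x.\<close>

lemma linear_ode_decaying_bound:
  fixes f r :: "real \<Rightarrow> complex"
  assumes f: "\<And>y. y \<ge> 0 \<Longrightarrow> (f has_vector_derivative \<mu> * f y + r y) (at y within {0..})"
    and r: "continuous_on {0..} r" and \<mu>: "Re \<mu> \<le> 0" and x: "x \<ge> 0"
    and M: "\<And>y. y \<ge> 0 \<Longrightarrow> cmod (r y) \<le> M"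
  shows "cmod (f x - exp (\<mu> * of_real x) * f 0) \<le> M * x"
proof -
  note hi = linear_ode_variation[of f \<mu> r 0 x x, OF f order_refl x]
  have cont: "continuous_on {0..x} r" by (intro continuous_on_subset[OF r]) auto
  have "f x - exp (\<mu> * of_real x) * f 0 = integral {0..x} (\<lambda>y. exp (- \<mu> * of_real (y - x)) * r y)"
    using integral_unique[OF hi] by simp
  also have "cmod \<dots> \<le> M * (x - 0)"
  proof (rule integral_bound[OF x])
    show "continuous_on {0..x} (\<lambda>y. exp (- \<mu> * of_real (y - x)) * r y)" by (intro continuous_intros cont)
    fix y assume y: "y \<in> {0..x}"
    have "Re \<mu> * (x - y) \<le> 0" using y \<mu> by (simp add: mult_le_0_iff)
    then have "exp (Re (- \<mu> * of_real (y - x))) \<le> 1" by (simp add: algebra_simps)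
    then show "cmod (exp (- \<mu> * of_real (y - x)) * r y) \<le> M"
      unfolding norm_mult norm_exp_eq_Re using M[of y] y mult_mono[of _ 1 _ M] by fastforce
  qed
  finally show ?thesis by simp
qed

section \<open>The time-integrated equation\<close>

locale wavemaker =
  fixes Am A0 A1 A2 A3 :: real and g0 :: "real \<Rightarrow> complex" and u :: "real \<Rightarrow> real \<Rightarrow> complex"
  assumes sol: "ibvp_solution Am A0 A1 A2 A3 (\<lambda>x. 0) g0 u"
begin

lemma regular: "regular_decaying u"
  using sol by (simp add: ibvp_solution_def)

lemma dx_0 [simp]: "dx 0 f x t = f x t"
  by (simp add: dx_def)

lemma has_vector_derivative_dx:
  assumes "j < 3" "x \<ge> 0" "t \<ge> 0"
  shows "((\<lambda>x. dx j u x t) has_vector_derivative dx (Suc j) u x t) (at x within {0..})"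
proof -
  have "times_differentiable_on 3 {0..} (\<lambda>x. u x t)" using regular assms(3) by (simp add: regular_decaying_def)
  then have "nderiv_on j {0..} (\<lambda>x. u x t) differentiable (at x within {0..})"
    using assms(1,2) by (simp add: times_differentiable_on_def)
  then show ?thesis unfolding dx_def by (simp add: vector_derivative_works)
qed

lemma has_vector_derivative_dt:
  assumes "x \<ge> 0" "t \<ge> 0"
  shows "((\<lambda>t. u x t) has_vector_derivative dt u x t) (at t within {0..})"
proof -
  have "times_differentiable_on 1 {0..} (u x)" using regular assms(1) by (simp add: regular_decaying_def)
  then have "nderiv_on 0 {0..} (u x) differentiable (at t within {0..})"
    using assms(2) unfolding times_differentiable_on_def by blast
  then show ?thesis unfolding dt_def by (simp add: vector_derivative_works)
qed

lemma has_vector_derivative_dx_dt: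
  assumes "j < 2" "x \<ge> 0" "t \<ge> 0"
  shows "((\<lambda>x. dx j (dt u) x t) has_vector_derivative dx (Suc j) (dt u) x t) (at x within {0..})"
proof -
  have "times_differentiable_on 2 {0..} (\<lambda>x. dt u x t)" using regular assms(3) by (simp add: regular_decaying_def)
  then have "nderiv_on j {0..} (\<lambda>x. dt u x t) differentiable (at x within {0..})"
    using assms(1,2) by (simp add: times_differentiable_on_def)
  then show ?thesis unfolding dx_def by (simp add: vector_derivative_works)
qed

lemma continuous_decaying_dx: "j \<le> 3 \<Longrightarrow> continuous_decaying (dx j u)"
  using regular by (simp add: regular_decaying_def)

lemma continuous_decaying_dx_dt: "j \<le> 2 \<Longrightarrow> continuous_decaying (dx j (dt u))"
  using regular by (simp add: regular_decaying_def)

lemma continuous_on_dx: "j \<le> 3 \<Longrightarrow> continuous_on ({0..} \<times> {0..}) (\<lambda>p. dx j u (fst p) (snd p))"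
  using continuous_decaying_dx[of j] by (simp add: continuous_decaying_def case_prod_unfold)

lemma continuous_on_dx_dt: "j \<le> 2 \<Longrightarrow> continuous_on ({0..} \<times> {0..}) (\<lambda>p. dx j (dt u) (fst p) (snd p))"
  using continuous_decaying_dx_dt[of j] by (simp add: continuous_decaying_def case_prod_unfold)

lemma continuous_on_dx_compose:
  assumes "j \<le> 3" "continuous_on S f" "continuous_on S g" "\<And>z. z \<in> S \<Longrightarrow> f z \<ge> 0" "\<And>z. z \<in> S \<Longrightarrow> g z \<ge> 0"
  shows "continuous_on S (\<lambda>z. dx j u (f z) (g z))"
  using continuous_on_compose2[OF continuous_on_dx[OF assms(1)] continuous_on_Pair[OF assms(2,3)]] assms(4,5) by auto

lemma continuous_on_dx_dt_compose:
  assumes "j \<le> 2" "continuous_on S f" "continuous_on S g" "\<And>z. z \<in> S \<Longrightarrow> f z \<ge> 0" "\<And>z. z \<in> S \<Longrightarrow> g z \<ge> 0"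
  shows "continuous_on S (\<lambda>z. dx j (dt u) (f z) (g z))"
  using continuous_on_compose2[OF continuous_on_dx_dt[OF assms(1)] continuous_on_Pair[OF assms(2,3)]] assms(4,5) by auto

lemmas continuous_on_u_compose = continuous_on_dx_compose[of 0, simplified]
lemmas continuous_on_dt_compose = continuous_on_dx_dt_compose[of 0, simplified]

lemma decay_bound:
  assumes "continuous_decaying f"
  obtains C where "C \<ge> 0" "\<And>x t. 0 \<le> x \<Longrightarrow> 0 \<le> t \<Longrightarrow> t \<le> T \<Longrightarrow> cmod (f x t) \<le> C / (1 + x)\<^sup>2"
proof -
  obtain C where C: "\<forall>x\<ge>0. \<forall>t\<in>{0..T}. cmod (f x t) \<le> C / (1 + x)\<^sup>2"
    using assms unfolding continuous_decaying_def by blast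
  have "cmod (f x t) \<le> max C 0 / (1 + x)\<^sup>2" if "0 \<le> x" "0 \<le> t" "t \<le> T" for x t
  proof -
    have "cmod (f x t) \<le> C / (1 + x)\<^sup>2" using C that by simp
    also have "\<dots> \<le> max C 0 / (1 + x)\<^sup>2" by (rule divide_right_mono) auto
    finally show ?thesis .
  qed
  then show thesis by (rule that[OF max.cobounded2])
qed

lemma uniform_bound:
  assumes "continuous_decaying f"
  obtains C where "C \<ge> 0" "\<And>x t. 0 \<le> x \<Longrightarrow> 0 \<le> t \<Longrightarrow> t \<le> T \<Longrightarrow> cmod (f x t) \<le> C"
proof -
  obtain C where C: "C \<ge> 0" "\<And>x t. 0 \<le> x \<Longrightarrow> 0 \<le> t \<Longrightarrow> t \<le> T \<Longrightarrow> cmod (f x t) \<le> C / (1 + x)\<^sup>2"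
    using decay_bound[OF assms, of T] by blast
  have "cmod (f x t) \<le> C" if "0 \<le> x" "0 \<le> t" "t \<le> T" for x t
  proof -
    have "C / (1 + x)\<^sup>2 \<le> C / 1" using C(1) that by (intro divide_left_mono) auto
    then show ?thesis using C(2)[OF that] by simp
  qed
  with C(1) show thesis by (rule that)
qed

text \<open>The equation is posed in the open quadrant and extends to its boundary by continuity of
  all derivatives involved.\<close>

lemma pde:
  assumes "x \<ge> 0" "t \<ge> 0"
  shows "dt u x t - of_real Am * dx 2 (dt u) x t =
        \<i> * of_real A0 * u x t + of_real A1 * dx 1 u x t
        + \<i> * of_real A2 * dx 2 u x t + of_real A3 * dx 3 u x t"
proof -
  define h where "h p = dt u (fst p) (snd p) - of_real Am * dx 2 (dt u) (fst p) (snd p)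
     - (\<i> * of_real A0 * u (fst p) (snd p) + of_real A1 * dx 1 u (fst p) (snd p)
        + \<i> * of_real A2 * dx 2 u (fst p) (snd p) + of_real A3 * dx 3 u (fst p) (snd p))" for p :: "real \<times> real"
  have cl: "closure (({0<..} :: real set) \<times> ({0<..} :: real set)) = {0..} \<times> ({0..} :: real set)" by (simp add: closure_Times)
  have "continuous_on ({0..} \<times> {0..}) h" unfolding h_def
    by (intro continuous_intros continuous_on_u_compose continuous_on_dx_compose
        continuous_on_dt_compose continuous_on_dx_dt_compose) auto
  moreover have "h p = 0" if "p \<in> {0<..} \<times> {0<..}" for p
    using sol that by (auto simp: h_def ibvp_solution_def)
  ultimately have "h p = 0" if "p \<in> {0..} \<times> {0..}" for p
    using continuous_constant_on_closure[of "{0<..} \<times> {0<..}" h 0 p] that unfolding cl by blast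
  from this[of "(x, t)"] assms show ?thesis by (simp add: h_def)
qed

lemma initial_zero:
  assumes "x \<ge> 0"
  shows "u x 0 = 0"
proof -
  have "continuous_on {0..} (\<lambda>x. u x 0)" by (intro continuous_on_u_compose continuous_intros) auto
  moreover have "u x 0 = 0" if "x \<in> {0<..}" for x using sol that by (simp add: ibvp_solution_def)
  ultimately show ?thesis
    using continuous_constant_on_closure[of "{0<..}" "\<lambda>x. u x 0" 0 x] assms by simp
qed

lemma boundary_value: "t > 0 \<Longrightarrow> u 0 t = g0 t"
  using sol by (simp add: ibvp_solution_def)

text \<open>Time derivatives get a separate transform \<open>lapt\<close>, because interchanging
  \<open>dx\<close> and \<open>dt\<close> is not part of the regularity assumed;
  \<open>lapt_Suc_eq\<close> provides the substitute.\<close>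

definition lap :: "complex \<Rightarrow> real \<Rightarrow> nat \<Rightarrow> real \<Rightarrow> complex" where
  "lap s T j x = integral {0..T} (\<lambda>t. exp (- s * of_real t) * dx j u x t)"

definition lapt :: "complex \<Rightarrow> real \<Rightarrow> nat \<Rightarrow> real \<Rightarrow> complex" where
  "lapt s T j x = integral {0..T} (\<lambda>t. exp (- s * of_real t) * dx j (dt u) x t)"

lemma lap_integrable:
  assumes "j \<le> 3" "x \<ge> 0"
  shows "(\<lambda>t. exp (- s * of_real t) * dx j u x t) integrable_on {0..T}"
  using assms by (intro integrable_continuous_interval continuous_intros continuous_on_dx_compose) auto

lemma lapt_integrable:
  assumes "j \<le> 2" "x \<ge> 0"
  shows "(\<lambda>t. exp (- s * of_real t) * dx j (dt u) x t) integrable_on {0..T}"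
  using assms by (intro integrable_continuous_interval continuous_intros continuous_on_dx_dt_compose) auto

lemma has_vector_derivative_lap:
  assumes "j < 3" "x \<ge> 0"
  shows "(lap s T j has_vector_derivative lap s T (Suc j) x) (at x within {0..})"
proof -
  have "((\<lambda>x. integral (cbox 0 T) (\<lambda>t. exp (- s * of_real t) * dx j u x t)) has_vector_derivative
    integral (cbox 0 T) (\<lambda>t. exp (- s * of_real t) * dx (Suc j) u x t)) (at x within {0..})"
  proof (rule leibniz_rule_vector_derivative)
    show "((\<lambda>x. exp (- s * of_real t) * dx j u x t) has_vector_derivative
       exp (- s * of_real t) * dx (Suc j) u x t) (at x within {0..})" if "x \<in> {0..}" "t \<in> cbox 0 T" for x t
      using that assms(1) by (intro has_vector_derivative_mult_right has_vector_derivative_dx) auto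
    show "continuous_on ({0..} \<times> cbox 0 T) (\<lambda>(x, t). exp (- s * of_real t) * dx (Suc j) u x t)"
      unfolding case_prod_unfold
      using assms(1) by (intro continuous_intros continuous_on_dx_compose) auto
  qed (use assms lap_integrable in auto)
  then show ?thesis unfolding lap_def[abs_def] by simp
qed

lemma has_vector_derivative_lapt:
  assumes "j < 2" "x \<ge> 0"
  shows "(lapt s T j has_vector_derivative lapt s T (Suc j) x) (at x within {0..})"
proof -
  have "((\<lambda>x. integral (cbox 0 T) (\<lambda>t. exp (- s * of_real t) * dx j (dt u) x t)) has_vector_derivative
    integral (cbox 0 T) (\<lambda>t. exp (- s * of_real t) * dx (Suc j) (dt u) x t)) (at x within {0..})"
  proof (rule leibniz_rule_vector_derivative)
    show "((\<lambda>x. exp (- s * of_real t) * dx j (dt u) x t) has_vector_derivative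
       exp (- s * of_real t) * dx (Suc j) (dt u) x t) (at x within {0..})" if "x \<in> {0..}" "t \<in> cbox 0 T" for x t
      using that assms(1) by (intro has_vector_derivative_mult_right has_vector_derivative_dx_dt) auto
    show "continuous_on ({0..} \<times> cbox 0 T) (\<lambda>(x, t). exp (- s * of_real t) * dx (Suc j) (dt u) x t)"
      unfolding case_prod_unfold
      using assms(1) by (intro continuous_intros continuous_on_dx_dt_compose) auto
  qed (use assms lapt_integrable in auto)
  then show ?thesis unfolding lapt_def[abs_def] by simp
qed

lemma continuous_on_lap: "j < 3 \<Longrightarrow> continuous_on {0..} (lap s T j)"
  by (rule continuous_on_vector_derivative[OF has_vector_derivative_lap]) auto

lemma lap_bounded:
  assumes "j \<le> 3" "Re s \<ge> 0" "T \<ge> 0"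
  obtains B where "\<And>x. x \<ge> 0 \<Longrightarrow> cmod (lap s T j x) \<le> B"
proof -
  obtain C where C: "C \<ge> 0" "\<And>x t. 0 \<le> x \<Longrightarrow> 0 \<le> t \<Longrightarrow> t \<le> T \<Longrightarrow> cmod (dx j u x t) \<le> C"
    using uniform_bound[OF continuous_decaying_dx[OF assms(1)], of T] by blast
  have "cmod (lap s T j x) \<le> C * (T - 0)" if x: "x \<ge> 0" for x
    unfolding lap_def
  proof (rule integral_bound[OF assms(3)])
    show "continuous_on {0..T} (\<lambda>t. exp (- s * of_real t) * dx j u x t)"
      using x assms(1) by (intro continuous_intros continuous_on_dx_compose) auto
    fix t assume t: "t \<in> {0..T}"
    have "cmod (exp (- s * of_real t)) \<le> 1" using t assms(2) by (simp add: norm_exp_eq_Re)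
    then have "cmod (exp (- s * of_real t)) * cmod (dx j u x t) \<le> 1 * C"
      using C t x by (intro mult_mono) auto
    then show "cmod (exp (- s * of_real t) * dx j u x t) \<le> C" by (simp add: norm_mult)
  qed
  then show thesis by (rule that)
qed

lemma lapt_0_eq:
  assumes "x \<ge> 0" "T \<ge> 0"
  shows "lapt s T 0 x = exp (- s * of_real T) * u x T + s * lap s T 0 x"
proof -
  have "((\<lambda>t. exp (- s * of_real t) * u x t) has_vector_derivative
      exp (- s * of_real t) * (- s * u x t + dt u x t)) (at t within {0..T})" if "t \<in> {0..T}" for t
  proof -
    have du: "((\<lambda>t. u x t) has_vector_derivative dt u x t) (at t within {0..T})"
      by (rule has_vector_derivative_within_subset[OF has_vector_derivative_dt]) (use assms that in auto)
    have "((\<lambda>t. exp (- s * of_real t)) has_vector_derivative - s * exp (- s * of_real t)) (at t within {0..T})"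
    proof -
      have "((\<lambda>t. exp (- s * t)) has_field_derivative - s * exp (- s * of_real t)) (at (of_real t))"
        by (auto intro!: derivative_eq_intros)
      then show ?thesis by (rule has_vector_derivative_real_field)
    qed
    from has_vector_derivative_mult[OF this du] show ?thesis by (simp add: algebra_simps)
  qed
  from fundamental_theorem_of_calculus[OF assms(2) this]
  have hi: "((\<lambda>t. exp (- s * of_real t) * (- s * u x t + dt u x t)) has_integral
     (exp (- s * of_real T) * u x T)) {0..T}"
    using initial_zero[OF assms(1)] by simp
  have "lapt s T 0 x - s * lap s T 0 x = exp (- s * of_real T) * u x T"
  proof -
    have "lapt s T 0 x - s * lap s T 0 x
       = integral {0..T} (\<lambda>t. exp (- s * of_real t) * dx 0 (dt u) x t - s * (exp (- s * of_real t) * dx 0 u x t))"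
      unfolding lap_def lapt_def integral_mult_right[symmetric]
      by (rule Henstock_Kurzweil_Integration.integral_diff[symmetric,
            OF lapt_integrable integrable_on_mult_right[OF lap_integrable]]) (use assms(1) in simp_all)
    also have "\<dots> = integral {0..T} (\<lambda>t. exp (- s * of_real t) * (- s * u x t + dt u x t))"
      by (rule arg_cong[where f = "integral {0..T}"]) (simp add: fun_eq_iff algebra_simps)
    finally show ?thesis using integral_unique[OF hi] by simp
  qed
  then show ?thesis by (simp add: algebra_simps)
qed

text \<open>Integrating by parts in time directly would require that mixed derivatives commute.
  Differentiating the identity for j in x avoids this, as both sides then follow from
  differentiation under the integral and derivatives in x alone.\<close>

lemma lapt_Suc_eq:
  assumes "j < 2" "T \<ge> 0" "x \<ge> 0"
    and eq: "\<And>x. x \<ge> 0 \<Longrightarrow> lapt s T j x = exp (- s * of_real T) * dx j u x T + s * lap s T j x"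
  shows "lapt s T (Suc j) x = exp (- s * of_real T) * dx (Suc j) u x T + s * lap s T (Suc j) x"
proof -
  have "((\<lambda>x. exp (- s * of_real T) * dx j u x T + s * lap s T j x) has_vector_derivative
      exp (- s * of_real T) * dx (Suc j) u x T + s * lap s T (Suc j) x) (at x within {0..})"
    using assms by (intro has_vector_derivative_add has_vector_derivative_mult_right
      has_vector_derivative_dx has_vector_derivative_lap) auto
  then have "(lapt s T j has_vector_derivative
      exp (- s * of_real T) * dx (Suc j) u x T + s * lap s T (Suc j) x) (at x within {0..})"
    by (rule has_vector_derivative_transform[rotated 2]) (use assms eq in auto)
  moreover have "at x within {0..} \<noteq> bot"
  proof -
    have "at_right x \<le> at x within {0..}" using \<open>x \<ge> 0\<close> by (intro at_le) auto
    then show ?thesis using trivial_limit_at_right_real[of x] by (metis le_bot)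
  qed
  ultimately show ?thesis
    using has_vector_derivative_lapt[OF assms(1,3)] vector_derivative_unique_within by blast
qed

lemma lapt_2_eq:
  assumes "T \<ge> 0" "x \<ge> 0"
  shows "lapt s T 2 x = exp (- s * of_real T) * dx 2 u x T + s * lap s T 2 x"
proof -
  have "lapt s T (Suc 0) x = exp (- s * of_real T) * dx (Suc 0) u x T + s * lap s T (Suc 0) x" if "x \<ge> 0" for x
    by (rule lapt_Suc_eq) (use assms that in \<open>simp_all add: lapt_0_eq\<close>)
  then have "lapt s T (Suc (Suc 0)) x = exp (- s * of_real T) * dx (Suc (Suc 0)) u x T + s * lap s T (Suc (Suc 0)) x"
    by (rule lapt_Suc_eq[rotated 3]) (use assms in simp_all)
  then show ?thesis by (simp add: numeral_2_eq_2)
qed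

lemma lap_ode:
  assumes "T \<ge> 0" "x \<ge> 0"
  shows "exp (- s * of_real T) * (u x T - of_real Am * dx 2 u x T) + s * (lap s T 0 x - of_real Am * lap s T 2 x)
     = \<i> * of_real A0 * lap s T 0 x + of_real A1 * lap s T 1 x + \<i> * of_real A2 * lap s T 2 x + of_real A3 * lap s T 3 x"
proof -
  let ?E = "\<lambda>t. exp (- s * of_real t)"
  have L: "((\<lambda>t. ?E t * dx j u x t) has_integral lap s T j x) {0..T}" if "j \<le> 3" for j
    unfolding lap_def using lap_integrable[OF that assms(2)] by (rule integrable_integral)
  have Lt: "((\<lambda>t. ?E t * dx j (dt u) x t) has_integral lapt s T j x) {0..T}" if "j \<le> 2" for j
    unfolding lapt_def using lapt_integrable[OF that assms(2)] by (rule integrable_integral)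
  have lhs: "((\<lambda>t. ?E t * dx 0 (dt u) x t - of_real Am * (?E t * dx 2 (dt u) x t)) has_integral
      (lapt s T 0 x - of_real Am * lapt s T 2 x)) {0..T}"
    by (intro has_integral_diff has_integral_mult_right Lt) auto
  have rhs: "((\<lambda>t. \<i> * of_real A0 * (?E t * dx 0 u x t) + of_real A1 * (?E t * dx 1 u x t)
     + \<i> * of_real A2 * (?E t * dx 2 u x t) + of_real A3 * (?E t * dx 3 u x t)) has_integral
      (\<i> * of_real A0 * lap s T 0 x + of_real A1 * lap s T 1 x + \<i> * of_real A2 * lap s T 2 x + of_real A3 * lap s T 3 x)) {0..T}"
    by (intro has_integral_add has_integral_mult_right L) auto
  have eq: "?E t * dx 0 (dt u) x t - of_real Am * (?E t * dx 2 (dt u) x t)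
    = \<i> * of_real A0 * (?E t * dx 0 u x t) + of_real A1 * (?E t * dx 1 u x t)
     + \<i> * of_real A2 * (?E t * dx 2 u x t) + of_real A3 * (?E t * dx 3 u x t)" if "t \<in> {0..T}" for t
  proof -
    have "?E t * (dt u x t - of_real Am * dx 2 (dt u) x t) = ?E t * (\<i> * of_real A0 * u x t + of_real A1 * dx 1 u x t
        + \<i> * of_real A2 * dx 2 u x t + of_real A3 * dx 3 u x t)"
      using pde[of x t] assms that by simp
    then show ?thesis by (simp add: algebra_simps)
  qed
  have "lapt s T 0 x - of_real Am * lapt s T 2 x = \<i> * of_real A0 * lap s T 0 x
      + of_real A1 * lap s T 1 x + \<i> * of_real A2 * lap s T 2 x + of_real A3 * lap s T 3 x"
    by (rule has_integral_unique[OF has_integral_eq[OF eq lhs] rhs])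
  then show ?thesis unfolding lapt_0_eq[OF assms(2,1)] lapt_2_eq[OF assms] by (simp add: algebra_simps)
qed

end

section \<open>Energy estimates\<close>

text \<open>
  Integrate over $[0,R]$ and take $\delta = 1/(2T)$: the term $\delta e$ is then absorbed by the
  maximum of the energy over $[0,T]$.
\<close>

lemma energy_growth:
  fixes e et F Fx :: "real \<Rightarrow> real \<Rightarrow> real"
  assumes e_deriv: "\<And>x t. x \<ge> 0 \<Longrightarrow> t \<ge> 0 \<Longrightarrow> ((\<lambda>t. e x t) has_vector_derivative et x t) (at t within {0..})"
    and F_deriv: "\<And>x t. x \<ge> 0 \<Longrightarrow> t \<ge> 0 \<Longrightarrow> ((\<lambda>x. F x t) has_vector_derivative Fx x t) (at x within {0..})"
    and e0: "\<And>x. x \<ge> 0 \<Longrightarrow> e x 0 = 0" and e_nonneg: "\<And>x t. x \<ge> 0 \<Longrightarrow> t \<ge> 0 \<Longrightarrow> e x t \<ge> 0"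
    and cont_e: "continuous_on ({0..} \<times> {0..}) (\<lambda>p. e (fst p) (snd p))"
    and cont_et: "continuous_on ({0..} \<times> {0..}) (\<lambda>p. et (fst p) (snd p))"
    and cont_Fx: "continuous_on ({0..} \<times> {0..}) (\<lambda>p. Fx (fst p) (snd p))"
    and ineq: "\<And>\<delta> x t. \<delta> > 0 \<Longrightarrow> x \<ge> 0 \<Longrightarrow> t \<ge> 0 \<Longrightarrow> et x t \<le> Fx x t + \<delta> * e x t + K / \<delta> * exp (- \<kappa> * x)"
    and K: "K \<ge> 0" and \<kappa>: "\<kappa> > 0"
    and flux0: "\<And>t. t \<ge> 0 \<Longrightarrow> - F 0 t \<le> Cb" and Cb: "Cb \<ge> 0"
    and fluxR: "\<And>T. \<exists>C. \<forall>x\<ge>0. \<forall>t\<in>{0..T}. F x t \<le> C / (1 + x)"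
  shows "\<exists>C. \<forall>T\<ge>0. \<forall>R\<ge>0. integral {0..R} (\<lambda>x. e x T) \<le> C * (1 + T)\<^sup>2"
proof -
  have cont_x: "continuous_on {0..R} (\<lambda>x. f x t)"
    if "continuous_on ({0..} \<times> {0..}) (\<lambda>p. f (fst p) (snd p))" "t \<ge> 0" for f :: "real \<Rightarrow> real \<Rightarrow> real" and R t
  proof -
    have "continuous_on {0..R} (\<lambda>x. (x, t))" by (intro continuous_intros)
    then have "continuous_on {0..R} (\<lambda>x. f (fst (x, t)) (snd (x, t)))"
      by (rule continuous_on_compose2[OF that(1)]) (use that(2) in auto)
    then show ?thesis by simp
  qed
  define E where "E R t = integral {0..R} (\<lambda>x. e x t)" for R t
  have E_deriv: "((\<lambda>t. E R t) has_vector_derivative integral {0..R} (\<lambda>x. et x t)) (at t within {0..})"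
    if "t \<ge> 0" for R t
  proof -
    have "((\<lambda>t. integral (cbox 0 R) (\<lambda>x. e x t)) has_vector_derivative integral (cbox 0 R) (\<lambda>x. et x t)) (at t within {0..})"
    proof (rule leibniz_rule_vector_derivative)
      show "continuous_on ({0..} \<times> cbox 0 R) (\<lambda>(t, x). et x t)"
        unfolding case_prod_unfold
      proof -
        have "continuous_on ({0..} \<times> cbox 0 R) (\<lambda>p. (snd p, fst p) :: real \<times> real)" by (intro continuous_intros)
        then have "continuous_on ({0..} \<times> cbox 0 R) (\<lambda>p. et (fst (snd p, fst p)) (snd (snd p, fst p)))"
          by (rule continuous_on_compose2[OF cont_et]) auto
        then show "continuous_on ({0..} \<times> cbox 0 R) (\<lambda>p. et (snd p) (fst p))" by simp
      qed
    qed (use that e_deriv cont_x[OF cont_e] in \<open>auto intro: integrable_continuous_interval\<close>)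
    then show ?thesis by (simp add: E_def)
  qed
  have E_rate: "integral {0..R} (\<lambda>x. et x t) \<le> F R t - F 0 t + \<delta> * E R t + K / (\<delta> * \<kappa>)"
    if "R \<ge> 0" "t \<ge> 0" "\<delta> > 0" for R t \<delta>
  proof -
    have FTC: "((\<lambda>x. Fx x t) has_integral (F R t - F 0 t)) {0..R}"
    proof (rule fundamental_theorem_of_calculus[OF that(1)])
      fix x assume "x \<in> {0..R}"
      then show "((\<lambda>x. F x t) has_vector_derivative Fx x t) (at x within {0..R})"
        by (intro has_vector_derivative_within_subset[OF F_deriv[OF _ that(2)]]) auto
    qed
    have int_e: "(\<lambda>x. e x t) integrable_on {0..R}"
      using that by (intro integrable_continuous_interval cont_x[OF cont_e])
    have int_k: "(\<lambda>x. exp (- \<kappa> * x)) integrable_on {0..R}"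
      by (intro integrable_continuous_interval continuous_intros)
    have Ig: "((\<lambda>x. Fx x t + \<delta> * e x t + K / \<delta> * exp (- \<kappa> * x)) has_integral
       (F R t - F 0 t + \<delta> * E R t + K / \<delta> * integral {0..R} (\<lambda>x. exp (- \<kappa> * x)))) {0..R}"
      unfolding E_def
      by (intro has_integral_add has_integral_mult_right FTC integrable_integral int_e int_k)
    have If: "((\<lambda>x. et x t) has_integral integral {0..R} (\<lambda>x. et x t)) {0..R}"
      using that by (intro integrable_integral integrable_continuous_interval cont_x[OF cont_et])
    have "integral {0..R} (\<lambda>x. et x t)
      \<le> F R t - F 0 t + \<delta> * E R t + K / \<delta> * integral {0..R} (\<lambda>x. exp (- \<kappa> * x))"
      by (rule has_integral_le[OF If Ig]) (use ineq that in auto)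
    moreover have "integral {0..R} (\<lambda>x. exp (- \<kappa> * x)) \<le> 1 / \<kappa>"
      using integral_exp_decay_le[OF \<kappa> that(1)] by simp
    then have "K / \<delta> * integral {0..R} (\<lambda>x. exp (- \<kappa> * x)) \<le> K / \<delta> * (1 / \<kappa>)"
      using K that(3) by (intro mult_left_mono) auto
    ultimately show ?thesis by simp
  qed
  have E_nonneg: "E R t \<ge> 0" if "t \<ge> 0" for R t
    unfolding E_def using that e_nonneg
    by (intro Henstock_Kurzweil_Integration.integral_nonneg integrable_continuous_interval cont_x[OF cont_e]) auto
  have E_mono: "E R t \<le> E R' t" if "t \<ge> 0" "R \<le> R'" for R R' t
    unfolding E_def using that e_nonneg
    by (intro integral_subset_le integrable_continuous_interval cont_x[OF cont_e]) auto
  have bound: "E R T \<le> 2 * T * Cb + 4 * T\<^sup>2 * K / \<kappa>" if T: "T > 0" and R: "R \<ge> 0" for R T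
  proof -
    obtain CT where CT: "\<forall>x\<ge>0. \<forall>t\<in>{0..T}. F x t \<le> CT / (1 + x)" using fluxR by blast
    define D where "D = max CT 0"
    have D: "D \<ge> 0" by (simp add: D_def)
    have FD: "F x t \<le> D / (1 + x)" if "x \<ge> 0" "0 \<le> t" "t \<le> T" for x t
    proof -
      have "F x t \<le> CT / (1 + x)" using CT that by simp
      also have "\<dots> \<le> D / (1 + x)" using that by (intro divide_right_mono) (auto simp: D_def)
      finally show ?thesis .
    qed
    have fin: "E R' T \<le> 2 * T * (D / (1 + R') + Cb + 2 * T * K / \<kappa>)" if R': "R' \<ge> 0" for R'
    proof -
      define A where "A = D / (1 + R') + Cb + 2 * T * K / \<kappa>"
      have A: "A \<ge> 0" unfolding A_def using D Cb K \<kappa> T R' by (intro add_nonneg_nonneg) auto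
      have "continuous_on {0..T} (E R')"
        by (rule continuous_on_subset[OF continuous_on_vector_derivative[OF E_deriv]]) auto
      then obtain t0 where t0: "t0 \<in> {0..T}" "\<And>t. t \<in> {0..T} \<Longrightarrow> E R' t \<le> E R' t0"
        using continuous_attains_sup[of "{0..T}" "E R'"] T by auto
      define S where "S = E R' t0"
      have S: "S \<ge> 0" using E_nonneg t0(1) by (simp add: S_def)
      have rate: "integral {0..R'} (\<lambda>x. et x t) \<le> A + S / (2 * T)" if "t \<in> {0..t0}" for t
      proof -
        have t: "0 \<le> t" "t \<le> T" using that t0(1) by auto
        have "integral {0..R'} (\<lambda>x. et x t) \<le> F R' t - F 0 t + 1 / (2 * T) * E R' t + K / (1 / (2 * T) * \<kappa>)"
          using T by (intro E_rate R' t) auto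
        also have "1 / (2 * T) * E R' t \<le> 1 / (2 * T) * S"
          using t0(2)[of t] t T unfolding S_def by (intro mult_left_mono) auto
        also have "K / (1 / (2 * T) * \<kappa>) = 2 * T * K / \<kappa>" using T by simp
        finally have "integral {0..R'} (\<lambda>x. et x t) \<le> F R' t - F 0 t + 1 / (2 * T) * S + 2 * T * K / \<kappa>"
          by simp
        then show ?thesis using FD[OF R' t] flux0[OF t(1)] unfolding A_def by simp
      qed
      have "((\<lambda>t. integral {0..R'} (\<lambda>x. et x t)) has_integral (E R' t0 - E R' 0)) {0..t0}"
      proof (rule fundamental_theorem_of_calculus)
        show "0 \<le> t0" using t0(1) by simp
        fix t assume "t \<in> {0..t0}"
        then show "(E R' has_vector_derivative integral {0..R'} (\<lambda>x. et x t)) (at t within {0..t0})"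
          by (intro has_vector_derivative_within_subset[OF E_deriv]) auto
      qed
      from has_integral_le[OF this has_integral_const_real rate]
      have "E R' t0 - E R' 0 \<le> t0 * (A + S / (2 * T))" using t0(1) by simp
      moreover have "E R' 0 = 0"
      proof -
        have "E R' 0 = integral {0..R'} (\<lambda>x. 0)" unfolding E_def
          by (rule Henstock_Kurzweil_Integration.integral_cong) (simp add: e0)
        then show ?thesis by simp
      qed
      moreover have "t0 * (A + S / (2 * T)) \<le> T * (A + S / (2 * T))"
        using t0(1) A S T by (intro mult_right_mono add_nonneg_nonneg) auto
      moreover have "T * (A + S / (2 * T)) = T * A + S / 2" using T by (simp add: field_simps)
      ultimately have "S \<le> 2 * T * A" unfolding S_def by simp
      moreover have "E R' T \<le> S" using t0(2)[of T] T by (simp add: S_def)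
      ultimately show ?thesis unfolding A_def by simp
    qed
    \<comment> \<open>The flux through R' decays with a constant depending on \<open>T\<close> in an
      unknown way. Sending R' to infinity at fixed \<open>T\<close> removes it, and a bound explicit
      in \<open>T\<close> remains.\<close>
    have "E R T \<le> 2 * T * (0 + Cb + 2 * T * K / \<kappa>)"
    proof (rule tendsto_lowerbound[where F = at_top])
      show "((\<lambda>R'. 2 * T * (D / (1 + R') + Cb + 2 * T * K / \<kappa>)) \<longlongrightarrow> 2 * T * (0 + Cb + 2 * T * K / \<kappa>)) at_top"
      proof (intro tendsto_intros)
        have "filterlim (\<lambda>R'. 1 + R') at_top (at_top :: real filter)"
          by (rule filterlim_tendsto_add_at_top[OF tendsto_const filterlim_ident])
        then show "((\<lambda>R'. D / (1 + R')) \<longlongrightarrow> 0) at_top"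
          by (intro tendsto_divide_0[OF tendsto_const] filterlim_at_top_imp_at_infinity)
      qed
      show "\<forall>\<^sub>F R' in at_top. E R T \<le> 2 * T * (D / (1 + R') + Cb + 2 * T * K / \<kappa>)"
        using eventually_ge_at_top[of R]
      proof eventually_elim
        case (elim R')
        then have "E R T \<le> E R' T" using T by (intro E_mono) auto
        also have "\<dots> \<le> 2 * T * (D / (1 + R') + Cb + 2 * T * K / \<kappa>)" using elim R by (intro fin) auto
        finally show ?case .
      qed
    qed simp
    then show ?thesis by (simp add: power2_eq_square algebra_simps)
  qed
  have "integral {0..R} (\<lambda>x. e x T) \<le> (2 * Cb + 4 * K / \<kappa>) * (1 + T)\<^sup>2" if T: "T \<ge> 0" and R: "R \<ge> 0" for R T
  proof (cases "T = 0")
    case True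
    have "integral {0..R} (\<lambda>x. e x T) = integral {0..R} (\<lambda>x. 0)"
      by (rule Henstock_Kurzweil_Integration.integral_cong) (simp add: e0 True)
    then show ?thesis using Cb K \<kappa> by simp
  next
    case False
    then have "integral {0..R} (\<lambda>x. e x T) \<le> 2 * Cb * T + 4 * K / \<kappa> * T\<^sup>2"
      using bound[of T R] T R by (simp add: E_def mult_ac)
    also have "\<dots> \<le> 2 * Cb * (1 + T)\<^sup>2 + 4 * K / \<kappa> * (1 + T)\<^sup>2"
    proof (intro add_mono mult_left_mono)
      show "T \<le> (1 + T)\<^sup>2" "T\<^sup>2 \<le> (1 + T)\<^sup>2" using T by (simp_all add: power2_eq_square algebra_simps)
    qed (use Cb K \<kappa> in auto)
    finally show ?thesis by (simp add: algebra_simps)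
  qed
  then show ?thesis by blast
qed

lemma fourier_asymp_bounded:
  assumes cont: "continuous_on {0..} f" and f: "fourier_asymp \<omega>0 f c"
  obtains B where "B \<ge> 0" "\<And>t. t \<ge> 0 \<Longrightarrow> cmod (f t) \<le> B"
proof -
  define p where "p t = (\<Sum>\<^sub>\<infinity>n. c n * exp (\<i> * of_real (of_int n * \<omega>0 * t)))" for t
  have abs: "(\<lambda>n. norm (c n)) summable_on UNIV" using f by (simp add: fourier_asymp_def)
  define M where "M = infsum (\<lambda>n. norm (c n)) UNIV"
  have p: "cmod (p t) \<le> M" for t
    using norm_infsum_bound[of "\<lambda>n. c n * exp (\<i> * of_real (of_int n * \<omega>0 * t))" UNIV] abs
    by (simp add: p_def M_def norm_mult)
  have M: "M \<ge> 0" using p[of 0] norm_ge_zero order_trans by blast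
  have "\<forall>\<^sub>F t in at_top. dist (f t - p t) 0 < 1"
    using f unfolding fourier_asymp_def p_def by (intro tendstoD) auto
  then obtain T where T: "\<And>t. t \<ge> T \<Longrightarrow> cmod (f t - p t) < 1"
    by (auto simp: eventually_at_top_linorder)
  have "compact (f ` {0..T})" by (intro compact_continuous_image continuous_on_subset[OF cont]) auto
  from compact_imp_bounded[OF this] obtain B where B: "\<forall>z\<in>f ` {0..T}. cmod z \<le> B"
    unfolding bounded_iff by blast
  have "cmod (f t) \<le> max B (M + 1)" if "t \<ge> 0" for t
  proof (cases "t \<ge> T")
    case True
    then show ?thesis using T[OF True] p[of t] norm_triangle_sub[of "f t" "p t"] by linarith
  next
    case False
    then show ?thesis using B that by (simp add: max.coboundedI1)
  qed
  moreover have "max B (M + 1) \<ge> 0" using M by linarith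
  ultimately show thesis using that by blast
qed

lemmas has_vector_derivative_inner = bounded_bilinear.has_vector_derivative[OF bounded_bilinear_inner]

lemma abs_inner_le_mult:
  fixes a b :: complex
  assumes "cmod a \<le> M" "cmod b \<le> N"
  shows "\<bar>inner a b\<bar> \<le> M * N"
proof -
  have "\<bar>inner a b\<bar> \<le> cmod a * cmod b" by (rule Cauchy_Schwarz_ineq2)
  also have "\<dots> \<le> M * N" using assms by (intro mult_mono) (auto intro: order_trans[OF norm_ge_zero])
  finally show ?thesis .
qed

lemma norm_add_squared_le: "(norm (a + b))\<^sup>2 \<le> 2 * (norm a)\<^sup>2 + 2 * (norm b)\<^sup>2"
  for a b :: "'a :: real_normed_vector"
proof -
  have "(norm (a + b))\<^sup>2 \<le> (norm a + norm b)\<^sup>2" by (intro power_mono norm_triangle_ineq) simp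
  also have "\<dots> \<le> 2 * (norm a)\<^sup>2 + 2 * (norm b)\<^sup>2"
    using zero_le_power2[of "norm a - norm b"] by (simp add: power2_eq_square algebra_simps)
  finally show ?thesis .
qed

context wavemaker begin

text \<open>The real part of cnj u times the equation: for \<open>Am = 0\<close> the time derivative
  of |u|^2 is exactly the x-derivative of a quadratic flux in u, u_x and u_xx. The flux at x = 0 is
  bounded because these boundary values are, and so the energy has limited growth.\<close>

lemma L2_growth_cubic:
  assumes Am: "Am = 0" and bdd: "\<And>j. j \<le> 2 \<Longrightarrow> \<exists>B. \<forall>t\<ge>0. cmod (dx j u 0 t) \<le> B"
  shows "\<exists>C. \<forall>T\<ge>0. \<forall>R\<ge>0. integral {0..R} (\<lambda>x. (cmod (u x T))\<^sup>2) \<le> C * (1 + T)\<^sup>2"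
proof -
  define flux where "flux a b c = A1 * inner a a + 2 * A2 * inner a (\<i> * b) + A3 * (2 * inner a c - inner b b)"
    for a b c :: complex
  define W where "W = \<bar>A1\<bar> + 2 * \<bar>A2\<bar> + 3 * \<bar>A3\<bar>"
  have W: "W \<ge> 0" by (simp add: W_def)
  have flux_le: "\<bar>flux a b c\<bar> \<le> W * (M * M)" if "cmod a \<le> M" "cmod b \<le> M" "cmod c \<le> M" for a b c M
  proof -
    have i: "\<bar>inner a a\<bar> \<le> M * M" "\<bar>inner a (\<i> * b)\<bar> \<le> M * M" "\<bar>inner a c\<bar> \<le> M * M" "\<bar>inner b b\<bar> \<le> M * M"
      by (rule abs_inner_le_mult; use that in \<open>simp add: norm_mult\<close>)+
    have "\<bar>flux a b c\<bar> \<le> \<bar>A1 * inner a a\<bar> + \<bar>2 * A2 * inner a (\<i> * b)\<bar> + \<bar>A3 * (2 * inner a c - inner b b)\<bar>"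
      unfolding flux_def by linarith
    also have "\<dots> = \<bar>A1\<bar> * \<bar>inner a a\<bar> + 2 * \<bar>A2\<bar> * \<bar>inner a (\<i> * b)\<bar> + \<bar>A3\<bar> * \<bar>2 * inner a c - inner b b\<bar>"
      by (simp only: abs_mult) simp
    also have "\<dots> \<le> \<bar>A1\<bar> * (M * M) + 2 * \<bar>A2\<bar> * (M * M) + \<bar>A3\<bar> * (3 * (M * M))"
    proof (intro add_mono mult_left_mono i)
      show "\<bar>2 * inner a c - inner b b\<bar> \<le> 3 * (M * M)" using i(3,4) by linarith
    qed auto
    finally show ?thesis by (simp add: W_def algebra_simps)
  qed
  obtain b where b: "\<And>j t. j \<le> 2 \<Longrightarrow> t \<ge> 0 \<Longrightarrow> cmod (dx j u 0 t) \<le> b j"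
    using bdd by metis
  define B where "B = max (b 0) (max (b 1) (b 2))"
  have B: "cmod (u 0 t) \<le> B" "cmod (dx 1 u 0 t) \<le> B" "cmod (dx 2 u 0 t) \<le> B" if "t \<ge> 0" for t
    using b[of 0 t] b[of 1 t] b[of 2 t] that by (auto simp: B_def)
  note cont = continuous_on_dx continuous_on_dx[of 0, simplified] continuous_on_dx_dt[of 0, simplified]
  have "\<exists>C. \<forall>T\<ge>0. \<forall>R\<ge>0. integral {0..R} (\<lambda>x. inner (u x T) (u x T)) \<le> C * (1 + T)\<^sup>2"
  \<comment> \<open>There is no source, hence \<open>K = 0\<close>, and \<kappa> can be any positive
    number. \<open>W * (B * B)\<close> bounds the flux at the boundary.\<close>
  proof (rule energy_growth[where K = 0 and \<kappa> = 1 and Cb = "W * (B * B)"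
      and et = "\<lambda>x t. inner (u x t) (dt u x t) + inner (dt u x t) (u x t)"
      and F = "\<lambda>x t. flux (u x t) (dx 1 u x t) (dx 2 u x t)"
      and Fx = "\<lambda>x t. A1 * (inner (u x t) (dx 1 u x t) + inner (dx 1 u x t) (u x t))
         + 2 * A2 * (inner (u x t) (\<i> * dx 2 u x t) + inner (dx 1 u x t) (\<i> * dx 1 u x t))
         + A3 * (2 * (inner (u x t) (dx 3 u x t) + inner (dx 1 u x t) (dx 2 u x t))
            - (inner (dx 1 u x t) (dx 2 u x t) + inner (dx 2 u x t) (dx 1 u x t)))"])
    fix x t :: real assume x: "x \<ge> 0"
    show "inner (u x 0) (u x 0) = 0" using initial_zero[OF x] by simp
    assume t: "t \<ge> 0"
    note ut = has_vector_derivative_dt[OF x t]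
    show "((\<lambda>t. inner (u x t) (u x t)) has_vector_derivative
       inner (u x t) (dt u x t) + inner (dt u x t) (u x t)) (at t within {0..})"
      by (rule has_vector_derivative_inner[OF ut ut])
    have u: "((\<lambda>x. u x t) has_vector_derivative dx 1 u x t) (at x within {0..})"
      "((\<lambda>x. dx 1 u x t) has_vector_derivative dx 2 u x t) (at x within {0..})"
      "((\<lambda>x. dx 2 u x t) has_vector_derivative dx 3 u x t) (at x within {0..})"
      using has_vector_derivative_dx[of 0 x t] has_vector_derivative_dx[of 1 x t] has_vector_derivative_dx[of 2 x t] x t
      by (simp_all add: numeral_2_eq_2 numeral_3_eq_3)
    show "((\<lambda>x. flux (u x t) (dx 1 u x t) (dx 2 u x t)) has_vector_derivative
        A1 * (inner (u x t) (dx 1 u x t) + inner (dx 1 u x t) (u x t))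
         + 2 * A2 * (inner (u x t) (\<i> * dx 2 u x t) + inner (dx 1 u x t) (\<i> * dx 1 u x t))
         + A3 * (2 * (inner (u x t) (dx 3 u x t) + inner (dx 1 u x t) (dx 2 u x t))
            - (inner (dx 1 u x t) (dx 2 u x t) + inner (dx 2 u x t) (dx 1 u x t)))) (at x within {0..})"
      unfolding flux_def
      by (intro has_vector_derivative_add has_vector_derivative_diff has_vector_derivative_mult_right
          has_vector_derivative_inner u)
    show "inner (u x t) (u x t) \<ge> 0" by simp
    fix \<delta> :: real assume "\<delta> > 0"
    have "dt u x t = \<i> * of_real A0 * u x t + of_real A1 * dx 1 u x t
        + \<i> * of_real A2 * dx 2 u x t + of_real A3 * dx 3 u x t" using pde[OF x t] Am by simp
    then have "inner (u x t) (dt u x t) + inner (dt u x t) (u x t)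
      = A1 * (inner (u x t) (dx 1 u x t) + inner (dx 1 u x t) (u x t))
         + 2 * A2 * (inner (u x t) (\<i> * dx 2 u x t) + inner (dx 1 u x t) (\<i> * dx 1 u x t))
         + A3 * (2 * (inner (u x t) (dx 3 u x t) + inner (dx 1 u x t) (dx 2 u x t))
            - (inner (dx 1 u x t) (dx 2 u x t) + inner (dx 2 u x t) (dx 1 u x t)))" (is "_ = ?Fx")
      by (simp add: inner_complex_def algebra_simps)
    moreover have "\<delta> * inner (u x t) (u x t) \<ge> 0" using \<open>\<delta> > 0\<close> by simp
    ultimately show "inner (u x t) (dt u x t) + inner (dt u x t) (u x t)
      \<le> ?Fx + \<delta> * inner (u x t) (u x t) + 0 / \<delta> * exp (- 1 * x)" by simp
  next
    fix t :: real assume t: "t \<ge> 0"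
    show "- flux (u 0 t) (dx 1 u 0 t) (dx 2 u 0 t) \<le> W * (B * B)"
      using flux_le[OF B[OF t]] by linarith
  next
    fix T :: real
    have "\<forall>j. \<exists>c. j \<le> 3 \<longrightarrow> (\<forall>x t. 0 \<le> x \<longrightarrow> 0 \<le> t \<longrightarrow> t \<le> T \<longrightarrow> cmod (dx j u x t) \<le> c / (1 + x)\<^sup>2)"
      using decay_bound[OF continuous_decaying_dx, of _ T] by blast
    from choice[OF this] obtain c where
      c: "\<And>j x t. j \<le> 3 \<Longrightarrow> 0 \<le> x \<Longrightarrow> 0 \<le> t \<Longrightarrow> t \<le> T \<Longrightarrow> cmod (dx j u x t) \<le> c j / (1 + x)\<^sup>2"
      by blast
    define C where "C = max 0 (max (c 0) (max (c 1) (c 2)))"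
    have C: "C \<ge> 0" by (simp add: C_def)
    have cC: "cmod (dx j u x t) \<le> C / (1 + x)\<^sup>2" if "j \<le> 2" "0 \<le> x" "0 \<le> t" "t \<le> T" for j x t
    proof -
      have "j = 0 \<or> j = 1 \<or> j = 2" using that(1) by auto
      then have "c j \<le> C" by (auto simp: C_def)
      then have "c j / (1 + x)\<^sup>2 \<le> C / (1 + x)\<^sup>2" by (intro divide_right_mono) auto
      then show ?thesis using c[of j x t] that by simp
    qed
    have "flux (u x t) (dx 1 u x t) (dx 2 u x t) \<le> W * (C * C) / (1 + x)" if "x \<ge> 0" "t \<in> {0..T}" for x t
    proof -
      have "\<bar>flux (u x t) (dx 1 u x t) (dx 2 u x t)\<bar> \<le> W * (C / (1 + x)\<^sup>2 * (C / (1 + x)\<^sup>2))"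
        using cC[of 0 x t] cC[of 1 x t] cC[of 2 x t] that by (intro flux_le) auto
      also have "\<dots> = W * (C * C) / (1 + x) ^ 4" by (simp add: power2_eq_square power4_eq_xxxx)
      also have "\<dots> \<le> W * (C * C) / (1 + x) ^ 1"
        using that W C by (intro divide_left_mono power_increasing mult_nonneg_nonneg) auto
      finally show ?thesis by simp
    qed
    then show "\<exists>C. \<forall>x\<ge>0. \<forall>t\<in>{0..T}. flux (u x t) (dx 1 u x t) (dx 2 u x t) \<le> C / (1 + x)" by blast
  next
    show "0 \<le> W * (B * B)" using W by simp
    show "(0::real) \<le> 0" "(0::real) < 1" by simp_all
  qed (intro continuous_intros cont; simp)+
  then show ?thesis by (simp add: dot_square_norm)
qed

text \<open>The case s = 0 of the integration by parts. It yields both the vanishing of u_x at time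
  0 and the time derivative of u_x.\<close>

lemma dx_1_eq_integral:
  assumes "x \<ge> 0" "T \<ge> 0"
  shows "dx 1 u x T = integral {0..T} (\<lambda>t. dx 1 (dt u) x t)"
  using lapt_Suc_eq[of 0 T x 0] lapt_0_eq[of _ T 0] assms by (simp add: lapt_def)

lemma has_vector_derivative_dt_dx_1:
  assumes "x \<ge> 0" "t \<ge> 0"
  shows "((\<lambda>t. dx 1 u x t) has_vector_derivative dx 1 (dt u) x t) (at t within {0..})"
proof -
  have "continuous_on {0..t + 1} (\<lambda>t. dx 1 (dt u) x t)"
    using assms by (intro continuous_on_dx_dt_compose continuous_intros) auto
  then have "((\<lambda>t. integral {0..t} (\<lambda>t. dx 1 (dt u) x t)) has_vector_derivative dx 1 (dt u) x t) (at t within {0..t + 1})"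
    using assms by (intro integral_has_vector_derivative) auto
  moreover have "at t within {0..t + 1} = at t within {0..}"
    by (rule at_within_nhd[of t "{t - 1<..<t + 1}"]) auto
  ultimately have "((\<lambda>t. integral {0..t} (\<lambda>t. dx 1 (dt u) x t)) has_vector_derivative dx 1 (dt u) x t) (at t within {0..})"
    by simp
  then show ?thesis
    by (rule has_vector_derivative_transform[rotated 2]) (use assms dx_1_eq_integral in auto)
qed

text \<open>
  Nothing bounds $u_{xt}(0,t)$, which enters the energy balance of $u$. It drops out of the balance of
  $v = u - u(0,t) e^{-\beta x}$ with $\beta = A_{-2}^{-1/2}$, because $e^{-\beta x}$ is annihilated by
  $1 - A_{-2} \partial_x^2$ and $v$ vanishes at $x = 0$.
\<close>

lemma H1_growth_mixed:
  assumes Am: "Am > 0" "A3 = 0" and bdd: "\<And>t. t \<ge> 0 \<Longrightarrow> cmod (u 0 t) \<le> B"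
  shows "\<exists>C. \<forall>T\<ge>0. \<forall>R\<ge>0. integral {0..R} (\<lambda>x. (cmod (u x T))\<^sup>2) \<le> C * (1 + T)\<^sup>2
    \<and> integral {0..R} (\<lambda>x. (cmod (dx 1 u x T))\<^sup>2) \<le> C * (1 + T)\<^sup>2"
proof -
  define \<beta> where "\<beta> = 1 / sqrt Am"
  have \<beta>: "\<beta> > 0" "Am * \<beta>\<^sup>2 = 1" using Am by (simp_all add: \<beta>_def power_divide)
  have B: "B \<ge> 0" using bdd[of 0] norm_ge_zero order_trans by blast
  define \<phi> where "\<phi> x = exp (- \<beta> * x)" for x
  have \<phi>: "\<phi> x > 0" for x by (simp add: \<phi>_def)
  have \<phi>_deriv: "((\<lambda>x. of_real (a * \<phi> x) * z) has_vector_derivative - (of_real (a * \<beta> * \<phi> x) * z)) (at x within {0..})"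
    for a x and z :: complex
  proof -
    have "((\<lambda>x. a * \<phi> x) has_real_derivative - (a * \<beta> * \<phi> x)) (at x within {0..})"
      unfolding \<phi>_def by (auto intro!: derivative_eq_intros)
    then have "((\<lambda>x. of_real (a * \<phi> x) :: complex) has_vector_derivative of_real (- (a * \<beta> * \<phi> x))) (at x within {0..})"
      by (rule has_vector_derivative_of_real)
    from has_vector_derivative_mult_left[OF this, of z] show ?thesis by simp
  qed
  define v where "v x t = u x t - of_real (1 * \<phi> x) * u 0 t" for x t
  define vt where "vt x t = dt u x t - of_real (1 * \<phi> x) * dt u 0 t" for x t
  define v1 where "v1 x t = dx 1 u x t + of_real (\<beta> * \<phi> x) * u 0 t" for x t
  define v1t where "v1t x t = dx 1 (dt u) x t + of_real (\<beta> * \<phi> x) * dt u 0 t" for x t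
  define v2 where "v2 x t = dx 2 u x t - of_real (\<beta>\<^sup>2 * \<phi> x) * u 0 t" for x t
  define v2t where "v2t x t = dx 2 (dt u) x t - of_real (\<beta>\<^sup>2 * \<phi> x) * dt u 0 t" for x t
  \<comment> \<open>The spatial operator i A0 + A1 D + i A2 D^2 applied to exp (- \<beta> x)
    multiplies it by \<open>c\<close>; so \<open>w\<close> is the source in the equation for
    \<open>v\<close>.\<close>
  define c where "c = \<i> * of_real A0 - of_real (A1 * \<beta>) + \<i> * of_real (A2 * \<beta>\<^sup>2)"
  define w where "w x t = c * of_real (\<phi> x) * u 0 t" for x t
  have derivs: "((\<lambda>x. v x t) has_vector_derivative v1 x t) (at x within {0..})"
    "((\<lambda>x. v1 x t) has_vector_derivative v2 x t) (at x within {0..})"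
    "((\<lambda>x. v1t x t) has_vector_derivative v2t x t) (at x within {0..})"
    "((\<lambda>t. v x t) has_vector_derivative vt x t) (at t within {0..})"
    "((\<lambda>t. v1 x t) has_vector_derivative v1t x t) (at t within {0..})"
    if x: "x \<ge> 0" and t: "t \<ge> 0" for x t
  proof -
    have u: "((\<lambda>x. u x t) has_vector_derivative dx 1 u x t) (at x within {0..})"
      "((\<lambda>x. dx 1 u x t) has_vector_derivative dx 2 u x t) (at x within {0..})"
      "((\<lambda>x. dx 1 (dt u) x t) has_vector_derivative dx 2 (dt u) x t) (at x within {0..})"
      using has_vector_derivative_dx[of 0 x t] has_vector_derivative_dx[of 1 x t]
        has_vector_derivative_dx_dt[of 1 x t] x t by (simp_all add: numeral_2_eq_2)
    show "((\<lambda>x. v x t) has_vector_derivative v1 x t) (at x within {0..})"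
      using has_vector_derivative_diff[OF u(1) \<phi>_deriv[of 1 "u 0 t" x]] by (simp add: v_def v1_def)
    show "((\<lambda>x. v1 x t) has_vector_derivative v2 x t) (at x within {0..})"
      using has_vector_derivative_add[OF u(2) \<phi>_deriv[of \<beta> "u 0 t" x]] by (simp add: v1_def v2_def power2_eq_square)
    show "((\<lambda>x. v1t x t) has_vector_derivative v2t x t) (at x within {0..})"
      using has_vector_derivative_add[OF u(3) \<phi>_deriv[of \<beta> "dt u 0 t" x]] by (simp add: v1t_def v2t_def power2_eq_square)
    show "((\<lambda>t. v x t) has_vector_derivative vt x t) (at t within {0..})"
      unfolding v_def vt_def
      by (intro has_vector_derivative_diff has_vector_derivative_mult_right has_vector_derivative_dt x t order_refl)
    show "((\<lambda>t. v1 x t) has_vector_derivative v1t x t) (at t within {0..})"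
      unfolding v1_def v1t_def
      by (intro has_vector_derivative_add has_vector_derivative_mult_right has_vector_derivative_dt
          has_vector_derivative_dt_dx_1 x t order_refl)
  qed
  have c0: "continuous_on ({0..} \<times> {0..}) (\<lambda>p. u 0 (snd p))"
    by (intro continuous_on_u_compose continuous_intros) auto
  have c0t: "continuous_on ({0..} \<times> {0..}) (\<lambda>p. dt u 0 (snd p))"
    by (intro continuous_on_dt_compose continuous_intros) auto
  note cont = continuous_on_dx continuous_on_dx[of 0, simplified] continuous_on_dx_dt
    continuous_on_dx_dt[of 0, simplified] c0 c0t
  have conts: "continuous_on ({0..} \<times> {0..}) (\<lambda>p. v (fst p) (snd p))"
     "continuous_on ({0..} \<times> {0..}) (\<lambda>p. v1 (fst p) (snd p))"
     "continuous_on ({0..} \<times> {0..}) (\<lambda>p. v2 (fst p) (snd p))"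
     "continuous_on ({0..} \<times> {0..}) (\<lambda>p. vt (fst p) (snd p))"
     "continuous_on ({0..} \<times> {0..}) (\<lambda>p. v1t (fst p) (snd p))"
     "continuous_on ({0..} \<times> {0..}) (\<lambda>p. v2t (fst p) (snd p))"
    unfolding v_def v1_def v2_def vt_def v1t_def v2t_def \<phi>_def
    by (intro continuous_intros cont; simp)+
  define e where "e x t = inner (v x t) (v x t) + Am * inner (v1 x t) (v1 x t)" for x t
  have e_ge: "(cmod (v x t))\<^sup>2 \<le> e x t" "Am * (cmod (v1 x t))\<^sup>2 \<le> e x t" for x t
    using Am by (simp_all add: e_def dot_square_norm)
  have cont_e: "continuous_on ({0..} \<times> {0..}) (\<lambda>p. e (fst p) (snd p))"
    unfolding e_def by (intro continuous_intros conts)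
  \<comment> \<open>The last term arises from moving one x-derivative in Am |v_x|^2 after
    differentiating in time. Every term contains the factor \<open>v\<close>, so the flux vanishes
    at x = 0.\<close>
  define F where "F x t = A1 * inner (v x t) (v x t) + 2 * A2 * inner (v x t) (\<i> * v1 x t) + 2 * Am * inner (v x t) (v1t x t)" for x t
  define Fx where "Fx x t = A1 * (inner (v x t) (v1 x t) + inner (v1 x t) (v x t))
     + 2 * A2 * (inner (v x t) (\<i> * v2 x t) + inner (v1 x t) (\<i> * v1 x t))
     + 2 * Am * (inner (v x t) (v2t x t) + inner (v1 x t) (v1t x t))" for x t
  define et where "et x t = (inner (v x t) (vt x t) + inner (vt x t) (v x t))
     + Am * (inner (v1 x t) (v1t x t) + inner (v1t x t) (v1 x t))" for x t
  have balance: "et x t = Fx x t + 2 * inner (v x t) (w x t)" if "x \<ge> 0" "t \<ge> 0" for x t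
  proof -
    have expand: "(inner V Vt + inner Vt V) + Am * (inner V1 V1t + inner V1t V1)
      = (A1 * (inner V V1 + inner V1 V) + 2 * A2 * (inner V (\<i> * V2) + inner V1 (\<i> * V1))
         + 2 * Am * (inner V V2t + inner V1 V1t)) + 2 * inner V z"
      if "Vt = of_real Am * V2t + \<i> * of_real A0 * V + of_real A1 * V1 + \<i> * of_real A2 * V2 + z"
      for V Vt V1 V1t V2 V2t z :: complex
      unfolding that by (simp add: inner_complex_def algebra_simps)
    have "of_real Am * (of_real (\<beta>\<^sup>2 * \<phi> x) * dt u 0 t) = of_real (Am * \<beta>\<^sup>2) * (of_real (\<phi> x) * dt u 0 t)" by simp
    then have z: "of_real Am * (of_real (\<beta>\<^sup>2 * \<phi> x) * dt u 0 t) = of_real (\<phi> x) * dt u 0 t" by (simp add: \<beta>)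
    have "vt x t - of_real Am * v2t x t = dt u x t - of_real Am * dx 2 (dt u) x t"
      unfolding vt_def v2t_def using z by (simp add: right_diff_distrib)
    also have "\<dots> = \<i> * of_real A0 * u x t + of_real A1 * dx 1 u x t + \<i> * of_real A2 * dx 2 u x t"
      using pde[OF that] Am by simp
    also have "\<dots> = \<i> * of_real A0 * v x t + of_real A1 * v1 x t + \<i> * of_real A2 * v2 x t + w x t"
      unfolding v_def v1_def v2_def w_def c_def by (simp add: algebra_simps)
    finally have "vt x t = of_real Am * v2t x t + \<i> * of_real A0 * v x t + of_real A1 * v1 x t
        + \<i> * of_real A2 * v2 x t + w x t" by (simp add: algebra_simps)
    from expand[OF this, of "v1t x t"] show ?thesis unfolding et_def Fx_def .
  qed
  have "\<exists>C. \<forall>T\<ge>0. \<forall>R\<ge>0. integral {0..R} (\<lambda>x. e x T) \<le> C * (1 + T)\<^sup>2"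
  \<comment> \<open>\<open>K\<close> and \<kappa> come from |w|^2 <= (|c| B)^2 exp (- 2 \<beta> x);
    \<open>Cb = 0\<close> because \<open>F\<close> vanishes at x = 0.\<close>
  proof (rule energy_growth[where K = "(cmod c * B)\<^sup>2" and \<kappa> = "2 * \<beta>" and Cb = 0 and et = et and F = F and Fx = Fx])
    fix x t :: real assume x: "x \<ge> 0"
    have "v1 x 0 = 0" using dx_1_eq_integral[OF x, of 0] initial_zero[of 0] by (simp add: v1_def)
    moreover have "v x 0 = 0" using initial_zero[OF x] initial_zero[of 0] by (simp add: v_def)
    ultimately show "e x 0 = 0" by (simp add: e_def)
    assume t: "t \<ge> 0"
    note d = derivs[OF x t]
    show "((\<lambda>t. e x t) has_vector_derivative et x t) (at t within {0..})"
      unfolding e_def et_def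
      by (intro has_vector_derivative_add has_vector_derivative_mult_right has_vector_derivative_inner d)
    show "((\<lambda>x. F x t) has_vector_derivative Fx x t) (at x within {0..})"
      unfolding F_def Fx_def
      by (intro has_vector_derivative_add has_vector_derivative_mult_right has_vector_derivative_inner d)
    show "e x t \<ge> 0" using Am by (simp add: e_def)
    fix \<delta> :: real assume \<delta>: "\<delta> > 0"
    have "2 * inner (v x t) (w x t) \<le> 2 * (cmod (v x t) * cmod (w x t))"
      using Cauchy_Schwarz_ineq2[of "v x t" "w x t"] by linarith
    also have "\<dots> \<le> \<delta> * (cmod (v x t))\<^sup>2 + (cmod (w x t))\<^sup>2 / \<delta>"
    proof -
      \<comment> \<open>Young's inequality with weight \<delta>, needed for every \<delta> > 0
        because the energy lemma chooses it depending on \<open>T\<close>.\<close>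
      have "0 \<le> (\<delta> * cmod (v x t) - cmod (w x t))\<^sup>2 / \<delta>" using \<delta> by simp
      also have "\<dots> = \<delta> * (cmod (v x t))\<^sup>2 + (cmod (w x t))\<^sup>2 / \<delta> - 2 * (cmod (v x t) * cmod (w x t))"
        using \<delta> by (simp add: power2_eq_square field_simps)
      finally show ?thesis by simp
    qed
    also have "\<dots> \<le> \<delta> * e x t + (cmod c * B)\<^sup>2 / \<delta> * exp (- (2 * \<beta>) * x)"
    proof (rule add_mono)
      show "\<delta> * (cmod (v x t))\<^sup>2 \<le> \<delta> * e x t" using \<delta> e_ge by (intro mult_left_mono) auto
      have "cmod (w x t) = cmod c * \<phi> x * cmod (u 0 t)" using \<phi>[of x] by (simp add: w_def norm_mult)
      also have "\<dots> \<le> cmod c * \<phi> x * B" using bdd[OF t] \<phi>[of x] by (intro mult_left_mono) auto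
      finally have "cmod (w x t) \<le> cmod c * B * \<phi> x" by (simp only: ac_simps)
      then have "(cmod (w x t))\<^sup>2 \<le> (cmod c * B * \<phi> x)\<^sup>2" by (intro power_mono) auto
      also have "\<dots> = (cmod c * B)\<^sup>2 * exp (- (2 * \<beta>) * x)"
        unfolding \<phi>_def power_mult_distrib by (simp flip: exp_double)
      finally show "(cmod (w x t))\<^sup>2 / \<delta> \<le> (cmod c * B)\<^sup>2 / \<delta> * exp (- (2 * \<beta>) * x)"
        using \<delta> by (simp add: divide_right_mono)
    qed
    finally show "et x t \<le> Fx x t + \<delta> * e x t + (cmod c * B)\<^sup>2 / \<delta> * exp (- (2 * \<beta>) * x)"
      using balance[OF x t] by simp
  next
    show "- F 0 t \<le> 0" for t by (simp add: F_def v_def \<phi>_def)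
    show "continuous_on ({0..} \<times> {0..}) (\<lambda>p. et (fst p) (snd p))"
      "continuous_on ({0..} \<times> {0..}) (\<lambda>p. Fx (fst p) (snd p))"
      unfolding et_def Fx_def by (intro continuous_intros conts)+
    show "0 \<le> (cmod c * B)\<^sup>2" "0 < 2 * \<beta>" "(0::real) \<le> 0" using \<beta> by simp_all
    fix T :: real
    obtain C where C: "C \<ge> 0" "\<And>x t. 0 \<le> x \<Longrightarrow> 0 \<le> t \<Longrightarrow> t \<le> T \<Longrightarrow> cmod (u x t) \<le> C / (1 + x)\<^sup>2"
      using decay_bound[OF continuous_decaying_dx[of 0], of T] by auto
    obtain C1 where C1: "C1 \<ge> 0" "\<And>x t. 0 \<le> x \<Longrightarrow> 0 \<le> t \<Longrightarrow> t \<le> T \<Longrightarrow> cmod (dx 1 u x t) \<le> C1"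
      using uniform_bound[OF continuous_decaying_dx[of 1], of T] by auto
    obtain C2 where C2: "C2 \<ge> 0" "\<And>x t. 0 \<le> x \<Longrightarrow> 0 \<le> t \<Longrightarrow> t \<le> T \<Longrightarrow> cmod (dx 1 (dt u) x t) \<le> C2"
      using uniform_bound[OF continuous_decaying_dx_dt[of 1], of T] by auto
    obtain C3 where C3: "C3 \<ge> 0" "\<And>x t. 0 \<le> x \<Longrightarrow> 0 \<le> t \<Longrightarrow> t \<le> T \<Longrightarrow> cmod (dt u x t) \<le> C3"
      using uniform_bound[OF continuous_decaying_dx_dt[of 0], of T] by auto
    \<comment> \<open>Turns exponential into algebraic decay: exp (\<beta> x) >= 1 + \<beta> x gives
      \<phi> x <= M / (1 + x). The constants here may depend on \<open>T\<close>, since only the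
      decay of the flux in x matters.\<close>
    define M where "M = max 1 (1 / \<beta>)"
    have M: "M \<ge> 1" by (simp add: M_def)
    define D where "D = (C + M * B) + (C1 + \<beta> * B) + (C2 + \<beta> * C3)"
    have nn: "C + M * B \<ge> 0" "C1 + \<beta> * B \<ge> 0" "C2 + \<beta> * C3 \<ge> 0"
      using C C1 C2 C3 B M \<beta> by (auto intro!: add_nonneg_nonneg mult_nonneg_nonneg)
    then have D: "D \<ge> 0" by (simp add: D_def)
    have \<phi>1: "\<phi> x \<le> 1" if "x \<ge> 0" for x using that \<beta> by (simp add: \<phi>_def)
    have \<phi>M: "\<phi> x \<le> M / (1 + x)" if "x \<ge> 0" for x
    proof -
      have "1 \<le> M * \<beta>"
      proof -
        have "1 / \<beta> * \<beta> \<le> M * \<beta>" using \<beta> by (intro mult_right_mono) (auto simp: M_def)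
        then show ?thesis using \<beta> by simp
      qed
      then have "1 * x \<le> M * \<beta> * x" using that by (intro mult_right_mono) auto
      then have "1 + x \<le> M * (1 + \<beta> * x)" using M by (simp add: algebra_simps)
      also have "\<dots> \<le> M * exp (\<beta> * x)" using M by (intro mult_left_mono exp_ge_add_one_self) auto
      finally show ?thesis using that by (simp add: \<phi>_def exp_minus field_simps)
    qed
    have vD: "cmod (v x t) \<le> D / (1 + x)" if "x \<ge> 0" "t \<in> {0..T}" for x t
    proof -
      have "cmod (v x t) \<le> cmod (u x t) + \<phi> x * cmod (u 0 t)"
        unfolding v_def using norm_triangle_ineq4[of "u x t" "of_real (1 * \<phi> x) * u 0 t"] \<phi>[of x]
        by (simp add: norm_mult)
      also have "cmod (u x t) \<le> C / (1 + x)"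
      proof -
        have "C / (1 + x)\<^sup>2 \<le> C / (1 + x)^1" using that C(1) by (intro divide_left_mono power_increasing) auto
        then show ?thesis using C(2)[of x t] that by simp
      qed
      also have "\<phi> x * cmod (u 0 t) \<le> M / (1 + x) * B" using that \<phi>M bdd[of t] \<phi>[of x] M by (intro mult_mono) auto
      also have "C / (1 + x) + M / (1 + x) * B = (C + M * B) / (1 + x)" by (simp add: add_divide_distrib)
      also have "\<dots> \<le> D / (1 + x)" using that nn by (intro divide_right_mono) (auto simp: D_def)
      finally show ?thesis by simp
    qed
    have v1D: "cmod (v1 x t) \<le> D" if "x \<ge> 0" "t \<in> {0..T}" for x t
    proof -
      have "cmod (v1 x t) \<le> cmod (dx 1 u x t) + \<beta> * \<phi> x * cmod (u 0 t)"
        unfolding v1_def using norm_triangle_ineq[of "dx 1 u x t" "of_real (\<beta> * \<phi> x) * u 0 t"] \<phi>[of x] \<beta>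
        by (simp add: norm_mult)
      also have "\<beta> * \<phi> x * cmod (u 0 t) \<le> \<beta> * 1 * B"
        using that \<phi>1 bdd[of t] \<phi>[of x] \<beta> by (intro mult_mono) auto
      finally show ?thesis using C1(2)[of x t] that nn unfolding D_def by simp
    qed
    have v1tD: "cmod (v1t x t) \<le> D" if "x \<ge> 0" "t \<in> {0..T}" for x t
    proof -
      have "cmod (v1t x t) \<le> cmod (dx 1 (dt u) x t) + \<beta> * \<phi> x * cmod (dt u 0 t)"
        unfolding v1t_def using norm_triangle_ineq[of "dx 1 (dt u) x t" "of_real (\<beta> * \<phi> x) * dt u 0 t"] \<phi>[of x] \<beta>
        by (simp add: norm_mult)
      also have "\<beta> * \<phi> x * cmod (dt u 0 t) \<le> \<beta> * 1 * C3"
        using that \<phi>1 C3(2)[of 0 t] \<phi>[of x] \<beta> by (intro mult_mono) auto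
      finally show ?thesis using C2(2)[of x t] that nn unfolding D_def by simp
    qed
    have "F x t \<le> (\<bar>A1\<bar> + 2 * \<bar>A2\<bar> + 2 * Am) * (D * D) / (1 + x)" if "x \<ge> 0" "t \<in> {0..T}" for x t
    proof -
      have "D / (1 + x) \<le> D / 1" using that D by (intro divide_left_mono) auto
      then have v: "cmod (v x t) \<le> D" using vD[OF that] by simp
      have i: "\<bar>inner (v x t) (v x t)\<bar> \<le> D / (1 + x) * D" "\<bar>inner (v x t) (\<i> * v1 x t)\<bar> \<le> D / (1 + x) * D"
        "\<bar>inner (v x t) (v1t x t)\<bar> \<le> D / (1 + x) * D"
        by (rule abs_inner_le_mult; use v vD v1D v1tD that in \<open>simp add: norm_mult\<close>)+
      have "F x t \<le> \<bar>A1 * inner (v x t) (v x t)\<bar> + \<bar>2 * A2 * inner (v x t) (\<i> * v1 x t)\<bar> + \<bar>2 * Am * inner (v x t) (v1t x t)\<bar>"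
        unfolding F_def by linarith
      also have "\<dots> = \<bar>A1\<bar> * \<bar>inner (v x t) (v x t)\<bar> + 2 * \<bar>A2\<bar> * \<bar>inner (v x t) (\<i> * v1 x t)\<bar> + 2 * Am * \<bar>inner (v x t) (v1t x t)\<bar>"
        using Am by (simp only: abs_mult) simp
      also have "\<dots> \<le> \<bar>A1\<bar> * (D / (1 + x) * D) + 2 * \<bar>A2\<bar> * (D / (1 + x) * D) + 2 * Am * (D / (1 + x) * D)"
        using Am by (intro add_mono mult_left_mono i) auto
      also have "\<dots> = (\<bar>A1\<bar> + 2 * \<bar>A2\<bar> + 2 * Am) * (D * D) / (1 + x)"
        by (simp add: distrib_right add_divide_distrib)
      finally show ?thesis .
    qed
    then show "\<exists>C. \<forall>x\<ge>0. \<forall>t\<in>{0..T}. F x t \<le> C / (1 + x)" by blast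
  qed (rule cont_e)
  then obtain C where C: "\<And>T R. T \<ge> 0 \<Longrightarrow> R \<ge> 0 \<Longrightarrow> integral {0..R} (\<lambda>x. e x T) \<le> C * (1 + T)\<^sup>2" by blast
  have C0: "C \<ge> 0" using C[of 0 0] by simp
  \<comment> \<open>Returns from \<open>v\<close> to u. The split part \<open>q\<close> is
    \<open>v\<close> (with a = 1, m = 1) or \<open>v1\<close> (with a = - \<beta>, m = 1 / Am), and
    the exponential part is square integrable with a bound independent of \<open>T\<close>.\<close>
  have transfer: "integral {0..R} (\<lambda>x. (cmod (dx j u x T))\<^sup>2) \<le> (2 * m * C + a\<^sup>2 * B\<^sup>2 / \<beta>) * (1 + T)\<^sup>2"
    if T: "T \<ge> 0" and R: "R \<ge> 0" and j: "j \<le> 3" and m: "m \<ge> 0"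
      and split: "\<And>x. x \<ge> 0 \<Longrightarrow> dx j u x T = q x + of_real (a * \<phi> x) * u 0 T"
      and q: "\<And>x. x \<ge> 0 \<Longrightarrow> (cmod (q x))\<^sup>2 \<le> m * e x T" for T R j m a q
  proof -
    have int_e: "(\<lambda>x. e x T) integrable_on {0..R}"
    proof (rule integrable_continuous_interval)
      have "continuous_on {0..R} (\<lambda>x. (x, T))" by (intro continuous_intros)
      then have "continuous_on {0..R} (\<lambda>x. e (fst (x, T)) (snd (x, T)))"
        by (rule continuous_on_compose2[OF cont_e]) (use T in auto)
      then show "continuous_on {0..R} (\<lambda>x. e x T)" by simp
    qed
    have int_k: "(\<lambda>x. exp (- (2 * \<beta>) * (x - 0))) integrable_on {0..R}"
      by (intro integrable_continuous_interval continuous_intros)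
    have "integral {0..R} (\<lambda>x. (cmod (dx j u x T))\<^sup>2)
       \<le> integral {0..R} (\<lambda>x. 2 * m * e x T + 2 * (a\<^sup>2 * B\<^sup>2) * exp (- (2 * \<beta>) * (x - 0)))"
    proof (rule integral_le)
      show "(\<lambda>x. (cmod (dx j u x T))\<^sup>2) integrable_on {0..R}"
        using T j by (intro integrable_continuous_interval continuous_intros continuous_on_dx_compose) auto
      show "(\<lambda>x. 2 * m * e x T + 2 * (a\<^sup>2 * B\<^sup>2) * exp (- (2 * \<beta>) * (x - 0))) integrable_on {0..R}"
        by (intro integrable_add integrable_on_mult_right int_e int_k)
      fix x assume "x \<in> {0..R}"
      then have x: "x \<ge> 0" by simp
      have "(cmod (of_real (a * \<phi> x) * u 0 T))\<^sup>2 = a\<^sup>2 * (cmod (u 0 T))\<^sup>2 * (\<phi> x)\<^sup>2"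
        by (simp add: norm_mult power_mult_distrib)
      also have "\<dots> \<le> a\<^sup>2 * B\<^sup>2 * (\<phi> x)\<^sup>2" using bdd[OF T] by (intro mult_right_mono mult_left_mono power_mono) auto
      also have "(\<phi> x)\<^sup>2 = exp (- (2 * \<beta>) * (x - 0))" unfolding \<phi>_def by (simp flip: exp_double)
      finally show "(cmod (dx j u x T))\<^sup>2 \<le> 2 * m * e x T + 2 * (a\<^sup>2 * B\<^sup>2) * exp (- (2 * \<beta>) * (x - 0))"
        unfolding split[OF x] using norm_add_squared_le[of "q x" "of_real (a * \<phi> x) * u 0 T"] q[OF x] by linarith
    qed
    also have "\<dots> = 2 * m * integral {0..R} (\<lambda>x. e x T) + 2 * (a\<^sup>2 * B\<^sup>2) * integral {0..R} (\<lambda>x. exp (- (2 * \<beta>) * (x - 0)))"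
      by (subst Henstock_Kurzweil_Integration.integral_add)
         (auto intro!: integrable_on_mult_right int_e int_k[simplified])
    also have "\<dots> \<le> 2 * m * (C * (1 + T)\<^sup>2) + 2 * (a\<^sup>2 * B\<^sup>2) * (1 / (2 * \<beta>))"
      using C[OF T R] integral_exp_decay_le[of "2 * \<beta>" 0 R] \<beta> R m by (intro add_mono mult_left_mono) auto
    also have "2 * (a\<^sup>2 * B\<^sup>2) * (1 / (2 * \<beta>)) \<le> a\<^sup>2 * B\<^sup>2 / \<beta> * (1 + T)\<^sup>2"
    proof -
      have "1 * 1 \<le> (1 + T) * (1 + T)" using T by (intro mult_mono) auto
      then have "a\<^sup>2 * B\<^sup>2 / \<beta> * 1 \<le> a\<^sup>2 * B\<^sup>2 / \<beta> * (1 + T)\<^sup>2" using \<beta>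
        by (intro mult_left_mono) (auto simp: power2_eq_square)
      then show ?thesis by simp
    qed
    finally show ?thesis by (simp add: algebra_simps)
  qed
  define C' where "C' = (2 * 1 * C + 1\<^sup>2 * B\<^sup>2 / \<beta>) + (2 * (1 / Am) * C + (- \<beta>)\<^sup>2 * B\<^sup>2 / \<beta>)"
  have nn: "2 * 1 * C + 1\<^sup>2 * B\<^sup>2 / \<beta> \<ge> 0" "2 * (1 / Am) * C + (- \<beta>)\<^sup>2 * B\<^sup>2 / \<beta> \<ge> 0"
    using C0 B \<beta> Am by auto
  have "integral {0..R} (\<lambda>x. (cmod (u x T))\<^sup>2) \<le> C' * (1 + T)\<^sup>2
    \<and> integral {0..R} (\<lambda>x. (cmod (dx 1 u x T))\<^sup>2) \<le> C' * (1 + T)\<^sup>2" if T: "T \<ge> 0" and R: "R \<ge> 0" for T R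
  proof
    have "integral {0..R} (\<lambda>x. (cmod (dx 0 u x T))\<^sup>2) \<le> (2 * 1 * C + 1\<^sup>2 * B\<^sup>2 / \<beta>) * (1 + T)\<^sup>2"
      by (rule transfer[where ?q2 = "\<lambda>x. v x T", OF T R]) (use e_ge in \<open>simp_all add: v_def\<close>)
    also have "\<dots> \<le> C' * (1 + T)\<^sup>2" using nn by (intro mult_right_mono) (auto simp: C'_def)
    finally show "integral {0..R} (\<lambda>x. (cmod (u x T))\<^sup>2) \<le> C' * (1 + T)\<^sup>2" by simp
    have "integral {0..R} (\<lambda>x. (cmod (dx 1 u x T))\<^sup>2) \<le> (2 * (1 / Am) * C + (- \<beta>)\<^sup>2 * B\<^sup>2 / \<beta>) * (1 + T)\<^sup>2"
    proof (rule transfer[where ?q2 = "\<lambda>x. v1 x T", OF T R])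
      show "(cmod (v1 x T))\<^sup>2 \<le> 1 / Am * e x T" for x
        using e_ge(2)[of x T] Am by (simp add: field_simps)
    qed (use Am in \<open>simp_all add: v1_def\<close>)
    also have "\<dots> \<le> C' * (1 + T)\<^sup>2" using nn by (intro mult_right_mono) (auto simp: C'_def)
    finally show "integral {0..R} (\<lambda>x. (cmod (dx 1 u x T))\<^sup>2) \<le> C' * (1 + T)\<^sup>2" .
  qed
  then show ?thesis by blast
qed

end

section \<open>Asymptotics of the wavemaker problem\<close>

lemma exp_decay_beats_quadratic:
  fixes \<sigma> a b c :: real
  assumes "\<sigma> > 0"
  shows "((\<lambda>T. exp (- \<sigma> * T) * (a + b * (1 + T)\<^sup>2) * c) \<longlongrightarrow> 0) at_top"
  using assms by real_asymp

context wavemaker begin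

text \<open>Separates the small modulus, which becomes the factor \<eta> of
  \<open>linear_ode_growing_L2_bound\<close>, from the phase, which is absorbed into the
  source.\<close>

lemma exp_polar: "exp (- s * of_real T) = of_real (exp (- Re s * T)) * exp (- \<i> * of_real (Im s * T))"
proof -
  have "- s * of_real T = of_real (- Re s * T) + - \<i> * of_real (Im s * T)"
    by (simp add: complex_eq_iff)
  then show ?thesis by (simp only: exp_add exp_of_real)
qed

lemma dx_bounded:
  assumes "j \<le> 3" "T \<ge> 0"
  obtains D where "\<And>y. y \<ge> 0 \<Longrightarrow> cmod (dx j u y T) \<le> D"
proof -
  obtain C where C: "C \<ge> 0" "\<And>x t. 0 \<le> x \<Longrightarrow> 0 \<le> t \<Longrightarrow> t \<le> T \<Longrightarrow> cmod (dx j u x t) \<le> C"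
    using uniform_bound[OF continuous_decaying_dx[OF assms(1)], of T] by blast
  show thesis by (rule that[of C]) (rule C(2)[OF _ assms(2) order_refl])
qed

text \<open>The third-order equation factors into first-order ones, solved outside in: the two
  growing factors are integrated from infinity, the decaying one from the boundary. Working with
  factors instead of a basis of exponentials avoids dividing by differences of roots, so k1 = k2 is
  allowed.\<close>

lemma lap_decaying_mode_cubic:
  assumes coeffs: "Am = 0" "A3 < 0" and s: "Re s > 0"
    and bdd: "\<And>j. j \<le> 2 \<Longrightarrow> \<exists>B. \<forall>t\<ge>0. cmod (dx j u 0 t) \<le> B"
  obtains k where "Im k > 0" "dispoly Am A0 A1 A2 A3 (\<i> * s) k = 0"
    "\<And>x. x \<ge> 0 \<Longrightarrow> ((\<lambda>T. lap s T 0 x - exp (\<i> * k * of_real x) * lap s T 0 0) \<longlongrightarrow> 0) at_top"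
proof -
  obtain k0 k1 k2 where k: "Im k0 > 0" "Im k1 < 0" "Im k2 < 0"
    and V: "of_real A2 = - of_real A3 * (k0 + k1 + k2)"
    "- of_real A1 = of_real A3 * (k0 * k1 + k0 * k2 + k1 * k2)"
    "- of_real A0 - \<i> * s = - of_real A3 * (k0 * k1 * k2)"
    using dispersion_roots_cubic[OF coeffs(2) s] by blast
  have A3: "of_real A3 \<noteq> (0::complex)" using coeffs by simp
  obtain C where C: "\<And>T R. T \<ge> 0 \<Longrightarrow> R \<ge> 0 \<Longrightarrow> integral {0..R} (\<lambda>x. (cmod (u x T))\<^sup>2) \<le> C * (1 + T)\<^sup>2"
    using L2_growth_cubic[OF coeffs(1) bdd] by blast
  have mu: "Re (\<i> * k1) > 0" "Re (\<i> * k2) > 0" "Re (\<i> * k0) \<le> 0" using k by simp_all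
  define Q where "Q T = exp (- Re s * T) * (1 / Re (\<i> * k1) + 1 / A3\<^sup>2 * (C * (1 + T)\<^sup>2))" for T
  have bound: "cmod (lap s T 0 x - exp (\<i> * k0 * of_real x) * lap s T 0 0) \<le> Q T / Re (\<i> * k2) * x"
    if T: "T \<ge> 0" and x: "x \<ge> 0" for T x
  proof -
    let ?L = "lap s T"
    \<comment> \<open>With D the x-derivative, \<open>f2\<close> is (D - i k0) applied to the
      transform and \<open>f1\<close> is (D - i k2) applied to \<open>f2\<close>. By Vieta's
      relations (D - i k1) applied to \<open>f1\<close> is the remainder from the upper limit
      \<open>T\<close>.\<close>
    define f1 where "f1 y = ?L 2 y - \<i> * (k0 + k2) * ?L 1 y - k0 * k2 * ?L 0 y" for y
    define f2 where "f2 y = ?L 1 y - \<i> * k0 * ?L 0 y" for y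
    define r where "r y = exp (- \<i> * of_real (Im s * T)) / of_real A3 * u y T" for y
    have d: "(?L 0 has_vector_derivative ?L 1 y) (at y within {0..})"
      "(?L 1 has_vector_derivative ?L 2 y) (at y within {0..})"
      "(?L 2 has_vector_derivative ?L 3 y) (at y within {0..})" if "y \<ge> 0" for y
      using has_vector_derivative_lap[of 0 y s T] has_vector_derivative_lap[of 1 y s T]
        has_vector_derivative_lap[of 2 y s T] that by (simp_all add: numeral_2_eq_2 numeral_3_eq_3)
    have contL: "continuous_on {0..} (?L j)" if "j < 3" for j by (rule continuous_on_lap[OF that])
    have cont1: "continuous_on {0..} f1" and cont2: "continuous_on {0..} f2"
      unfolding f1_def f2_def by (intro continuous_intros contL; simp)+
    have contr: "continuous_on {0..} r"
      unfolding r_def using T by (intro continuous_intros continuous_on_u_compose) auto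
    obtain B0 where B0: "\<And>y. y \<ge> 0 \<Longrightarrow> cmod (?L 0 y) \<le> B0" using lap_bounded[of 0 s T] s T by auto
    obtain B1 where B1: "\<And>y. y \<ge> 0 \<Longrightarrow> cmod (?L 1 y) \<le> B1" using lap_bounded[of 1 s T] s T by auto
    obtain B2 where B2: "\<And>y. y \<ge> 0 \<Longrightarrow> cmod (?L 2 y) \<le> B2" using lap_bounded[of 2 s T] s T by auto
    have bd1: "cmod (f1 y) \<le> B2 + cmod (k0 + k2) * B1 + cmod (k0 * k2) * B0" if "y \<ge> 0" for y
    proof -
      have "cmod (f1 y) \<le> cmod (?L 2 y) + cmod (\<i> * (k0 + k2) * ?L 1 y) + cmod (k0 * k2 * ?L 0 y)"
        unfolding f1_def by (rule order_trans[OF norm_triangle_ineq4 add_right_mono[OF norm_triangle_ineq4]])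
      also have "\<dots> = cmod (?L 2 y) + cmod (k0 + k2) * cmod (?L 1 y) + cmod (k0 * k2) * cmod (?L 0 y)"
        by (simp add: norm_mult)
      also have "\<dots> \<le> B2 + cmod (k0 + k2) * B1 + cmod (k0 * k2) * B0"
        using B0[OF that] B1[OF that] B2[OF that] by (intro add_mono mult_left_mono) auto
      finally show ?thesis .
    qed
    have bd2: "cmod (f2 y) \<le> B1 + cmod k0 * B0" if "y \<ge> 0" for y
    proof -
      have "cmod (f2 y) \<le> cmod (?L 1 y) + cmod (\<i> * k0 * ?L 0 y)" unfolding f2_def by (rule norm_triangle_ineq4)
      also have "\<dots> = cmod (?L 1 y) + cmod k0 * cmod (?L 0 y)" by (simp add: norm_mult)
      also have "\<dots> \<le> B1 + cmod k0 * B0" using B0[OF that] B1[OF that] by (intro add_mono mult_left_mono) auto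
      finally show ?thesis .
    qed
    have ode1: "(f1 has_vector_derivative \<i> * k1 * f1 y + of_real (exp (- Re s * T)) * r y) (at y within {0..})"
      if y: "y \<ge> 0" for y
    proof -
      have "(f1 has_vector_derivative ?L 3 y - \<i> * (k0 + k2) * ?L 2 y - k0 * k2 * ?L 1 y) (at y within {0..})"
        unfolding f1_def by (intro has_vector_derivative_diff has_vector_derivative_mult_right d y)
      moreover have "?L 3 y - \<i> * (k0 + k2) * ?L 2 y - k0 * k2 * ?L 1 y = \<i> * k1 * f1 y + of_real (exp (- Re s * T)) * r y"
      proof -
        have "exp (- s * of_real T) * u y T + s * ?L 0 y = \<i> * of_real A0 * ?L 0 y + of_real A1 * ?L 1 y
           + \<i> * of_real A2 * ?L 2 y + of_real A3 * ?L 3 y"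
          using lap_ode[OF T y, of s] coeffs(1) by simp
        then have "exp (- s * of_real T) * u y T = \<i> * of_real A0 * ?L 0 y + of_real A1 * ?L 1 y
           + \<i> * of_real A2 * ?L 2 y + of_real A3 * ?L 3 y - s * ?L 0 y"
          by (simp only: eq_diff_eq)
        also have "\<dots> = - \<i> * (- of_real A0 - \<i> * s) * ?L 0 y - (- of_real A1) * ?L 1 y
           + \<i> * of_real A2 * ?L 2 y + of_real A3 * ?L 3 y"
          by (simp add: algebra_simps)
        also have "\<dots> = of_real A3 * (\<i> * (k0 * k1 * k2) * ?L 0 y
           - (k0 * k1 + k0 * k2 + k1 * k2) * ?L 1 y - \<i> * (k0 + k1 + k2) * ?L 2 y + ?L 3 y)"
          unfolding V by (simp add: algebra_simps)
        finally have "exp (- s * of_real T) * u y T / of_real A3 = \<i> * (k0 * k1 * k2) * ?L 0 y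
           - (k0 * k1 + k0 * k2 + k1 * k2) * ?L 1 y - \<i> * (k0 + k1 + k2) * ?L 2 y + ?L 3 y"
          using A3 by simp
        moreover have "exp (- s * of_real T) * u y T / of_real A3 = of_real (exp (- Re s * T)) * r y"
          unfolding r_def exp_polar[of s T] by simp
        ultimately show ?thesis unfolding f1_def by (simp add: algebra_simps)
      qed
      ultimately show ?thesis by simp
    qed
    have ode2: "(f2 has_vector_derivative \<i> * k2 * f2 y + f1 y) (at y within {0..})" if y: "y \<ge> 0" for y
    proof -
      have "(f2 has_vector_derivative ?L 2 y - \<i> * k0 * ?L 1 y) (at y within {0..})"
        unfolding f2_def by (intro has_vector_derivative_diff has_vector_derivative_mult_right d y)
      moreover have "?L 2 y - \<i> * k0 * ?L 1 y = \<i> * k2 * f2 y + f1 y"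
        unfolding f1_def f2_def by (simp add: algebra_simps)
      ultimately show ?thesis by simp
    qed
    have ode0: "(?L 0 has_vector_derivative \<i> * k0 * ?L 0 y + f2 y) (at y within {0..})" if y: "y \<ge> 0" for y
      using d(1)[OF y] unfolding f2_def by simp
    have rM: "integral {0..R} (\<lambda>y. (cmod (r y))\<^sup>2) \<le> 1 / A3\<^sup>2 * (C * (1 + T)\<^sup>2)" if "R \<ge> 0" for R
    proof -
      have "(cmod (r y))\<^sup>2 = 1 / A3\<^sup>2 * (cmod (u y T))\<^sup>2" for y
        by (simp add: r_def norm_mult norm_divide power_mult_distrib power_divide)
      then have "integral {0..R} (\<lambda>y. (cmod (r y))\<^sup>2) = 1 / A3\<^sup>2 * integral {0..R} (\<lambda>y. (cmod (u y T))\<^sup>2)"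
        by (simp only: integral_mult_right)
      also have "\<dots> \<le> 1 / A3\<^sup>2 * (C * (1 + T)\<^sup>2)" using C[OF T that] by (intro mult_left_mono) auto
      finally show ?thesis .
    qed
    have f1Q: "cmod (f1 y) \<le> Q T" if "y \<ge> 0" for y
      unfolding Q_def
      by (rule linear_ode_growing_L2_bound[OF ode1 contr mu(1) bd1 that exp_ge_zero rM])
    have f2Q: "cmod (f2 y) \<le> Q T / Re (\<i> * k2)" if "y \<ge> 0" for y
      by (rule linear_ode_growing_sup_bound[OF ode2 cont1 mu(2) bd2 that f1Q])
    show ?thesis
      by (rule linear_ode_decaying_bound[OF ode0 cont2 mu(3) x f2Q])
  qed
  have root: "dispoly Am A0 A1 A2 A3 (\<i> * s) k0 = 0"
  proof -
    have "dispoly Am A0 A1 A2 A3 (\<i> * s) k0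
      = of_real A3 * k0^3 + of_real A2 * k0^2 + - of_real A1 * k0 + (- of_real A0 - \<i> * s)"
      unfolding dispoly_def using coeffs by simp
    also have "\<dots> = 0" unfolding V by (simp add: power2_eq_square power3_eq_cube algebra_simps)
    finally show ?thesis .
  qed
  show thesis
  proof (rule that[OF k(1) root])
    fix x :: real assume x: "x \<ge> 0"
    have "((\<lambda>T. Q T / Re (\<i> * k2) * x) \<longlongrightarrow> 0) at_top"
    proof -
      have "Q T / Re (\<i> * k2) * x = exp (- Re s * T) * (1 / Re (\<i> * k1) + (1 / A3\<^sup>2 * C) * (1 + T)\<^sup>2) * (x / Re (\<i> * k2))" for T
        unfolding Q_def by simp
      then show ?thesis using exp_decay_beats_quadratic[OF s] by (simp only:)
    qed
    moreover have "\<forall>\<^sub>F T in at_top. cmod (lap s T 0 x - exp (\<i> * k0 * of_real x) * lap s T 0 0) \<le> Q T / Re (\<i> * k2) * x"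
      using eventually_ge_at_top[of 0] by eventually_elim (rule bound[OF _ x])
    ultimately show "((\<lambda>T. lap s T 0 x - exp (\<i> * k0 * of_real x) * lap s T 0 0) \<longlongrightarrow> 0) at_top"
      by (rule Lim_null_comparison[rotated])
  qed
qed

text \<open>
  In the proof, \<open>\<kappa>\<close> is chosen so that the term $u_{xx}(\cdot,T)$, which the energy does not
  control, cancels in the equation for \<open>z\<close>.
\<close>

lemma lap_decaying_mode_mixed:
  assumes coeffs: "Am > 0" "A3 = 0" and s: "Re s > 0"
    and bdd: "\<exists>B. \<forall>t\<ge>0. cmod (u 0 t) \<le> B"
  obtains k where "Im k > 0" "dispoly Am A0 A1 A2 A3 (\<i> * s) k = 0"
    "\<And>x. x \<ge> 0 \<Longrightarrow> \<exists>B. \<forall>t\<ge>0. cmod (u x t) \<le> B \<Longrightarrow>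
      ((\<lambda>T. lap s T 0 x - exp (\<i> * k * of_real x) * lap s T 0 0) \<longlongrightarrow> 0) at_top"
proof -
  obtain k0 k1 c where k: "Im k0 > 0" "Im k1 < 0" and c: "c \<noteq> 0" "c = of_real A2 - \<i> * s * of_real Am"
    and V: "of_real A1 = c * (k0 + k1)" "- of_real A0 - \<i> * s = c * (k0 * k1)"
    using dispersion_roots_mixed[OF coeffs s] by metis
  obtain B where B: "\<And>t. t \<ge> 0 \<Longrightarrow> cmod (u 0 t) \<le> B" using bdd by blast
  obtain C where C: "\<And>T R. T \<ge> 0 \<Longrightarrow> R \<ge> 0 \<Longrightarrow> integral {0..R} (\<lambda>x. (cmod (u x T))\<^sup>2) \<le> C * (1 + T)\<^sup>2"
    "\<And>T R. T \<ge> 0 \<Longrightarrow> R \<ge> 0 \<Longrightarrow> integral {0..R} (\<lambda>x. (cmod (dx 1 u x T))\<^sup>2) \<le> C * (1 + T)\<^sup>2"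
    using H1_growth_mixed[OF coeffs B] by blast
  have mu: "Re (\<i> * k1) > 0" "Re (\<i> * k0) \<le> 0" using k by simp_all
  define \<kappa> where "\<kappa> = of_real Am / (\<i> * c)"
  \<comment> \<open>After the cancellation of u_xx, \<alpha> and \<beta> are the coefficients of u
    and u_x in the source. \<open>H1_growth_mixed\<close> controls precisely these two in mean
    square.\<close>
  define \<alpha> where "\<alpha> = 1 / (\<i> * c) - \<kappa> * (k0 * k1)"
  define \<beta> where "\<beta> = - (\<i> * \<kappa> * (k0 + k1))"
  define W where "W = 2 * (cmod \<alpha>)\<^sup>2 + 2 * (cmod \<beta>)\<^sup>2"
  define Q where "Q T = exp (- Re s * T) * (1 / Re (\<i> * k1) + W * (C * (1 + T)\<^sup>2))" for T
  define E where "E T = exp (- s * of_real T)" for T :: real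
  define z where "z T y = lap s T 0 y + \<kappa> * E T * u y T" for T y
  have bound: "cmod (z T x - exp (\<i> * k0 * of_real x) * z T 0) \<le> Q T * x"
    if T: "T \<ge> 0" and x: "x \<ge> 0" for T x
  proof -
    let ?L = "lap s T"
    \<comment> \<open>This is (D - i k0) applied to \<open>z\<close>, with D the x-derivative; the
      remaining factor D - i k1 is the growing one.\<close>
    define f where "f y = ?L 1 y + \<kappa> * E T * dx 1 u y T - \<i> * k0 * z T y" for y
    define r where "r y = exp (- \<i> * of_real (Im s * T)) * (\<alpha> * u y T + \<beta> * dx 1 u y T)" for y
    have d: "(?L 0 has_vector_derivative ?L 1 y) (at y within {0..})"
      "(?L 1 has_vector_derivative ?L 2 y) (at y within {0..})"
      "((\<lambda>y. u y T) has_vector_derivative dx 1 u y T) (at y within {0..})"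
      "((\<lambda>y. dx 1 u y T) has_vector_derivative dx 2 u y T) (at y within {0..})" if "y \<ge> 0" for y
      using has_vector_derivative_lap[of 0 y s T] has_vector_derivative_lap[of 1 y s T]
        has_vector_derivative_dx[of 0 y T] has_vector_derivative_dx[of 1 y T]
        that T by (simp_all add: numeral_2_eq_2)
    have dz: "(z T has_vector_derivative ?L 1 y + \<kappa> * E T * dx 1 u y T) (at y within {0..})" if "y \<ge> 0" for y
      unfolding z_def by (intro has_vector_derivative_add has_vector_derivative_mult_right d that)
    have contL: "continuous_on {0..} (?L j)" if "j < 3" for j by (rule continuous_on_lap[OF that])
    have contu: "continuous_on {0..} (\<lambda>y. dx j u y T)" if "j \<le> 3" for j
      using T that by (intro continuous_on_dx_compose continuous_intros) auto
    note cont = contL contu contu[of 0, simplified]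
    have contf: "continuous_on {0..} f"
      unfolding f_def z_def by (intro continuous_intros cont; simp)
    have contr: "continuous_on {0..} r"
      unfolding r_def by (intro continuous_intros cont; simp)
    obtain B0 where B0: "\<And>y. y \<ge> 0 \<Longrightarrow> cmod (?L 0 y) \<le> B0" using lap_bounded[of 0 s T] s T by auto
    obtain B1 where B1: "\<And>y. y \<ge> 0 \<Longrightarrow> cmod (?L 1 y) \<le> B1" using lap_bounded[of 1 s T] s T by auto
    obtain D0 where D0: "\<And>y. y \<ge> 0 \<Longrightarrow> cmod (u y T) \<le> D0" using dx_bounded[of 0 T] T by auto
    obtain D1 where D1: "\<And>y. y \<ge> 0 \<Longrightarrow> cmod (dx 1 u y T) \<le> D1" using dx_bounded[of 1 T] T by auto
    have bd: "cmod (f y) \<le> B1 + cmod (\<kappa> * E T) * D1 + cmod k0 * (B0 + cmod (\<kappa> * E T) * D0)" if "y \<ge> 0" for y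
    proof -
      have "cmod (z T y) \<le> cmod (?L 0 y) + cmod (\<kappa> * E T) * cmod (u y T)"
        unfolding z_def using norm_triangle_ineq[of "?L 0 y" "\<kappa> * E T * u y T"] by (simp add: norm_mult)
      also have "\<dots> \<le> B0 + cmod (\<kappa> * E T) * D0"
        using B0[OF that] D0[OF that] by (intro add_mono mult_left_mono) auto
      finally have zb: "cmod (z T y) \<le> B0 + cmod (\<kappa> * E T) * D0" .
      have "cmod (f y) \<le> cmod (?L 1 y) + cmod (\<kappa> * E T * dx 1 u y T) + cmod (\<i> * k0 * z T y)"
        unfolding f_def by (rule order_trans[OF norm_triangle_ineq4 add_right_mono[OF norm_triangle_ineq]])
      also have "\<dots> = cmod (?L 1 y) + cmod (\<kappa> * E T) * cmod (dx 1 u y T) + cmod k0 * cmod (z T y)"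
        by (simp add: norm_mult)
      also have "\<dots> \<le> B1 + cmod (\<kappa> * E T) * D1 + cmod k0 * (B0 + cmod (\<kappa> * E T) * D0)"
        using B1[OF that] D1[OF that] zb by (intro add_mono mult_left_mono) auto
      finally show ?thesis .
    qed
    have ode1: "(f has_vector_derivative \<i> * k1 * f y + of_real (exp (- Re s * T)) * r y) (at y within {0..})"
      if y: "y \<ge> 0" for y
    proof -
      have "(f has_vector_derivative ?L 2 y + \<kappa> * E T * dx 2 u y T
         - \<i> * k0 * (?L 1 y + \<kappa> * E T * dx 1 u y T)) (at y within {0..})"
        unfolding f_def
        by (intro has_vector_derivative_diff has_vector_derivative_add has_vector_derivative_mult_right d dz y)
      moreover have "?L 2 y + \<kappa> * E T * dx 2 u y T - \<i> * k0 * (?L 1 y + \<kappa> * E T * dx 1 u y T)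
         = \<i> * k1 * f y + E T * (\<alpha> * u y T + \<beta> * dx 1 u y T)"
      proof -
        have "E T * (u y T - of_real Am * dx 2 u y T)
          = - \<i> * (- of_real A0 - \<i> * s) * ?L 0 y + of_real A1 * ?L 1 y
           + \<i> * (of_real A2 - \<i> * s * of_real Am) * ?L 2 y"
          using lap_ode[OF T y, of s] coeffs unfolding E_def by (simp add: algebra_simps)
        also have "\<dots> = (\<i> * c) * (?L 2 y - \<i> * (k0 + k1) * ?L 1 y - k0 * k1 * ?L 0 y)"
          unfolding V c(2)[symmetric] by (simp add: algebra_simps)
        finally have e1: "E T * (u y T - of_real Am * dx 2 u y T) / (\<i> * c)
          = ?L 2 y - \<i> * (k0 + k1) * ?L 1 y - k0 * k1 * ?L 0 y"
          using c(1) by simp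
        have e2: "E T * (u y T - of_real Am * dx 2 u y T) / (\<i> * c)
          = E T * (1 / (\<i> * c) * u y T - \<kappa> * dx 2 u y T)"
          unfolding \<kappa>_def by (simp add: right_diff_distrib diff_divide_distrib)
        have move: "L = Y + a + b" if "Y = L - a - b" for L Y a b :: complex
          using that by simp
        have L2: "?L 2 y = E T * (1 / (\<i> * c) * u y T - \<kappa> * dx 2 u y T)
          + \<i> * (k0 + k1) * ?L 1 y + k0 * k1 * ?L 0 y"
          by (rule move[OF trans[OF e2[symmetric] e1]])
        define h where "h = 1 / (\<i> * c)"
        show ?thesis unfolding L2 f_def z_def \<alpha>_def \<beta>_def h_def[symmetric]
          by (simp add: algebra_simps)
      qed
      moreover have "E T * (\<alpha> * u y T + \<beta> * dx 1 u y T) = of_real (exp (- Re s * T)) * r y"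
        unfolding E_def r_def exp_polar[of s T] by (simp only: mult.assoc)
      ultimately show ?thesis by simp
    qed
    have ode0: "(z T has_vector_derivative \<i> * k0 * z T y + f y) (at y within {0..})" if y: "y \<ge> 0" for y
      using dz[OF y] unfolding f_def by simp
    have rM: "integral {0..R} (\<lambda>y. (cmod (r y))\<^sup>2) \<le> W * (C * (1 + T)\<^sup>2)" if R: "R \<ge> 0" for R
    proof -
      have int: "(\<lambda>y. (cmod (dx j u y T))\<^sup>2) integrable_on {0..R}" if "j \<le> 3" for j
        by (intro integrable_continuous_interval continuous_intros continuous_on_subset[OF contu[OF that]]) auto
      note int0 = int[of 0, simplified]
      have "integral {0..R} (\<lambda>y. (cmod (r y))\<^sup>2)
        \<le> integral {0..R} (\<lambda>y. 2 * (cmod \<alpha>)\<^sup>2 * (cmod (u y T))\<^sup>2 + 2 * (cmod \<beta>)\<^sup>2 * (cmod (dx 1 u y T))\<^sup>2)"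
      proof (rule integral_le)
        show "(\<lambda>y. (cmod (r y))\<^sup>2) integrable_on {0..R}"
          by (intro integrable_continuous_interval continuous_intros continuous_on_subset[OF contr]) auto
        show "(\<lambda>y. 2 * (cmod \<alpha>)\<^sup>2 * (cmod (u y T))\<^sup>2 + 2 * (cmod \<beta>)\<^sup>2 * (cmod (dx 1 u y T))\<^sup>2) integrable_on {0..R}"
          by (intro integrable_add integrable_on_mult_right int0 int) simp
        fix y
        have "cmod (r y) = cmod (\<alpha> * u y T + \<beta> * dx 1 u y T)" by (simp add: r_def norm_mult)
        then show "(cmod (r y))\<^sup>2 \<le> 2 * (cmod \<alpha>)\<^sup>2 * (cmod (u y T))\<^sup>2 + 2 * (cmod \<beta>)\<^sup>2 * (cmod (dx 1 u y T))\<^sup>2"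
          using norm_add_squared_le[of "\<alpha> * u y T" "\<beta> * dx 1 u y T"]
          by (simp add: norm_mult power_mult_distrib)
      qed
      also have "\<dots> = 2 * (cmod \<alpha>)\<^sup>2 * integral {0..R} (\<lambda>y. (cmod (u y T))\<^sup>2)
        + 2 * (cmod \<beta>)\<^sup>2 * integral {0..R} (\<lambda>y. (cmod (dx 1 u y T))\<^sup>2)"
        unfolding integral_mult_right[symmetric]
        by (rule Henstock_Kurzweil_Integration.integral_add[OF integrable_on_mult_right[OF int0] integrable_on_mult_right[OF int]]) simp
      also have "\<dots> \<le> 2 * (cmod \<alpha>)\<^sup>2 * (C * (1 + T)\<^sup>2) + 2 * (cmod \<beta>)\<^sup>2 * (C * (1 + T)\<^sup>2)"
        using C[OF T R] by (intro add_mono mult_left_mono) auto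
      finally show ?thesis by (simp add: W_def distrib_right)
    qed
    have fQ: "cmod (f y) \<le> Q T" if "y \<ge> 0" for y
      unfolding Q_def
      by (rule linear_ode_growing_L2_bound[OF ode1 contr mu(1) bd that exp_ge_zero rM])
    show ?thesis
      by (rule linear_ode_decaying_bound[OF ode0 contf mu(2) x fQ])
  qed
  have root: "dispoly Am A0 A1 A2 A3 (\<i> * s) k0 = 0"
  proof -
    have "dispoly Am A0 A1 A2 A3 (\<i> * s) k0
      = (of_real A2 - \<i> * s * of_real Am) * k0^2 - of_real A1 * k0 + (- of_real A0 - \<i> * s)"
      unfolding dispoly_def using coeffs by simp
    also have "\<dots> = 0" unfolding V c(2)[symmetric] by (simp add: power2_eq_square algebra_simps)
    finally show ?thesis .
  qed
  show thesis
  proof (rule that[OF k(1) root])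
    fix x :: real assume x: "x \<ge> 0" and "\<exists>B. \<forall>t\<ge>0. cmod (u x t) \<le> B"
    then obtain Bx where Bx: "\<And>t. t \<ge> 0 \<Longrightarrow> cmod (u x t) \<le> Bx" by blast
    let ?e = "exp (\<i> * k0 * of_real x)"
    define P where "P T = Q T * x + cmod \<kappa> * exp (- Re s * T) * (Bx + cmod ?e * B)" for T
    have "(P \<longlongrightarrow> 0) at_top"
    proof -
      have "P T = exp (- Re s * T) * (1 / Re (\<i> * k1) + (W * C) * (1 + T)\<^sup>2) * x
        + exp (- Re s * T) * (cmod \<kappa> * (Bx + cmod ?e * B) + 0 * (1 + T)\<^sup>2) * 1" for T
        unfolding P_def Q_def by simp
      then have "P = (\<lambda>T. exp (- Re s * T) * (1 / Re (\<i> * k1) + (W * C) * (1 + T)\<^sup>2) * x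
        + exp (- Re s * T) * (cmod \<kappa> * (Bx + cmod ?e * B) + 0 * (1 + T)\<^sup>2) * 1)" by (rule ext)
      then show ?thesis
        using tendsto_add[OF exp_decay_beats_quadratic[OF s] exp_decay_beats_quadratic[OF s]] by (simp only: add_0_right)
    qed
    moreover have "\<forall>\<^sub>F T in at_top. cmod (lap s T 0 x - ?e * lap s T 0 0) \<le> P T"
      using eventually_ge_at_top[of 0]
    proof eventually_elim
      case (elim T)
      \<comment> \<open>Going back from \<open>z\<close> to the transform costs a multiple of
        \<open>E T\<close> times values of u at x and at 0. These are bounded in time by hypothesis,
        while \<open>E T\<close> decays.\<close>
      have eq: "lap s T 0 x - ?e * lap s T 0 0 = (z T x - ?e * z T 0) - \<kappa> * E T * (u x T - ?e * u 0 T)"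
        unfolding z_def by (simp add: algebra_simps)
      have "cmod (\<kappa> * E T * (u x T - ?e * u 0 T)) = cmod \<kappa> * exp (- Re s * T) * cmod (u x T - ?e * u 0 T)"
        by (simp add: norm_mult E_def norm_exp_eq_Re)
      also have "\<dots> \<le> cmod \<kappa> * exp (- Re s * T) * (Bx + cmod ?e * B)"
      proof (rule mult_left_mono)
        have "cmod (u x T - ?e * u 0 T) \<le> cmod (u x T) + cmod ?e * cmod (u 0 T)"
          using norm_triangle_ineq4[of "u x T" "?e * u 0 T"] by (simp only: norm_mult)
        also have "\<dots> \<le> Bx + cmod ?e * B" using Bx[OF elim] B[OF elim] by (intro add_mono mult_left_mono) auto
        finally show "cmod (u x T - ?e * u 0 T) \<le> Bx + cmod ?e * B" .
      qed simp
      finally have 2: "cmod (\<kappa> * E T * (u x T - ?e * u 0 T)) \<le> cmod \<kappa> * exp (- Re s * T) * (Bx + cmod ?e * B)" .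
      show ?case unfolding eq P_def
        by (rule order_trans[OF norm_triangle_ineq4 add_mono[OF bound[OF elim x] 2]])
    qed
    ultimately show "((\<lambda>T. lap s T 0 x - ?e * lap s T 0 0) \<longlongrightarrow> 0) at_top"
      by (rule Lim_null_comparison[rotated])
  qed
qed

end

text \<open>For each \<open>eps j\<close> the transforms at x and at 0 are related, as
  \<open>T\<close> tends to infinity, by the factor exp (i K j x). Multiplied by
  \<open>eps j\<close> they are Abelian means, which tend to the Fourier coefficients, while
  \<open>K j\<close> tends to \<open>k0\<close>; uniqueness of the iterated limit gives the
  claim.\<close>

lemma (in wavemaker) wavemaker_mode:
  fixes n :: int
  assumes coeffs: "admissible_coeffs Am A3" and freq: "admissible_freq Am A2 \<omega>0"
    and k0: "boundary_root Am A0 A1 A2 A3 \<omega>0 n k0"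
    and g0: "fourier_asymp \<omega>0 g0 a" and bv: "\<And>j. fourier_asymp \<omega>0 (\<lambda>t. dx j u 0 t) (b j)"
    and x: "x \<ge> 0" and ux: "fourier_asymp \<omega>0 (\<lambda>t. u x t) c"
  shows "(\<Sum>\<^sub>\<infinity>m\<in>{m. of_int m * \<omega>0 = of_int n * \<omega>0}. c m)
    = exp (\<i> * k0 * of_real x) * (\<Sum>\<^sub>\<infinity>m\<in>{m. of_int m * \<omega>0 = of_int n * \<omega>0}. a m)"
proof -
  have AA: "Am \<ge> 0" "Am * A3 = 0" using coeffs by (auto simp: admissible_coeffs_def)
  define eps where "eps j = inverse (real (Suc j))" for j
  have eps: "eps j > 0" for j by (simp add: eps_def)
  have eps0: "eps \<longlonglongrightarrow> 0" unfolding eps_def by (rule LIMSEQ_inverse_real_of_nat)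
  define s where "s j = of_real (eps j) + \<i> * of_real (of_int n * \<omega>0)" for j
  have s: "Re (s j) > 0" for j using eps[of j] by (simp add: s_def)
  have cont_dx: "continuous_on {0..} (\<lambda>t. dx j u y t)" if "j \<le> 3" "y \<ge> 0" for j y
    using that by (intro continuous_on_dx_compose continuous_intros) auto
  have cont_u: "continuous_on {0..} (\<lambda>t. u y t)" if "y \<ge> 0" for y
    using cont_dx[of 0 y] that by simp
  have bdd: "\<exists>B. \<forall>t\<ge>0. cmod (dx j u 0 t) \<le> B" if "j \<le> 2" for j
  proof -
    have "continuous_on {0..} (\<lambda>t. dx j u 0 t)" using that by (intro cont_dx) auto
    from fourier_asymp_bounded[OF this bv] show ?thesis by blast
  qed
  have bdd0: "\<exists>B. \<forall>t\<ge>0. cmod (u 0 t) \<le> B" using bdd[of 0] by simp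
  have bddx: "\<exists>B. \<forall>t\<ge>0. cmod (u x t) \<le> B"
    using fourier_asymp_bounded[OF cont_u[OF x] ux] by blast
  have "\<forall>j. \<exists>k. Im k > 0 \<and> dispoly Am A0 A1 A2 A3 (\<i> * s j) k = 0 \<and>
    ((\<lambda>T. lap (s j) T 0 x - exp (\<i> * k * of_real x) * lap (s j) T 0 0) \<longlongrightarrow> 0) at_top"
  proof
    fix j
    consider "Am = 0" "A3 < 0" | "Am > 0" "A3 = 0" using coeffs by (auto simp: admissible_coeffs_def)
    then show "\<exists>k. Im k > 0 \<and> dispoly Am A0 A1 A2 A3 (\<i> * s j) k = 0 \<and>
      ((\<lambda>T. lap (s j) T 0 x - exp (\<i> * k * of_real x) * lap (s j) T 0 0) \<longlongrightarrow> 0) at_top"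
    proof cases
      case 1
      show ?thesis
      proof (rule lap_decaying_mode_cubic[OF 1 s[of j] bdd])
        fix k assume k: "Im k > 0" "dispoly Am A0 A1 A2 A3 (\<i> * s j) k = 0"
          "\<And>x. x \<ge> 0 \<Longrightarrow> ((\<lambda>T. lap (s j) T 0 x - exp (\<i> * k * of_real x) * lap (s j) T 0 0) \<longlongrightarrow> 0) at_top"
        show ?thesis by (intro exI[of _ k] conjI k x)
      qed
    next
      case 2
      show ?thesis
      proof (rule lap_decaying_mode_mixed[OF 2 s[of j] bdd0])
        fix k assume k: "Im k > 0" "dispoly Am A0 A1 A2 A3 (\<i> * s j) k = 0"
          "\<And>x. x \<ge> 0 \<Longrightarrow> \<exists>B. \<forall>t\<ge>0. cmod (u x t) \<le> B \<Longrightarrow>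
            ((\<lambda>T. lap (s j) T 0 x - exp (\<i> * k * of_real x) * lap (s j) T 0 0) \<longlongrightarrow> 0) at_top"
        show ?thesis by (intro exI[of _ k] conjI k x bddx)
      qed
    qed
  qed
  from choice[OF this] obtain K where K: "\<And>j. Im (K j) > 0"
    "\<And>j. dispoly Am A0 A1 A2 A3 (\<i> * s j) (K j) = 0"
    "\<And>j. ((\<lambda>T. lap (s j) T 0 x - exp (\<i> * K j * of_real x) * lap (s j) T 0 0) \<longlongrightarrow> 0) at_top"
    by blast
  note k0' = k0[unfolded boundary_root_iff]
  \<comment> \<open>In the convention of waves exp (i (k x - \<omega> t)), growth at rate
    \<open>s j\<close> means frequency \<open>\<i> * s j\<close>, which approaches - n \<omega>0
    from the upper half-plane.\<close>
  have "\<i> * s j = of_real (- of_int n * \<omega>0) + \<i> * of_real (eps j)" for j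
    by (simp add: s_def algebra_simps)
  with K(2) have K2: "dispoly Am A0 A1 A2 A3 (of_real (- of_int n * \<omega>0) + \<i> * of_real (eps j)) (K j) = 0" for j
    by simp
  have "K \<longlonglongrightarrow> k0"
    by (rule upper_root_tendsto[OF coeffs admissible_freq_lead[OF freq] _ _ eps eps0 K(1) K2])
       (use k0' frontier_Dplus_radiation[OF AA] in auto)
  then have expK: "(\<lambda>j. exp (\<i> * K j * of_real x)) \<longlonglongrightarrow> exp (\<i> * k0 * of_real x)"
    by (intro tendsto_intros)
  let ?R = "{m. of_int m * \<omega>0 = of_int n * \<omega>0}"
  let ?M = "\<lambda>y p. laplace_mean (of_int n * \<omega>0) (eps (fst p)) (snd p) (u y)"
  have mean: "laplace_mean (of_int n * \<omega>0) (eps j) T (u y) = of_real (eps j) * lap (s j) T 0 y" for j T y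
    unfolding laplace_mean_def lap_def s_def by simp
  have u0: "fourier_asymp \<omega>0 (u 0) a"
  proof -
    \<comment> \<open>The boundary condition is imposed for t > 0 only, and asymptotics see only
      large t.\<close>
    have "\<forall>\<^sub>F t in at_top. g0 t = u 0 t"
      using eventually_gt_at_top[of 0] by eventually_elim (simp add: boundary_value)
    then have "\<forall>\<^sub>F t in at_top. g0 t - (\<Sum>\<^sub>\<infinity>n. a n * exp (\<i> * of_real (of_int n * \<omega>0 * t)))
      = u 0 t - (\<Sum>\<^sub>\<infinity>n. a n * exp (\<i> * of_real (of_int n * \<omega>0 * t)))"
      by eventually_elim simp
    then show ?thesis using g0 unfolding fourier_asymp_def by (blast intro: Lim_transform_eventually)
  qed
  have lim_x: "(?M x \<longlongrightarrow> (\<Sum>\<^sub>\<infinity>m\<in>?R. c m)) iterated_limit_filter"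
    by (rule fourier_asymp_laplace_mean[OF cont_u[OF x] ux eps eps0])
  have lim_0: "(?M 0 \<longlongrightarrow> (\<Sum>\<^sub>\<infinity>m\<in>?R. a m)) iterated_limit_filter"
    by (rule fourier_asymp_laplace_mean[OF cont_u[OF order_refl] u0 eps eps0])
  have lim_e: "((\<lambda>p. exp (\<i> * K (fst p) * of_real x)) \<longlongrightarrow> exp (\<i> * k0 * of_real x)) iterated_limit_filter"
    using tendsto_iterated[of "\<lambda>j T. exp (\<i> * K j * of_real x)", OF tendsto_const expK] by simp
  have "((\<lambda>p. of_real (eps (fst p)) * (lap (s (fst p)) (snd p) 0 x
      - exp (\<i> * K (fst p) * of_real x) * lap (s (fst p)) (snd p) 0 0)) \<longlongrightarrow> 0) iterated_limit_filter"
  proof (rule tendsto_iterated)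
    show "((\<lambda>T. of_real (eps j) * (lap (s j) T 0 x - exp (\<i> * K j * of_real x) * lap (s j) T 0 0)) \<longlongrightarrow> of_real (eps j) * 0) at_top" for j
      by (rule tendsto_mult[OF tendsto_const K(3)])
  qed simp
  then have "((\<lambda>p. ?M x p - exp (\<i> * K (fst p) * of_real x) * ?M 0 p) \<longlongrightarrow> 0) iterated_limit_filter"
    unfolding mean by (simp add: right_diff_distrib mult.left_commute)
  from tendsto_add[OF this tendsto_mult[OF lim_e lim_0]]
  have "(?M x \<longlongrightarrow> exp (\<i> * k0 * of_real x) * (\<Sum>\<^sub>\<infinity>m\<in>?R. a m)) iterated_limit_filter" by simp
  from tendsto_unique[OF iterated_limit_filter_nontrivial lim_x this] show ?thesis .
qed

text \<open>No uniform estimate in x is proved here. The mode identity holds at each point of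
  \<open>X\<close> and shows that the assumed series and the claimed one have equal sums, so the
  uniformity assumed for \<open>U\<close> carries over.\<close>

lemma wavemaker_asymptotics:
  fixes k0 :: "int \<Rightarrow> complex"
  assumes coeffs: "admissible_coeffs Am A3" and freq: "admissible_freq Am A2 \<omega>0"
    and k0: "\<And>n. boundary_root Am A0 A1 A2 A3 \<omega>0 n (k0 n)"
    and g0: "fourier_asymp \<omega>0 g0 a" and sol: "ibvp_solution Am A0 A1 A2 A3 (\<lambda>x. 0) g0 u"
    and bv: "\<And>j. fourier_asymp \<omega>0 (\<lambda>t. dx j u 0 t) (b j)"
    and X: "X \<subseteq> {0..}" and U: "fourier_asymp_on X \<omega>0 u U"
  shows "fourier_asymp_on X \<omega>0 u (\<lambda>n x. a n * exp (\<i> * k0 n * of_real x))"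
proof -
  interpret wavemaker Am A0 A1 A2 A3 g0 u by standard (rule sol)
  have AA: "Am \<ge> 0" "Am * A3 = 0" using coeffs by (auto simp: admissible_coeffs_def)
  have abs_a: "(\<lambda>n. norm (a n)) summable_on UNIV" using g0 by (simp add: fourier_asymp_def)
  have rad: "radiation_condition Am A0 A1 A2 A3 (k0 n)" for n
    using k0[of n] frontier_Dplus_radiation[OF AA] unfolding boundary_root_iff by blast
  have asymp: "fourier_asymp \<omega>0 (\<lambda>t. u x t) (\<lambda>n. U n x)" if "x \<in> X" for x
    unfolding fourier_asymp_def
  proof
    show "(\<lambda>n. norm (U n x)) summable_on UNIV" using U that by (simp add: fourier_asymp_on_def)
    show "((\<lambda>t. u x t - (\<Sum>\<^sub>\<infinity>n. U n x * exp (\<i> * of_real (of_int n * \<omega>0 * t)))) \<longlongrightarrow> 0) at_top"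
      using tendsto_uniform_limitI[OF U[unfolded fourier_asymp_on_def, THEN conjunct2] that] .
  qed
  have mode: "(\<Sum>\<^sub>\<infinity>m\<in>{m. of_int m * \<omega>0 = of_int n * \<omega>0}. U m x)
    = exp (\<i> * k0 n * of_real x) * (\<Sum>\<^sub>\<infinity>m\<in>{m. of_int m * \<omega>0 = of_int n * \<omega>0}. a m)" if "x \<in> X" for n x
    by (rule wavemaker_mode[OF coeffs freq k0 g0 bv _ asymp[OF that]]) (use X that in auto)
  have series: "(\<Sum>\<^sub>\<infinity>n. U n x * exp (\<i> * of_real (of_int n * \<omega>0 * t)))
    = (\<Sum>\<^sub>\<infinity>n. (a n * exp (\<i> * k0 n * of_real x)) * exp (\<i> * of_real (of_int n * \<omega>0 * t)))"
    if x: "x \<in> X" for x t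
  proof (cases "\<omega>0 = 0")
    case True
    \<comment> \<open>At zero frequency every \<open>k0 n\<close> is a radiating root of one and the
      same polynomial. They coincide, and the exponential factors out of the sum.\<close>
    have root: "dispoly Am A0 A1 A2 A3 (of_real (- of_int 0 * \<omega>0)) (k0 n) = 0" for n
      using k0[of n] unfolding boundary_root_iff True by simp
    have "k0 n = k0 0" for n
      by (rule radiation_root_unique[OF coeffs admissible_freq_lead[OF freq] root rad root rad])
    then obtain \<kappa> where \<kappa>: "\<And>n. k0 n = \<kappa>" by blast
    have "(\<Sum>\<^sub>\<infinity>n. U n x) = exp (\<i> * \<kappa> * of_real x) * (\<Sum>\<^sub>\<infinity>n. a n)"
      using mode[OF x, of 0] True by (simp add: \<kappa>)
    also have "\<dots> = (\<Sum>\<^sub>\<infinity>n. exp (\<i> * \<kappa> * of_real x) * a n)" by (rule infsum_cmult_right'[symmetric])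
    also have "\<dots> = (\<Sum>\<^sub>\<infinity>n. a n * exp (\<i> * k0 n * of_real x))" by (simp only: \<kappa> mult.commute)
    finally show ?thesis using True by simp
  next
    case False
    have "U n x = a n * exp (\<i> * k0 n * of_real x)" for n
    proof -
      have "{m. of_int m * \<omega>0 = of_int n * \<omega>0} = {n}" using False by auto
      then show ?thesis using mode[OF x, of n] by (simp add: mult.commute)
    qed
    then show ?thesis by simp
  qed
  show ?thesis unfolding fourier_asymp_on_def
  proof (intro conjI ballI)
    fix x assume x: "x \<in> X"
    show "(\<lambda>n. norm (a n * exp (\<i> * k0 n * of_real x))) summable_on UNIV"
    proof (rule Infinite_Sum.abs_summable_on_comparison_test[OF abs_a])
      fix n
      \<comment> \<open>Boundary roots have nonnegative imaginary part and x is nonnegative, so the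
        spatial factor has modulus at most 1 and absolute convergence is inherited from
        \<open>a\<close>.\<close>
      have "Im (k0 n) \<ge> 0" using rad[of n] unfolding radiation_condition_iff[OF AA] by auto
      then have "Im (k0 n) * x \<ge> 0" using x X by (intro mult_nonneg_nonneg) auto
      then have "cmod (exp (\<i> * k0 n * of_real x)) \<le> 1" by (simp add: norm_exp_eq_Re)
      then have "cmod (a n) * cmod (exp (\<i> * k0 n * of_real x)) \<le> cmod (a n) * 1" by (rule mult_left_mono) simp
      then show "cmod (a n * exp (\<i> * k0 n * of_real x)) \<le> cmod (a n)" by (simp add: norm_mult)
    qed
  next
    have "uniform_limit X (\<lambda>t x. u x t - (\<Sum>\<^sub>\<infinity>n. U n x * exp (\<i> * of_real (of_int n * \<omega>0 * t)))) (\<lambda>x. 0) at_top"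
      using U by (simp add: fourier_asymp_on_def)
    then show "uniform_limit X (\<lambda>t x. u x t - (\<Sum>\<^sub>\<infinity>n. (a n * exp (\<i> * k0 n * of_real x))
       * exp (\<i> * of_real (of_int n * \<omega>0 * t)))) (\<lambda>x. 0) at_top"
      by (subst (asm) uniform_limit_cong'[OF _ refl]) (simp_all only: series)
  qed
qed

theorem corollary1p1:
  fixes Am A0 A1 A2 A3 :: real
  assumes "admissible_coeffs Am A3"
  shows
    "(\<forall>(\<omega>0::real) (k0 :: int \<Rightarrow> complex).
        admissible_freq Am A2 \<omega>0 \<and> (\<forall>n. boundary_root Am A0 A1 A2 A3 \<omega>0 n (k0 n)) \<longrightarrow>
          (\<forall>n. dispersion Am A0 A1 A2 A3 (k0 n) (of_real (- of_int n * \<omega>0)) \<and>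
               (\<forall>k. dispersion Am A0 A1 A2 A3 k (of_real (- of_int n * \<omega>0)) \<longrightarrow>
                      (k = k0 n \<longleftrightarrow> radiation_condition Am A0 A1 A2 A3 k))) \<and>
          (\<forall>(g0 :: real \<Rightarrow> complex) (a :: int \<Rightarrow> complex) (u :: real \<Rightarrow> real \<Rightarrow> complex)
             (U :: int \<Rightarrow> real \<Rightarrow> complex) (b :: nat \<Rightarrow> int \<Rightarrow> complex) (X :: real set).
               smooth_on_set {0<..} g0 \<and> fourier_asymp \<omega>0 g0 a \<and>
               ibvp_solution Am A0 A1 A2 A3 (\<lambda>x. 0) g0 u \<and>
               (\<forall>j. fourier_asymp \<omega>0 (\<lambda>t. dx j u 0 t) (b j)) \<and>
               X \<subseteq> {0..} \<and> bounded X \<and> fourier_asymp_on X \<omega>0 u U \<longrightarrow>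
                 fourier_asymp_on X \<omega>0 u (\<lambda>n x. a n * exp (\<i> * k0 n * of_real x)))) \<and>
     (\<exists>\<omega>m \<omega>p :: real. \<forall>(\<omega>0::real) k.
        admissible_freq Am A2 \<omega>0 \<and> boundary_root Am A0 A1 A2 A3 \<omega>0 1 k \<longrightarrow>
          (Im k = 0 \<longleftrightarrow> \<omega>m \<le> \<omega>0 \<and> \<omega>0 \<le> \<omega>p))"
proof (intro conjI allI impI; (elim conjE)?)
  fix \<omega>0 and k0 :: "int \<Rightarrow> complex" and n :: int
  assume freq: "admissible_freq Am A2 \<omega>0" and "\<forall>n. boundary_root Am A0 A1 A2 A3 \<omega>0 n (k0 n)"
  then have k0: "boundary_root Am A0 A1 A2 A3 \<omega>0 n (k0 n)" by blast
  show "dispersion Am A0 A1 A2 A3 (k0 n) (of_real (- of_int n * \<omega>0))"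
    by (rule boundary_root_characterization(1)[OF assms freq k0])
  show "k = k0 n \<longleftrightarrow> radiation_condition Am A0 A1 A2 A3 k"
    if "dispersion Am A0 A1 A2 A3 k (of_real (- of_int n * \<omega>0))" for k
    by (rule boundary_root_characterization(2)[OF assms freq k0 that])
next
  fix \<omega>0 k0 g0 a u U b X
  assume "admissible_freq Am A2 \<omega>0" "\<forall>n. boundary_root Am A0 A1 A2 A3 \<omega>0 n (k0 n)"
    "fourier_asymp \<omega>0 g0 a" "ibvp_solution Am A0 A1 A2 A3 (\<lambda>x. 0) g0 u"
    "\<forall>j. fourier_asymp \<omega>0 (\<lambda>t. dx j u 0 t) (b j)" "X \<subseteq> {0..}" "fourier_asymp_on X \<omega>0 u U"
  then show "fourier_asymp_on X \<omega>0 u (\<lambda>n x. a n * exp (\<i> * k0 n * of_real x))"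
    by (intro wavemaker_asymptotics[OF assms]) blast+
next
  show "\<exists>\<omega>m \<omega>p :: real. \<forall>(\<omega>0::real) k.
        admissible_freq Am A2 \<omega>0 \<and> boundary_root Am A0 A1 A2 A3 \<omega>0 1 k \<longrightarrow>
          (Im k = 0 \<longleftrightarrow> \<omega>m \<le> \<omega>0 \<and> \<omega>0 \<le> \<omega>p)"
    using assms boundary_root_real_range_cubic boundary_root_real_range_mixed
    unfolding admissible_coeffs_def by (elim disjE conjE) simp_all
qed

end
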